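(* Suppose $(G,X,H)$ is an A/QI triple, where $X$ is a Gromov hyperbolic graph on which $G$ acts by graph automorphisms, and fix a vertex $x\in X$. Let $\mathcal H=\{gHx\mid gH\in G/H\}$. Let $\hat X$ be the cone-off of $X$ with respect to $\mathcal H$. Then $\partial\hat X$ is homeomorphic to the subspace $\partial X\setminus\bigcup_{g\in G}\Lambda(gHg^{-1})$ of $\partial X$ obtained by deleting the limit sets of all the conjugates of $H$.
   Context: Graphs are connected and metrized with all edges of length 1. A hyperbolic space is a Gromov hyperbolic geodesic metric space $(X,d)$; all actions are by isometries. For $Y\subseteq X$, an action $G\curvearrowright X$ is acylindrical along $Y$ if for every $\varepsilon\ge 0$ there are $R>0$ and $M>0$ so that, whenever $x,y\in Y$ satisfy $d(x,y)\ge R$, $\#\{g\in G\mid d(gx,x)\le\varepsilon \text{ and } d(gy,y)\le\varepsilon\}\le M$. For $H<G$, the action is acylindrical along $H$ if it is acylindrical along $Hx$ for some (equivalently any) $x\in X$. A finitely generated subgroup $H<G$ is quasi-isometrically embedded by the action if, for some (equivalently any) $x\in X$, $h\mapsto hx$ is a quasi-isometric embedding of $H$ (with a word metric) into $X$. An A/QI triple $(G,X,H)$ consists of a hyperbolic space $X$ and an action $G\curvearrowright X$ which is acylindrical along a finitely generated infinite subgroup $H<G$ that is quasi-isometrically embedded by the action. Cone-off: the cone-off $\hat X$ of $X$ with respect to a collection $\mathcal H$ is the graph obtained from $X$ by adding an edge (of length 1) between each pair of distinct vertices that both lie in a common element of $\mathcal H$. In the present situation $\hat X$ is known to be Gromov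 hyperbolic. $\partial$ denotes the Gromov boundary (equivalence classes of sequences converging to infinity) with its usual topology. For $T\subseteq G$, the limit set $\Lambda(T)\subseteq\partial X$ is the set of all limits in $\partial X$ of sequences $t_nx_0$ with $t_n\in T$, for a base point $x_0$ (independent of $x_0$). *)

theory Defs
  imports
    "HOL-Analysis.Analysis"
    "HOL-Algebra.Group_Action"
    "HOL-Algebra.Generated_Groups"
begin

definition geodesic_space :: "'a set \<Rightarrow> ('a \<Rightarrow> 'a \<Rightarrow> real) \<Rightarrow> bool" where
  "geodesic_space M d \<longleftrightarrow> (\<forall>x\<in>M. \<forall>y\<in>M. \<exists>\<gamma>::real \<Rightarrow> 'a.
     \<gamma> 0 = x \<and> \<gamma> (d x y) = y \<and> \<gamma> ` {0..d x y} \<subseteq> M \<and>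
     (\<forall>s\<in>{0..d x y}. \<forall>t\<in>{0..d x y}. d (\<gamma> s) (\<gamma> t) = \<bar>s - t\<bar>))"

definition gromov_product :: "('a \<Rightarrow> 'a \<Rightarrow> real) \<Rightarrow> 'a \<Rightarrow> 'a \<Rightarrow> 'a \<Rightarrow> real" where
  "gromov_product d w x y = (d x w + d y w - d x y) / 2"

definition gromov_hyperbolic :: "'a set \<Rightarrow> ('a \<Rightarrow> 'a \<Rightarrow> real) \<Rightarrow> bool" where
  "gromov_hyperbolic M d \<longleftrightarrow> (\<exists>\<delta>\<ge>0. \<forall>w\<in>M. \<forall>x\<in>M. \<forall>y\<in>M. \<forall>z\<in>M.
     gromov_product d w x z \<ge> min (gromov_product d w x y) (gromov_product d w y z) - \<delta>)"

definition hyperbolic_space :: "'a set \<Rightarrow> ('a \<Rightarrow> 'a \<Rightarrow> real) \<Rightarrow> bool" where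
  "hyperbolic_space M d \<longleftrightarrow> Metric_space M d \<and> geodesic_space M d \<and> gromov_hyperbolic M d"

text \<open>
  The point \<open>w\<close> below is a base point in \<open>M\<close>. Gromov products change by a bounded amount with
  \<open>w\<close>; the boundary, its topology and limit sets do not depend on it.
\<close>

definition seqs_to_infinity :: "'a set \<Rightarrow> ('a \<Rightarrow> 'a \<Rightarrow> real) \<Rightarrow> 'a \<Rightarrow> (nat \<Rightarrow> 'a) set" where
  "seqs_to_infinity M d w = {y. range y \<subseteq> M \<and>
     filterlim (\<lambda>(i, j). gromov_product d w (y i) (y j)) at_top (sequentially \<times>\<^sub>F sequentially)}"

definition boundary_rel ::
    "'a set \<Rightarrow> ('a \<Rightarrow> 'a \<Rightarrow> real) \<Rightarrow> 'a \<Rightarrow> ((nat \<Rightarrow> 'a) \<times> (nat \<Rightarrow> 'a)) set" where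
  "boundary_rel M d w = {(y, z). y \<in> seqs_to_infinity M d w \<and> z \<in> seqs_to_infinity M d w \<and>
     filterlim (\<lambda>(i, j). gromov_product d w (y i) (z j)) at_top (sequentially \<times>\<^sub>F sequentially)}"

definition gromov_boundary ::
    "'a set \<Rightarrow> ('a \<Rightarrow> 'a \<Rightarrow> real) \<Rightarrow> 'a \<Rightarrow> (nat \<Rightarrow> 'a) set set" where
  "gromov_boundary M d w = seqs_to_infinity M d w // boundary_rel M d w"

definition boundary_product ::
    "('a \<Rightarrow> 'a \<Rightarrow> real) \<Rightarrow> 'a \<Rightarrow> (nat \<Rightarrow> 'a) set \<Rightarrow> (nat \<Rightarrow> 'a) set \<Rightarrow> ereal" where
  "boundary_product d w \<xi> \<eta> = (SUP (y, z)\<in>\<xi> \<times> \<eta>.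
     Liminf (sequentially \<times>\<^sub>F sequentially) (\<lambda>(i, j). ereal (gromov_product d w (y i) (z j))))"

text \<open>
  In the usual topology the sets \<open>{\<eta>. (\<xi>|\<eta>) > r}\<close> form a neighbourhood base at \<open>\<xi>\<close>.
\<close>

definition boundary_topology ::
    "'a set \<Rightarrow> ('a \<Rightarrow> 'a \<Rightarrow> real) \<Rightarrow> 'a \<Rightarrow> (nat \<Rightarrow> 'a) set topology" where
  "boundary_topology M d w = topology (\<lambda>U. U \<subseteq> gromov_boundary M d w \<and>
     (\<forall>\<xi>\<in>U. \<exists>r::real. \<forall>\<eta>\<in>gromov_boundary M d w. boundary_product d w \<xi> \<eta> > ereal r \<longrightarrow> \<eta> \<in> U))"

lemma openin_boundary_topology:
  "openin (boundary_topology M d w) U \<longleftrightarrow> U \<subseteq> gromov_boundary M d w \<and>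
     (\<forall>\<xi>\<in>U. \<exists>r::real. \<forall>\<eta>\<in>gromov_boundary M d w. boundary_product d w \<xi> \<eta> > ereal r \<longrightarrow> \<eta> \<in> U)"
proof -
  have "istopology (\<lambda>U. U \<subseteq> gromov_boundary M d w \<and> (\<forall>\<xi>\<in>U. \<exists>r::real.
      \<forall>\<eta>\<in>gromov_boundary M d w. boundary_product d w \<xi> \<eta> > ereal r \<longrightarrow> \<eta> \<in> U))"
    (is "istopology ?P")
    unfolding istopology_def
  proof (rule conjI; intro allI impI)
    fix S T assume S: "?P S" and T: "?P T"
    show "?P (S \<inter> T)"
    proof (intro conjI ballI)
      show "S \<inter> T \<subseteq> gromov_boundary M d w" using S by blast
      fix \<xi> assume \<xi>: "\<xi> \<in> S \<inter> T"
      obtain r where r: "\<forall>\<eta>\<in>gromov_boundary M d w. boundary_product d w \<xi> \<eta> > ereal r \<longrightarrow> \<eta> \<in> S"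
        using S \<xi> by blast
      obtain s where s: "\<forall>\<eta>\<in>gromov_boundary M d w. boundary_product d w \<xi> \<eta> > ereal s \<longrightarrow> \<eta> \<in> T"
        using T \<xi> by blast
      show "\<exists>r::real. \<forall>\<eta>\<in>gromov_boundary M d w. boundary_product d w \<xi> \<eta> > ereal r \<longrightarrow> \<eta> \<in> S \<inter> T"
      proof (intro exI ballI impI)
        fix \<eta> assume \<eta>: "\<eta> \<in> gromov_boundary M d w"
          and gt: "boundary_product d w \<xi> \<eta> > ereal (max r s)"
        have "ereal r \<le> ereal (max r s)" "ereal s \<le> ereal (max r s)" by simp_all
        with gt have "boundary_product d w \<xi> \<eta> > ereal r" "boundary_product d w \<xi> \<eta> > ereal s"
          by (meson le_less_trans)+
        with r s \<eta> show "\<eta> \<in> S \<inter> T" by blast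
      qed
    qed
  next
    fix \<U> assume "\<forall>U\<in>\<U>. ?P U"
    then show "?P (\<Union>\<U>)" by (meson Union_iff Union_least)
  qed
  then show ?thesis
    unfolding boundary_topology_def by (simp add: topology_inverse')
qed

text \<open>
  A sequence converges to the point \<open>\<xi>\<close> of the boundary iff it is a sequence converging to
  infinity whose class is \<open>\<xi>\<close>.
\<close>

definition limit_set ::
    "'a set \<Rightarrow> ('a \<Rightarrow> 'a \<Rightarrow> real) \<Rightarrow> 'a \<Rightarrow> ('g \<Rightarrow> 'a \<Rightarrow> 'a) \<Rightarrow> 'g set \<Rightarrow> (nat \<Rightarrow> 'a) set set" where
  "limit_set M d w \<psi> T = {boundary_rel M d w `` {\<lambda>n. \<psi> (t n) w} | t.
     range t \<subseteq> T \<and> (\<lambda>n. \<psi> (t n) w) \<in> seqs_to_infinity M d w}"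

definition isometric_action ::
    "('g, 'm) monoid_scheme \<Rightarrow> 'a set \<Rightarrow> ('a \<Rightarrow> 'a \<Rightarrow> real) \<Rightarrow> ('g \<Rightarrow> 'a \<Rightarrow> 'a) \<Rightarrow> bool" where
  "isometric_action G M d \<psi> \<longleftrightarrow> group_action G M \<psi> \<and>
     (\<forall>g\<in>carrier G. \<forall>x\<in>M. \<forall>y\<in>M. d (\<psi> g x) (\<psi> g y) = d x y)"

definition acylindrical_along ::
    "('g, 'm) monoid_scheme \<Rightarrow> ('a \<Rightarrow> 'a \<Rightarrow> real) \<Rightarrow> ('g \<Rightarrow> 'a \<Rightarrow> 'a) \<Rightarrow> 'a set \<Rightarrow> bool" where
  "acylindrical_along G d \<psi> Y \<longleftrightarrow>
     (\<forall>\<epsilon>::real. \<epsilon> \<ge> 0 \<longrightarrow> (\<exists>R::real. \<exists>N::nat. R > 0 \<and> N > 0 \<and>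
       (\<forall>x\<in>Y. \<forall>y\<in>Y. d x y \<ge> R \<longrightarrow>
         finite {g \<in> carrier G. d (\<psi> g x) x \<le> \<epsilon> \<and> d (\<psi> g y) y \<le> \<epsilon>} \<and>
         card {g \<in> carrier G. d (\<psi> g x) x \<le> \<epsilon> \<and> d (\<psi> g y) y \<le> \<epsilon>} \<le> N)))"

definition acylindrical_along_subgroup ::
    "('g, 'm) monoid_scheme \<Rightarrow> 'a set \<Rightarrow> ('a \<Rightarrow> 'a \<Rightarrow> real) \<Rightarrow> ('g \<Rightarrow> 'a \<Rightarrow> 'a) \<Rightarrow> 'g set \<Rightarrow> bool" where
  "acylindrical_along_subgroup G M d \<psi> H \<longleftrightarrow>
     (\<exists>x\<in>M. acylindrical_along G d \<psi> ((\<lambda>h. \<psi> h x) ` H))"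

definition word_length :: "('g, 'm) monoid_scheme \<Rightarrow> 'g set \<Rightarrow> 'g \<Rightarrow> nat" where
  "word_length G S h = (LEAST n. \<exists>ws. length ws = n \<and>
     set ws \<subseteq> S \<union> (\<lambda>s. inv\<^bsub>G\<^esub> s) ` S \<and> foldr (\<otimes>\<^bsub>G\<^esub>) ws \<one>\<^bsub>G\<^esub> = h)"

definition word_metric :: "('g, 'm) monoid_scheme \<Rightarrow> 'g set \<Rightarrow> 'g \<Rightarrow> 'g \<Rightarrow> real" where
  "word_metric G S h k = real (word_length G S (inv\<^bsub>G\<^esub> h \<otimes>\<^bsub>G\<^esub> k))"

definition quasi_isometric_embedding ::
    "'a set \<Rightarrow> ('a \<Rightarrow> 'a \<Rightarrow> real) \<Rightarrow> 'b set \<Rightarrow> ('b \<Rightarrow> 'b \<Rightarrow> real) \<Rightarrow> ('a \<Rightarrow> 'b) \<Rightarrow> bool" where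
  "quasi_isometric_embedding A dA B dB f \<longleftrightarrow> f ` A \<subseteq> B \<and>
     (\<exists>K\<ge>1. \<exists>C\<ge>0. \<forall>a\<in>A. \<forall>b\<in>A.
       dA a b / K - C \<le> dB (f a) (f b) \<and> dB (f a) (f b) \<le> K * dA a b + C)"

definition finite_generating_set :: "('g, 'm) monoid_scheme \<Rightarrow> 'g set \<Rightarrow> 'g set \<Rightarrow> bool" where
  "finite_generating_set G S H \<longleftrightarrow> finite S \<and> S \<subseteq> H \<and> generate G S = H"

definition qi_embedded_by_action ::
    "('g, 'm) monoid_scheme \<Rightarrow> 'a set \<Rightarrow> ('a \<Rightarrow> 'a \<Rightarrow> real) \<Rightarrow> ('g \<Rightarrow> 'a \<Rightarrow> 'a) \<Rightarrow> 'g set \<Rightarrow> bool" where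
  "qi_embedded_by_action G M d \<psi> H \<longleftrightarrow> (\<exists>S. finite_generating_set G S H \<and>
     (\<exists>x\<in>M. quasi_isometric_embedding H (word_metric G S) M d (\<lambda>h. \<psi> h x)))"

text \<open>
  \<^const>\<open>qi_embedded_by_action\<close> includes that \<open>H\<close> is finitely generated.
\<close>

definition AQI_triple ::
    "('g, 'm) monoid_scheme \<Rightarrow> 'a set \<Rightarrow> ('a \<Rightarrow> 'a \<Rightarrow> real) \<Rightarrow> ('g \<Rightarrow> 'a \<Rightarrow> 'a) \<Rightarrow> 'g set \<Rightarrow> bool" where
  "AQI_triple G M d \<psi> H \<longleftrightarrow> hyperbolic_space M d \<and> isometric_action G M d \<psi> \<and>
     subgroup H G \<and> infinite H \<and>
     acylindrical_along_subgroup G M d \<psi> H \<and> qi_embedded_by_action G M d \<psi> H"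

definition simple_graph :: "'v set \<Rightarrow> 'v set set \<Rightarrow> bool" where
  "simple_graph V E \<longleftrightarrow> (\<forall>e\<in>E. e \<subseteq> V \<and> card e = 2)"

definition connected_graph :: "'v set \<Rightarrow> 'v set set \<Rightarrow> bool" where
  "connected_graph V E \<longleftrightarrow> simple_graph V E \<and> (\<forall>u\<in>V. \<forall>v\<in>V. (u, v) \<in> {(a, b). {a, b} \<in> E}\<^sup>*)"

text \<open>
  Points of the geometric realization are given by barycentric coordinates: the vertex \<open>v\<close> is
  the indicator function of \<open>{v}\<close>, and the points of an edge \<open>{u, v}\<close> are the convex
  combinations of its endpoints.
\<close>

definition supp :: "('v \<Rightarrow> real) \<Rightarrow> 'v set" where
  "supp p = {v. p v \<noteq> 0}"

definition realization :: "'v set \<Rightarrow> 'v set set \<Rightarrow> ('v \<Rightarrow> real) set" where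
  "realization V E = {p. (\<forall>v. p v \<ge> 0) \<and> supp p \<in> (\<lambda>v. {v}) ` V \<union> E \<and> (\<Sum>v\<in>supp p. p v) = 1}"

definition vertex_point :: "'v \<Rightarrow> 'v \<Rightarrow> real" where
  "vertex_point v = (\<lambda>w. if w = v then 1 else 0)"

text \<open>
  Each edge is isometric to the unit interval: for two points of an edge \<open>{u, v}\<close>, both
  coordinates differ by the same amount, hence the factor one half. The distance on the
  realization is the resulting path metric, the infimum of the lengths of chains of points
  whose consecutive members lie on a common edge. It is set to 0 outside the realization
  because \<^const>\<open>Metric_space\<close> requires nonnegativity and symmetry for all arguments.
\<close>

definition on_common_edge :: "'v set set \<Rightarrow> ('v \<Rightarrow> real) \<Rightarrow> ('v \<Rightarrow> real) \<Rightarrow> bool" where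
  "on_common_edge E p q \<longleftrightarrow> (\<exists>e\<in>E. supp p \<union> supp q \<subseteq> e)"

definition edge_dist :: "('v \<Rightarrow> real) \<Rightarrow> ('v \<Rightarrow> real) \<Rightarrow> real" where
  "edge_dist p q = (\<Sum>v\<in>supp p \<union> supp q. \<bar>p v - q v\<bar>) / 2"

fun chain_length :: "('v \<Rightarrow> real) list \<Rightarrow> real" where
  "chain_length (p # q # ps) = edge_dist p q + chain_length (q # ps)"
| "chain_length _ = 0"

definition edge_chains :: "'v set \<Rightarrow> 'v set set \<Rightarrow> ('v \<Rightarrow> real) \<Rightarrow> ('v \<Rightarrow> real) \<Rightarrow> ('v \<Rightarrow> real) list set" where
  "edge_chains V E p q = {ps. ps \<noteq> [] \<and> hd ps = p \<and> last ps = q \<and>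
     set ps \<subseteq> realization V E \<and> successively (on_common_edge E) ps}"

definition graph_dist :: "'v set \<Rightarrow> 'v set set \<Rightarrow> ('v \<Rightarrow> real) \<Rightarrow> ('v \<Rightarrow> real) \<Rightarrow> real" where
  "graph_dist V E p q = (if p \<in> realization V E \<and> q \<in> realization V E
     then (INF ps\<in>edge_chains V E p q. chain_length ps) else 0)"

definition acts_by_graph_automorphisms ::
    "('g, 'm) monoid_scheme \<Rightarrow> 'v set \<Rightarrow> 'v set set \<Rightarrow> ('g \<Rightarrow> 'v \<Rightarrow> 'v) \<Rightarrow> bool" where
  "acts_by_graph_automorphisms G V E \<phi> \<longleftrightarrow> group_action G V \<phi> \<and>
     (\<forall>g\<in>carrier G. \<forall>u\<in>V. \<forall>v\<in>V. {\<phi> g u, \<phi> g v} \<in> E \<longleftrightarrow> {u, v} \<in> E)"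

text \<open>
  The action on the realization is the affine extension of the action on vertices; an element
  \<open>g\<close> moves the coordinate at \<open>v\<close> to \<open>g v\<close>.
\<close>

definition realization_action ::
    "('g, 'm) monoid_scheme \<Rightarrow> 'v set \<Rightarrow> 'v set set \<Rightarrow> ('g \<Rightarrow> 'v \<Rightarrow> 'v) \<Rightarrow>
     'g \<Rightarrow> ('v \<Rightarrow> real) \<Rightarrow> ('v \<Rightarrow> real)" where
  "realization_action G V E \<phi> g = (\<lambda>p\<in>realization V E.
     \<lambda>w. if w \<in> V then p (\<phi> (inv\<^bsub>G\<^esub> g) w) else 0)"

definition cone_off :: "'v set set \<Rightarrow> 'v set set \<Rightarrow> 'v set set" where
  "cone_off E \<H> = E \<union> {{u, v} | u v A. A \<in> \<H> \<and> u \<in> A \<and> v \<in> A \<and> u \<noteq> v}"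

definition coset_orbits ::
    "('g, 'm) monoid_scheme \<Rightarrow> ('g \<Rightarrow> 'v \<Rightarrow> 'v) \<Rightarrow> 'g set \<Rightarrow> 'v \<Rightarrow> 'v set set" where
  "coset_orbits G \<phi> H x = {(\<lambda>k. \<phi> k x) ` (g <#\<^bsub>G\<^esub> H) | g. g \<in> carrier G}"

end

theory Submission
  imports Defs "HOL-Real_Asymp.Real_Asymp"
begin

text \<open>
  Write \<open>(u|v)\<^sub>p\<close> for Gromov products in \<open>X\<close> and \<open>(u|v)'\<^sub>p\<close> for those in the cone-off, both taken
  on vertices. The orbits \<open>gHx\<close> are uniformly quasiconvex, so geodesics of \<open>X\<close> are unparametrized
  quasi-geodesics of the cone-off, which amounts to the single inequality
  \<open>(u|v)'\<^sub>p \<le> (u|v)\<^sub>p + C\<close> for all \<open>u\<close>, \<open>v\<close>, \<open>p\<close>. Applied at the centre \<open>p\<close> of the triangle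
  \<open>o\<close>, \<open>u\<close>, \<open>v\<close> of \<open>X\<close> it shows that \<open>(u|v)'\<^sub>o\<close> is the cone-off distance from \<open>o\<close> to \<open>p\<close> up to a
  constant. Hence \<open>(u|v)\<^sub>o \<le> (u|w)\<^sub>o\<close> implies \<open>(u|v)'\<^sub>o - C \<le> (u|w)'\<^sub>o\<close>, which yields hyperbolicity of
  the cone-off and makes the map from its boundary to the boundary of \<open>X\<close> a homeomorphism onto its
  image. Points in limit sets of conjugates of \<open>H\<close> are limits of sequences bounded in the cone-off,
  hence not in the image. Conversely, the centres along a sequence converging to a point outside the
  image may be chosen bounded in the cone-off, and acylindricity traps such a sequence in a single
  orbit \<open>gHx\<close>, so its limit lies in the limit set of a conjugate.
\<close>

section \<open>Discrete hyperbolic metrics\<close>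

text \<open>The obstacle is that the two Gromov products compare in one direction only: points of
  one orbit \<open>gHx\<close> are at cone-off distance at most 1, however far apart they are in X.
  So there is no quasi-isometry to transport boundaries, and as X need not be locally finite,
  compactness cannot turn a continuous bijection into a homeomorphism. Continuity of the inverse
  comes instead from the order of the products at a base point, which coning preserves up to a
  constant because a centre of a triangle in X remains, roughly, a centre in the cone-off. A second
  difficulty: edges of the cone-off can be arbitrarily long in X, so its geodesics are not
  quasi-geodesics of X and the usual stability theorem does not cover them. What survives is that
  every point of an X-geodesic between the ends of such an edge is close, in the cone-off, to those
  ends. Stability is therefore proved for a pair of distances \<open>e\<close> and \<open>d\<close>
  with \<open>e\<close> at most \<open>d\<close>: avoidance of a ball is measured in
  \<open>e\<close>, hyperbolicity is used in \<open>d\<close>. Boundaries see products only up to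
  bounded error, so all geometry takes place on vertices, with integer distances and discrete
  geodesics.\<close>

locale coarse_hyperbolic =
  fixes V :: "'v set" and d :: "'v \<Rightarrow> 'v \<Rightarrow> real" and \<delta> :: real
  assumes refl: "d u u = 0"
    and sym: "d u v = d v u"
    and tri: "\<lbrakk>u \<in> V; v \<in> V; w \<in> V\<rbrakk> \<Longrightarrow> d u w \<le> d u v + d v w"
    and delta_pos: "\<delta> > 0"
    and four_point: "\<lbrakk>p \<in> V; u \<in> V; v \<in> V; w \<in> V\<rbrakk> \<Longrightarrow>
      min (gromov_product d p u v) (gromov_product d p v w) - \<delta> \<le> gromov_product d p u w"
    and discrete_geodesic: "\<lbrakk>u \<in> V; v \<in> V\<rbrakk> \<Longrightarrow> \<exists>f n. f 0 = u \<and> f n = v \<and> real n = d u v \<and>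
      (\<forall>i\<le>n. f i \<in> V) \<and> (\<forall>i\<le>n. \<forall>j\<le>n. d (f i) (f j) = \<bar>real i - real j\<bar>)"
begin

lemma gp_sym: "gromov_product d p u v = gromov_product d p v u"
  by (simp add: gromov_product_def sym[of u v])

lemma gp_nonneg: "\<lbrakk>p \<in> V; u \<in> V; v \<in> V\<rbrakk> \<Longrightarrow> 0 \<le> gromov_product d p u v"
  using tri[of u p v] sym[of p v] by (simp add: gromov_product_def)

lemma gp_le_dist: "\<lbrakk>p \<in> V; u \<in> V; v \<in> V\<rbrakk> \<Longrightarrow> gromov_product d p u v \<le> d p u"
  using tri[of p u v] sym[of p u] sym[of p v] by (simp add: gromov_product_def)

lemma gp_lipschitz_left:
  "\<lbrakk>p \<in> V; u \<in> V; u' \<in> V; v \<in> V\<rbrakk> \<Longrightarrow> gromov_product d p u v \<le> gromov_product d p u' v + d u u'"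
  using tri[of u u' p] tri[of u' u v] sym[of u u'] by (auto simp: gromov_product_def field_simps)

lemma dist_le_gp: "\<lbrakk>p \<in> V; u \<in> V; v \<in> V\<rbrakk> \<Longrightarrow> d p u \<le> gromov_product d p u v + d u v"
  using tri[of u v p] sym[of p u] by (auto simp: gromov_product_def field_simps)

text \<open>Bisection: each halving of the chain costs one \<open>\<delta>\<close> by the four-point
  condition. The loss is thus logarithmic in the number of steps, which is what the bootstrap for
  quasi-geodesics relies on.\<close>

lemma gp_chain_log:
  assumes "n \<noteq> 0" "n \<le> 2 ^ k" "p \<in> V" "\<forall>i\<in>{a..a+n}. f i \<in> V"
  shows "\<exists>i\<in>{a..<a+n}. gromov_product d p (f i) (f (Suc i)) \<le> gromov_product d p (f a) (f (a + n)) + k * \<delta>"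
  using assms
proof (induction k arbitrary: a n)
  case 0
  then have "n = 1" by simp
  then show ?case by auto
next
  case (Suc k)
  show ?case
  proof (cases "n = 1")
    case True
    then show ?thesis using delta_pos by auto
  next
    case False
    define m where "m = n div 2"
    have m: "m \<noteq> 0" "m \<le> 2 ^ k" "n - m \<noteq> 0" "n - m \<le> 2 ^ k" "m \<le> n"
      using Suc.prems(1,2) False by (auto simp: m_def)
    have 1: "\<exists>i\<in>{a..<a+m}. gromov_product d p (f i) (f (Suc i)) \<le> gromov_product d p (f a) (f (a + m)) + k * \<delta>"
      by (rule Suc.IH) (use m Suc.prems in auto)
    have 2: "\<exists>i\<in>{a+m..<(a+m)+(n-m)}. gromov_product d p (f i) (f (Suc i))
        \<le> gromov_product d p (f (a+m)) (f ((a + m) + (n-m))) + k * \<delta>"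
      by (rule Suc.IH) (use m Suc.prems in auto)
    have "min (gromov_product d p (f a) (f (a+m))) (gromov_product d p (f (a+m)) (f (a+n))) - \<delta>
        \<le> gromov_product d p (f a) (f (a+n))"
      by (rule four_point) (use m Suc.prems in auto)
    then consider "gromov_product d p (f a) (f (a+m)) \<le> gromov_product d p (f a) (f (a+n)) + \<delta>"
      | "gromov_product d p (f (a+m)) (f (a+n)) \<le> gromov_product d p (f a) (f (a+n)) + \<delta>"
      by (auto simp: min_def split: if_splits)
    then show ?thesis
    proof cases
      case 1
      obtain i where i: "i\<in>{a..<a+m}" "gromov_product d p (f i) (f (Suc i)) \<le> gromov_product d p (f a) (f (a + m)) + k * \<delta>"
        using \<open>\<exists>i\<in>{a..<a+m}. _ i\<close> by blast
      then have "i \<in> {a..<a+n}" using m by auto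
      moreover have "gromov_product d p (f i) (f (Suc i)) \<le> gromov_product d p (f a) (f (a+n)) + real (Suc k) * \<delta>"
        using i(2) 1 by (simp add: algebra_simps)
      ultimately show ?thesis by blast
    next
      case 2
      obtain i where i: "i\<in>{a+m..<a+n}" "gromov_product d p (f i) (f (Suc i)) \<le> gromov_product d p (f (a+m)) (f (a + n)) + k * \<delta>"
        using \<open>\<exists>i\<in>{a+m..<(a+m)+(n-m)}. _ i\<close> m(5) by auto
      then have "i \<in> {a..<a+n}" using m by auto
      moreover have "gromov_product d p (f i) (f (Suc i)) \<le> gromov_product d p (f a) (f (a+n)) + real (Suc k) * \<delta>"
        using i(2) 2 by (simp add: algebra_simps)
      ultimately show ?thesis by blast
    qed
  qed
qed

text \<open>The product of \<open>q\<close>, \<open>u\<close> at \<open>p\<close> and that of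
  \<open>p\<close>, \<open>u\<close> at \<open>q\<close> add up to \<open>d p q\<close>, so an upper
  bound for one is a lower bound for the other. Geometrically: a point \<open>q\<close> near a
  geodesic from \<open>p\<close> to \<open>u\<close>, and not much beyond the place where it
  separates from a geodesic to \<open>v\<close>, is also near the latter.\<close>

lemma push_along:
  assumes V: "p \<in> V" "q \<in> V" "u \<in> V" "v \<in> V"
    and "gromov_product d q p u \<le> a" "d p q \<le> gromov_product d p u v + a"
  shows "gromov_product d q p v \<le> a + \<delta>"
proof -
  have "min (gromov_product d p q u) (gromov_product d p u v) - \<delta> \<le> gromov_product d p q v"
    by (rule four_point) (use V in auto)
  then show ?thesis
    using assms(5,6) sym[of p q] sym[of u p] sym[of u q] sym[of v p] sym[of v q] 
    by (auto simp: gromov_product_def min_def field_simps split: if_splits)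
qed

lemma center_at:
  assumes V: "p \<in> V" "u \<in> V" "v \<in> V"
    and geo: "f 0 = p" "f n = u" "real n = d p u" "\<forall>i\<le>n. f i \<in> V"
      "\<forall>i\<le>n. \<forall>j\<le>n. d (f i) (f j) = \<bar>real i - real j\<bar>"
  defines "q \<equiv> f (nat \<lfloor>gromov_product d p u v\<rfloor>)"
  shows "nat \<lfloor>gromov_product d p u v\<rfloor> \<le> n" "q \<in> V" "d p q \<le> gromov_product d p u v"
    "gromov_product d p u v \<le> d p q + 1" "gromov_product d q p u = 0"
    "gromov_product d q p v \<le> \<delta>" "gromov_product d q u v \<le> \<delta> + 1"
proof -
  let ?t = "gromov_product d p u v"
  \<comment> \<open>Rounding down puts the centre of the triangle at an integer parameter; this is
    the source of the \<open>+ 1\<close> in the bounds.\<close>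
  define i where "i = nat \<lfloor>?t\<rfloor>"
  have t: "0 \<le> ?t" "?t \<le> real n" using gp_nonneg[OF V] gp_le_dist[OF V] geo(3) by auto
  have i: "real i \<le> ?t" "?t \<le> real i + 1" using t(1) unfolding i_def by linarith+
  then have "i \<le> n" using t(2) by linarith
  then show "nat \<lfloor>?t\<rfloor> \<le> n" by (simp add: i_def)
  have q: "q = f i" by (simp add: q_def i_def)
  show qV: "q \<in> V" using \<open>i \<le> n\<close> geo(4) q by auto
  have pq: "d p q = i" using geo(5)[rule_format, of 0 i] geo(1) q \<open>i \<le> n\<close> by simp
  have uq: "d u q = n - i" using geo(5)[rule_format, of n i] geo(2) q \<open>i \<le> n\<close> by (simp add: of_nat_diff)
  show "d p q \<le> ?t" "?t \<le> d p q + 1" using pq i by auto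
  show 0: "gromov_product d q p u = 0"
    using pq uq geo(3) \<open>i \<le> n\<close> by (simp add: gromov_product_def of_nat_diff)
  have "gromov_product d q p v \<le> 0 + \<delta>"
    by (rule push_along[OF V(1) qV V(2,3)]) (use 0 pq i in auto)
  then show a: "gromov_product d q p v \<le> \<delta>" by simp
  have "n = d p u" "real (n - i) = real n - real i" using geo(3) \<open>i \<le> n\<close> by (auto simp: of_nat_diff)
  then show "gromov_product d q u v \<le> \<delta> + 1"
    using a pq i uq sym[of p u] sym[of p q] sym[of p v] unfolding gromov_product_def by argo
qed

lemma center:
  assumes V: "p \<in> V" "u \<in> V" "v \<in> V"
  shows "\<exists>q\<in>V. d p q \<le> gromov_product d p u v \<and> gromov_product d p u v \<le> d p q + 1 \<and>
    gromov_product d q p u \<le> \<delta> + 1 \<and> gromov_product d q p v \<le> \<delta> + 1 \<and> gromov_product d q u v \<le> \<delta> + 1"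
proof -
  obtain f n where f: "f 0 = p" "f n = u" "real n = d p u" "\<forall>i\<le>n. f i \<in> V"
      "\<forall>i\<le>n. \<forall>j\<le>n. d (f i) (f j) = \<bar>real i - real j\<bar>"
    using discrete_geodesic[OF V(1,2)] by blast
  show ?thesis using center_at[OF V f] delta_pos
    by (intro bexI[of _ "f (nat \<lfloor>gromov_product d p u v\<rfloor>)"]) auto
qed

lemma geodesic_near:
  assumes V: "u \<in> V" "v \<in> V" "p \<in> V"
    and geo: "f 0 = u" "f n = v" "real n = d u v" "\<forall>i\<le>n. f i \<in> V"
      "\<forall>i\<le>n. \<forall>j\<le>n. d (f i) (f j) = \<bar>real i - real j\<bar>"
  shows "\<exists>i\<le>n. d p (f i) \<le> gromov_product d p u v + 2 * \<delta> + 1"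
proof (intro exI conjI)
  note c = center_at[OF V geo]
  let ?q = "f (nat \<lfloor>gromov_product d u v p\<rfloor>)"
  show "nat \<lfloor>gromov_product d u v p\<rfloor> \<le> n" by (rule c)
  \<comment> \<open>An exact identity. \<open>?q\<close> is the centre of \<open>u\<close>,
    \<open>v\<close>, \<open>p\<close> on the geodesic, so its products are 0 for \<open>u\<close>,
    \<open>v\<close> and at most \<open>\<delta>\<close> and \<open>\<delta> + 1\<close> for the
    other two pairs.\<close>
  have "d p ?q = gromov_product d p u v - gromov_product d ?q u v + gromov_product d ?q u p + gromov_product d ?q v p"
    by (simp add: gromov_product_def field_simps sym[of p u] sym[of p v] sym[of ?q p] sym[of ?q u] sym[of ?q v])
  then show "d p ?q \<le> gromov_product d p u v + 2 * \<delta> + 1"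
    using c by linarith
qed

end

section \<open>Stability of quasi-geodesics for a pair of distances\<close>

lemma log_growth_bound:
  fixes a b c \<delta> :: real
  assumes "a > 0" "\<delta> > 0"
  shows "\<exists>D0. \<forall>D\<ge>D0. \<exists>k::nat. a * D + b \<le> 2 ^ k \<and> c + k * \<delta> < D"
proof -
  have "eventually (\<lambda>D. c + \<delta> * (log 2 (a * D + b) + 1) < D) at_top"
    using assms by real_asymp
  moreover have "eventually (\<lambda>D. a * D + b \<ge> 1) at_top"
    using assms by real_asymp
  ultimately have "eventually (\<lambda>D. c + \<delta> * (log 2 (a * D + b) + 1) < D \<and> a * D + b \<ge> 1) at_top"
    by eventually_elim simp
  then obtain D0 where D0: "\<And>D. D \<ge> D0 \<Longrightarrow> c + \<delta> * (log 2 (a * D + b) + 1) < D \<and> a * D + b \<ge> 1"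
    by (auto simp: eventually_at_top_linorder)
  show ?thesis
  proof (intro exI allI impI conjI)
    fix D assume D: "D \<ge> D0"
    define L where "L = log 2 (a * D + b)"
    let ?k = "nat \<lceil>L\<rceil>"
    have "0 \<le> L" using D0[OF D] by (simp add: L_def)
    then have k: "L \<le> ?k" "?k \<le> L + 1" by linarith+
    have "a * D + b = 2 powr L" using D0[OF D] by (simp add: L_def)
    also have "\<dots> \<le> 2 powr ?k" using k by (intro powr_mono) auto
    finally show "a * D + b \<le> 2 ^ ?k" by (simp add: powr_realpow)
    have "c + ?k * \<delta> \<le> c + \<delta> * (L + 1)" using k(2) assms(2) by (simp add: mult.commute)
    then show "c + ?k * \<delta> < D" using D0[OF D] by (simp add: L_def)
  qed
qed

context coarse_hyperbolic
begin

text \<open>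
  Stability of quasi-geodesics, for the distance \<open>d\<close> as well as for that of the cone-off, by one
  bootstrap. If the geodesic has a point \<open>p\<close> of maximal deviation \<open>D\<close> from the chain, leave \<open>p\<close>
  in both directions for distance \<open>2 D\<close> and return to the chain. This closes up to a polygon with
  \<open>O(D)\<close> sides that avoids the ball of radius \<open>D\<close> around \<open>p\<close>. In a hyperbolic space one of the
  sides comes \<open>O(log D)\<close>-close to \<open>p\<close>, so \<open>D\<close> is bounded.
\<close>

context
  fixes e :: "'v \<Rightarrow> 'v \<Rightarrow> real" and adj :: "'v \<Rightarrow> 'v \<Rightarrow> bool" and A B C0 :: real
  assumes e_refl: "e u u = 0"
    and e_sym: "e u v = e v u"
    and e_tri: "\<lbrakk>u \<in> V; v \<in> V; w \<in> V\<rbrakk> \<Longrightarrow> e u w \<le> e u v + e v w"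
    and e_le: "\<lbrakk>u \<in> V; v \<in> V\<rbrakk> \<Longrightarrow> e u v \<le> d u v"
    and const_pos: "A > 0" "B \<ge> 0" "C0 \<ge> 0"
    and adj_near: "\<lbrakk>u \<in> V; v \<in> V; p \<in> V; adj u v\<rbrakk> \<Longrightarrow> e p u \<le> gromov_product d p u v + C0"
    and adj_chain: "\<lbrakk>u \<in> V; v \<in> V\<rbrakk> \<Longrightarrow> \<exists>f m. f 0 = u \<and> f m = v \<and> real m \<le> A * e u v + B \<and>
      (\<forall>i<m. adj (f i) (f (Suc i))) \<and> (\<forall>i\<le>m. f i \<in> V \<and> e u (f i) \<le> e u v)"
begin

text \<open>Otherwise \<open>gp_chain_log\<close> yields a step with small product at
  \<open>p\<close>, and \<open>adj_near\<close> puts its first vertex at \<open>e\<close>-distance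
  less than \<open>D\<close> from \<open>p\<close>. Here avoidance in \<open>e\<close> is converted
  into an estimate for products of \<open>d\<close>.\<close>

lemma far_chain:
  assumes "p \<in> V" "m \<le> 2 ^ k" "\<forall>i\<in>{a..a+m}. f i \<in> V \<and> D \<le> e p (f i)"
    "\<forall>i\<in>{a..<a+m}. adj (f i) (f (Suc i))"
  shows "D - k * \<delta> - C0 \<le> gromov_product d p (f a) (f (a + m))"
proof (cases "m = 0")
  case True
  have "D \<le> d p (f a)" using assms(1,3) e_le[of p "f a"] by (force simp: True)
  then have "D \<le> gromov_product d p (f a) (f (a + m))"
    using sym[of p "f a"] refl[of "f a"] by (simp add: True gromov_product_def)
  moreover have "0 \<le> k * \<delta>" using delta_pos by simp
  ultimately show ?thesis using const_pos(3) by linarith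
next
  case False
  then obtain i where i: "i \<in> {a..<a+m}"
    "gromov_product d p (f i) (f (Suc i)) \<le> gromov_product d p (f a) (f (a + m)) + k * \<delta>"
    using gp_chain_log[of m k p a f] assms by blast
  have "f i \<in> V" "f (Suc i) \<in> V" "adj (f i) (f (Suc i))" "D \<le> e p (f i)"
    using assms(3,4) i(1) by auto
  then show ?thesis using adj_near[of "f i" "f (Suc i)" p] assms(1) i(2) by linarith
qed

text \<open>Stop at the first \<open>e\<close>-distance of at least \<open>2 * D\<close>, or at the
  end \<open>T\<close>. A step of \<open>d\<close>-length at most 1 has \<open>e\<close>-length at
  most 1, hence the overshoot.\<close>

lemma walk_away:
  assumes "D \<ge> 0" "\<forall>l\<le>T. g l \<in> V" "\<forall>l<T. d (g l) (g (Suc l)) \<le> 1"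
  shows "\<exists>s\<le>T. e (g 0) (g s) \<le> 2 * D + 1 \<and> (s = T \<or> 2 * D \<le> e (g 0) (g s))"
proof -
  define s where "s = (LEAST s. s = T \<or> 2 * D \<le> e (g 0) (g s))"
  have s: "s = T \<or> 2 * D \<le> e (g 0) (g s)" unfolding s_def by (rule LeastI[of _ T]) simp
  have sT: "s \<le> T" unfolding s_def by (rule Least_le) simp
  have "e (g 0) (g s) \<le> 2 * D + 1"
  proof (cases s)
    case 0
    then show ?thesis using assms(1) e_refl by simp
  next
    case (Suc r)
    then have "\<not> (r = T \<or> 2 * D \<le> e (g 0) (g r))" using not_less_Least[of r "\<lambda>s. s = T \<or> 2 * D \<le> e (g 0) (g s)"] unfolding s_def by auto
    moreover have "e (g 0) (g s) \<le> e (g 0) (g r) + e (g r) (g s)" "e (g r) (g s) \<le> d (g r) (g s)"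
      using e_tri e_le assms(2) sT Suc by auto
    moreover have "d (g r) (g s) \<le> 1" using assms(3) sT Suc by auto
    ultimately show ?thesis by linarith
  qed
  then show ?thesis using s sT by blast
qed

lemma deviation_bound:
  assumes D0: "\<forall>D\<ge>D0. \<exists>k::nat. A * (6 * D + 2) + B \<le> 2 ^ k \<and> C0 + 2 * \<delta> + k * \<delta> < D"
    and chain: "\<forall>i\<le>n. f i \<in> V" "\<forall>i<n. adj (f i) (f (Suc i))"
      "\<forall>i j. i \<le> j \<and> j \<le> n \<longrightarrow> real j - real i \<le> A * e (f i) (f j) + B"
    and geo: "g 0 = f 0" "g N = f n" "\<forall>i\<le>N. g i \<in> V"
      "\<forall>i\<le>N. \<forall>j\<le>N. d (g i) (g j) = \<bar>real i - real j\<bar>"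
    and "t \<le> N"
  shows "\<exists>i\<le>n. e (g t) (f i) \<le> D0"
proof -
  define dist where "dist t = Min ((\<lambda>i. e (g t) (f i)) ` {..n})" for t
  define D where "D = Max (dist ` {..N})"
  have "D \<in> dist ` {..N}" unfolding D_def by (rule Max_in) auto
  then obtain t0 where t0: "t0 \<le> N" "dist t0 = D" by auto
  have near: "\<exists>i\<le>n. e (g s) (f i) \<le> D" if "s \<le> N" for s
  proof -
    have "dist s \<in> (\<lambda>i. e (g s) (f i)) ` {..n}" unfolding dist_def by (rule Min_in) auto
    then obtain i where "i \<le> n" "dist s = e (g s) (f i)" by auto
    moreover have "dist s \<le> D" unfolding D_def using that by (intro Max_ge) auto
    ultimately show ?thesis by auto
  qed
  define p where "p = g t0"
  have p: "p \<in> V" using geo(3) t0 by (auto simp: p_def)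
  have far: "D \<le> e p (f i)" if "i \<le> n" for i
    unfolding t0(2)[symmetric] dist_def p_def using that by (intro Min_le) auto
  have D: "D \<ge> 0"
  proof -
    obtain i where "i \<le> n" "e p (f i) \<le> D" using near[OF t0(1)] by (auto simp: p_def)
    moreover have "0 \<le> e p (f i)"
      using e_tri[of p "f i" p] e_refl e_sym[of p "f i"] p chain(1) \<open>i \<le> n\<close> by simp
    ultimately show ?thesis by simp
  qed
  have "D < D0"
  proof (rule ccontr)
    assume "\<not> D < D0"
    then obtain k :: nat where k: "A * (6 * D + 2) + B \<le> 2 ^ k" "C0 + 2 * \<delta> + k * \<delta> < D"
      using D0[rule_format, of D] by auto
    \<comment> \<open>The side from a turning point \<open>z\<close> back to the chain. If
      \<open>z\<close> is an end of the geodesic, it lies on the chain and the side is trivial;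
      otherwise \<open>z\<close> is at distance at least \<open>2 * D\<close> from \<open>p\<close>
      and the side stays within \<open>D\<close> of \<open>z\<close>, so it avoids the ball of
      radius \<open>D\<close> around \<open>p\<close>.\<close>
    have link: "\<exists>i\<le>n. e z (f i) \<le> D \<and> D - k * \<delta> - C0 \<le> gromov_product d p z (f i)"
      if z: "z = g s" "s \<le> N" "s = 0 \<or> s = N \<or> 2 * D \<le> e p z" for z s
    proof -
      consider i where "i \<le> n" "z = f i" | "2 * D \<le> e p z" using z geo by auto
      then show ?thesis
      proof cases
        case 1
        then have "D - k * \<delta> - C0 \<le> gromov_product d p (f i) (f (i + 0))"
          using p chain(1) far by (intro far_chain) auto
        then show ?thesis using 1 D e_refl by auto
      next
        case 2
        obtain i where i: "i \<le> n" "e z (f i) \<le> D" using near z by auto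
        have zV: "z \<in> V" using z geo by auto
        obtain h m where h: "h 0 = z" "h m = f i" "real m \<le> A * e z (f i) + B"
            "\<forall>i<m. adj (h i) (h (Suc i))" "\<forall>l\<le>m. h l \<in> V \<and> e z (h l) \<le> e z (f i)"
          using adj_chain[of z "f i"] zV chain(1) i(1) by auto
        have "A * e z (f i) \<le> A * (6 * D + 2)" using i(2) const_pos D by (intro mult_left_mono) auto
        then have "real m \<le> 2 ^ k" using h(3) k(1) by linarith
        then have "real m \<le> real (2 ^ k)" by simp
        then have m: "m \<le> 2 ^ k" by (simp only: of_nat_le_iff)
        have "D \<le> e p (h l)" if "l \<le> m" for l
          using e_tri[of p "h l" z] e_sym[of z "h l"] h(5) that i(2) 2 p zV by force
        then have "D - k * \<delta> - C0 \<le> gromov_product d p (h 0) (h (0 + m))"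
          using p m h(4,5) by (intro far_chain) auto
        then show ?thesis using h i by auto
      qed
    qed
    have "\<exists>s\<le>t0. e (g (t0 - 0)) (g (t0 - s)) \<le> 2 * D + 1 \<and> (s = t0 \<or> 2 * D \<le> e (g (t0 - 0)) (g (t0 - s)))"
      by (rule walk_away) (use D geo t0 in auto)
    then obtain s where s: "s \<le> t0" "e p (g (t0 - s)) \<le> 2 * D + 1" "s = t0 \<or> 2 * D \<le> e p (g (t0 - s))"
      by (auto simp: p_def)
    have "\<exists>s\<le>N - t0. e (g (t0 + 0)) (g (t0 + s)) \<le> 2 * D + 1 \<and> (s = N - t0 \<or> 2 * D \<le> e (g (t0 + 0)) (g (t0 + s)))"
      by (rule walk_away) (use D geo t0 in auto)
    then obtain s' where s': "s' \<le> N - t0" "e p (g (t0 + s')) \<le> 2 * D + 1" "s' = N - t0 \<or> 2 * D \<le> e p (g (t0 + s'))"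
      by (auto simp: p_def)
    define z z' where "z = g (t0 - s)" and "z' = g (t0 + s')"
    have V: "z \<in> V" "z' \<in> V" using geo(3) s(1) s'(1) t0 by (auto simp: z_def z'_def)
    have zz': "gromov_product d p z z' = 0"
      using geo(4) t0(1) s(1) s'(1) by (simp add: gromov_product_def z_def z'_def p_def of_nat_diff)
    obtain i where i: "i \<le> n" "e z (f i) \<le> D" "D - k * \<delta> - C0 \<le> gromov_product d p z (f i)"
      using link[OF z_def] s t0 by (fastforce simp: z_def)
    obtain j where j: "j \<le> n" "e z' (f j) \<le> D" "D - k * \<delta> - C0 \<le> gromov_product d p z' (f j)"
      using link[OF z'_def] s' t0 by (fastforce simp: z'_def)
    have fV: "f i \<in> V" "f j \<in> V" using chain(1) i j by auto
    \<comment> \<open>The four pieces are at most \<open>D\<close>, \<open>2 * D + 1\<close>,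
      \<open>2 * D + 1\<close> and \<open>D\<close>, which gives \<open>6 * D + 2\<close>.\<close>
    have "e (f i) (f j) \<le> e (f i) z + e z p + e p z' + e z' (f j)"
      using e_tri[of "f i" z "f j"] e_tri[of z p "f j"] e_tri[of p z' "f j"] fV V p by linarith
    then have ij: "e (f i) (f j) \<le> 6 * D + 2"
      using i(2) j(2) s(2) s'(2) e_sym[of z p] e_sym[of z "f i"] by (simp add: z_def z'_def)
    have mid: "D - k * \<delta> - C0 \<le> gromov_product d p (f a) (f b)"
      if ab: "a \<le> b" "b \<le> n" "e (f a) (f b) \<le> 6 * D + 2" for a b
    proof -
      have "A * e (f a) (f b) \<le> A * (6 * D + 2)" using ab(3) const_pos by (intro mult_left_mono) auto
      moreover have "real b - real a \<le> A * e (f a) (f b) + B" using chain(3) ab by blast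
      ultimately have "real (b - a) \<le> 2 ^ k" using k(1) ab(1) by (simp add: of_nat_diff)
      then have "real (b - a) \<le> real (2 ^ k)" by simp
      then have "b - a \<le> 2 ^ k" by (simp only: of_nat_le_iff)
      then have "D - k * \<delta> - C0 \<le> gromov_product d p (f a) (f (a + (b - a)))"
        using p chain(1,2) far ab by (intro far_chain) auto
      then show ?thesis using ab by simp
    qed
    have "D - k * \<delta> - C0 \<le> gromov_product d p (f i) (f j)"
      using mid[of i j] mid[of j i] ij e_sym[of "f i" "f j"] gp_sym[of p "f i" "f j"] i(1) j(1)
      by (cases "i \<le> j") auto
    \<comment> \<open>The polygon \<open>z\<close>, \<open>f i\<close>, \<open>f j\<close>,
      \<open>z'\<close> is closed by two four-point estimates: its three sides have product at least
      \<open>D - k * \<delta> - C0\<close>, whereas \<open>z\<close> and \<open>z'\<close> lie on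
      either side of \<open>p\<close> on a geodesic and have product 0.\<close>
    moreover have "min (gromov_product d p z (f i)) (gromov_product d p (f i) z') - \<delta> \<le> gromov_product d p z z'"
      "min (gromov_product d p (f i) (f j)) (gromov_product d p (f j) z') - \<delta> \<le> gromov_product d p (f i) z'"
      by (rule four_point; use p V fV in simp)+
    ultimately show False
      using i(3) j(3) zz' k(2) gp_sym[of p z' "f j"] delta_pos by (auto simp: min_def split: if_splits)
  qed
  then show ?thesis using near[OF \<open>t \<le> N\<close>] by force
qed

text \<open>A geodesic with the same ends passes near \<open>p\<close> by
  \<open>geodesic_near\<close>, and its points are near the chain by \<open>deviation_bound\<close>.
  Applied with \<open>e = d\<close> to word geodesics in an orbit, and with \<open>e\<close> the
  cone-off distance to geodesics of the cone-off.\<close>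

lemma morse:
  "\<exists>C\<ge>0. \<forall>f n p. p \<in> V \<longrightarrow> (\<forall>i\<le>n. f i \<in> V) \<longrightarrow> (\<forall>i<n. adj (f i) (f (Suc i))) \<longrightarrow>
    (\<forall>i j. i \<le> j \<and> j \<le> n \<longrightarrow> real j - real i \<le> A * e (f i) (f j) + B) \<longrightarrow>
    (\<exists>i\<le>n. e p (f i) \<le> gromov_product d p (f 0) (f n) + C)"
proof -
  \<comment> \<open>The number of steps in a side is linear in \<open>D\<close>, but bisection costs
    only its logarithm times \<open>\<delta>\<close>, which is eventually less than
    \<open>D\<close>.\<close>
  obtain D0 where "\<forall>D\<ge>D0. \<exists>k::nat. (6 * A) * D + (2 * A + B) \<le> 2 ^ k \<and> (C0 + 2 * \<delta>) + k * \<delta> < D"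
    using log_growth_bound[of "6 * A" \<delta>] const_pos delta_pos by (metis mult_pos_pos zero_less_numeral)
  then have D0: "\<forall>D\<ge>D0. \<exists>k::nat. A * (6 * D + 2) + B \<le> 2 ^ k \<and> C0 + 2 * \<delta> + k * \<delta> < D"
    by (simp add: algebra_simps)
  show ?thesis
  proof (intro exI[of _ "\<bar>D0\<bar> + 2 * \<delta> + 1"] conjI allI impI)
    show "0 \<le> \<bar>D0\<bar> + 2 * \<delta> + 1" using delta_pos by simp
    fix f :: "nat \<Rightarrow> 'v" and n p
    assume p: "p \<in> V" and f: "\<forall>i\<le>n. f i \<in> V" "\<forall>i<n. adj (f i) (f (Suc i))"
      "\<forall>i j. i \<le> j \<and> j \<le> n \<longrightarrow> real j - real i \<le> A * e (f i) (f j) + B"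
    obtain g N where g: "g 0 = f 0" "g N = f n" "real N = d (f 0) (f n)" "\<forall>i\<le>N. g i \<in> V"
      "\<forall>i\<le>N. \<forall>j\<le>N. d (g i) (g j) = \<bar>real i - real j\<bar>"
      using discrete_geodesic[of "f 0" "f n"] f(1) by auto
    obtain t where t: "t \<le> N" "d p (g t) \<le> gromov_product d p (f 0) (f n) + 2 * \<delta> + 1"
      using geodesic_near[OF _ _ p g] f(1) by auto
    obtain i where i: "i \<le> n" "e (g t) (f i) \<le> D0"
      using deviation_bound[OF D0 f g(1,2,4,5) t(1)] by auto
    have "e p (f i) \<le> e p (g t) + e (g t) (f i)" "e p (g t) \<le> d p (g t)"
      using e_tri e_le p f(1) g(4) t(1) i(1) by auto
    then show "\<exists>i\<le>n. e p (f i) \<le> gromov_product d p (f 0) (f n) + (\<bar>D0\<bar> + 2 * \<delta> + 1)"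
      using i t by (intro exI[of _ i]) auto
  qed
qed

end

end

section \<open>Gromov products in a cone-off\<close>

locale coned_hyperbolic = coarse_hyperbolic +
  fixes e :: "'a \<Rightarrow> 'a \<Rightarrow> real" and C :: real
  assumes cone_refl: "e u u = 0"
    and cone_sym: "e u v = e v u"
    and cone_tri: "\<lbrakk>u \<in> V; v \<in> V; w \<in> V\<rbrakk> \<Longrightarrow> e u w \<le> e u v + e v w"
    and cone_gp_le: "\<lbrakk>p \<in> V; u \<in> V; v \<in> V\<rbrakk> \<Longrightarrow> gromov_product e p u v \<le> gromov_product d p u v + C"
begin

text \<open>Expand the product at \<open>p\<close> into products at \<open>q\<close>. Being near
  geodesics from \<open>p\<close> to \<open>u\<close> and to \<open>v\<close> persists in the
  cone-off by \<open>cone_gp_le\<close>, and the remaining product at \<open>q\<close> is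
  nonnegative.\<close>

lemma cone_center:
  assumes V: "p \<in> V" "q \<in> V" "u \<in> V" "v \<in> V"
    and "gromov_product d q p u \<le> c" "gromov_product d q p v \<le> c"
  shows "e p q \<le> gromov_product e p u v + 2 * (c + C)"
proof -
  have "gromov_product e p u v = e p q - gromov_product e q p u - gromov_product e q p v + gromov_product e q u v"
    using cone_sym[of p q] cone_sym[of p u] cone_sym[of p v] by (simp add: gromov_product_def field_simps)
  moreover have "0 \<le> gromov_product e q u v"
    using cone_tri[of u q v] V cone_sym[of q v] by (simp add: gromov_product_def)
  moreover have "gromov_product e q p u \<le> c + C" "gromov_product e q p v \<le> c + C"
    using cone_gp_le[of q p u] cone_gp_le[of q p v] assms by linarith+
  ultimately show ?thesis by argo
qed

text \<open>By \<open>push_along\<close> the centre \<open>q\<close> of \<open>p\<close>,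
  \<open>u\<close>, \<open>v\<close> is also near a geodesic from \<open>p\<close> to
  \<open>w\<close>. So \<open>e p q\<close> bounds the product of \<open>u\<close>, \<open>v\<close>
  from above and, by \<open>cone_center\<close>, those of \<open>v\<close>, \<open>w\<close> and of
  \<open>u\<close>, \<open>w\<close> from below. The errors \<open>\<delta> + 1 + C\<close> and
  \<open>2 * (2 * \<delta> + 1 + C)\<close> are merged into one constant.\<close>

lemma cone_gp_mono:
  assumes V: "p \<in> V" "u \<in> V" "v \<in> V" "w \<in> V"
    and le: "gromov_product d p u v \<le> gromov_product d p v w"
  shows "gromov_product e p u v - 3 * (2 * \<delta> + 1 + C) \<le> gromov_product e p v w"
    "gromov_product e p u v - 3 * (2 * \<delta> + 1 + C) \<le> gromov_product e p u w"
proof -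
  obtain q where q: "q \<in> V" "d p q \<le> gromov_product d p u v" "gromov_product d q p u \<le> \<delta> + 1"
      "gromov_product d q p v \<le> \<delta> + 1" "gromov_product d q u v \<le> \<delta> + 1"
    using center[OF V(1-3)] by auto
  have "gromov_product d q p w \<le> \<delta> + 1 + \<delta>"
    by (rule push_along[OF V(1) q(1) V(3,4)]) (use q le delta_pos in auto)
  then have c: "gromov_product d q p u \<le> 2 * \<delta> + 1" "gromov_product d q p v \<le> 2 * \<delta> + 1"
    "gromov_product d q p w \<le> 2 * \<delta> + 1" using q delta_pos by auto
  have "gromov_product e q u v \<le> \<delta> + 1 + C" using cone_gp_le[of q u v] q V by linarith
  then have "gromov_product e p u v \<le> e p q + \<delta> + 1 + C"
    using cone_tri[of u q p] cone_tri[of v q p] cone_sym[of p q] V q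
    by (simp add: gromov_product_def field_simps)
  then show "gromov_product e p u v - 3 * (2 * \<delta> + 1 + C) \<le> gromov_product e p v w"
    "gromov_product e p u v - 3 * (2 * \<delta> + 1 + C) \<le> gromov_product e p u w"
    using cone_center[OF V(1) q(1) V(3,4) c(2,3)] cone_center[OF V(1) q(1) V(2,4) c(1,3)] delta_pos
    by (simp_all add: algebra_simps)
qed

lemma cone_four_point:
  assumes V: "p \<in> V" "u \<in> V" "v \<in> V" "w \<in> V"
  shows "min (gromov_product e p u v) (gromov_product e p v w) - 3 * (2 * \<delta> + 1 + C) \<le> gromov_product e p u w"
proof (cases "gromov_product d p u v \<le> gromov_product d p v w")
  case True
  then show ?thesis using cone_gp_mono(2)[OF V] by linarith
next
  case False
  then have "gromov_product d p w v \<le> gromov_product d p v u"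
    using gp_sym[of p w v] gp_sym[of p u v] by linarith
  from cone_gp_mono(2)[OF V(1,4,3,2) this]
  have "gromov_product e p w v - 3 * (2 * \<delta> + 1 + C) \<le> gromov_product e p w u" .
  moreover have "gromov_product e p w v = gromov_product e p v w" "gromov_product e p w u = gromov_product e p u w"
    using cone_sym[of w v] cone_sym[of w u] by (auto simp: gromov_product_def)
  ultimately show ?thesis by linarith
qed

end

section \<open>Graphs and their realizations\<close>

definition edge_rel :: "'v set set \<Rightarrow> ('v \<times> 'v) set" where
  "edge_rel E = {(a, b). {a, b} \<in> E}"

text \<open>Where no path exists, the \<open>LEAST\<close> ranges over an empty set and is
  unspecified; hence the triangle inequality is claimed inside \<open>V\<close> only, while symmetry
  and nonnegativity hold everywhere.\<close>

definition gdist :: "'v set set \<Rightarrow> 'v \<Rightarrow> 'v \<Rightarrow> real" where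
  "gdist E u v = real (LEAST n. (u, v) \<in> edge_rel E ^^ n)"

lemma relpow_edge_rel_sym: "(u, v) \<in> edge_rel E ^^ n \<Longrightarrow> (v, u) \<in> edge_rel E ^^ n"
proof (induction n arbitrary: u v)
  case (Suc n)
  then obtain w where "(u, w) \<in> edge_rel E" "(w, v) \<in> edge_rel E ^^ n" by (meson relpow_Suc_D2)
  then have "(w, u) \<in> edge_rel E" "(v, w) \<in> edge_rel E ^^ n"
    using Suc.IH by (auto simp: edge_rel_def insert_commute)
  then show ?case by auto
qed simp

lemma gdist_refl [simp]: "gdist E u u = 0"
  unfolding gdist_def by (simp add: Least_eq_0)

lemma gdist_sym: "gdist E u v = gdist E v u"
  unfolding gdist_def by (metis relpow_edge_rel_sym)

lemma gdist_nonneg [simp]: "0 \<le> gdist E u v"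
  by (simp add: gdist_def)

lemma gdist_le_relpow: "(u, v) \<in> edge_rel E ^^ n \<Longrightarrow> gdist E u v \<le> n"
  unfolding gdist_def by (simp add: Least_le)

lemma gdist_edge: "{u, v} \<in> E \<Longrightarrow> gdist E u v \<le> 1"
  using gdist_le_relpow[of u v 1 E] by (simp add: edge_rel_def)

lemma gdist_le_chain:
  assumes "\<And>i. i < n \<Longrightarrow> {f (a + i), f (Suc (a + i))} \<in> E"
  shows "gdist E (f a) (f (a + n)) \<le> n"
proof (rule gdist_le_relpow)
  show "(f a, f (a + n)) \<in> edge_rel E ^^ n"
    unfolding relpow_fun_conv by (rule exI[of _ "\<lambda>i. f (a + i)"]) (use assms in \<open>auto simp: edge_rel_def\<close>)
qed

locale conn_graph =
  fixes V :: "'v set" and E :: "'v set set"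
  assumes connected_graph: "connected_graph V E"
begin

lemma edge_subset: "e \<in> E \<Longrightarrow> e \<subseteq> V" and edge_card: "e \<in> E \<Longrightarrow> card e = 2"
  using connected_graph by (auto simp: connected_graph_def simple_graph_def)

lemma gdist_relpow:
  assumes "u \<in> V" "v \<in> V"
  obtains n where "gdist E u v = real n" "(u, v) \<in> edge_rel E ^^ n"
proof -
  have "(u, v) \<in> (edge_rel E)\<^sup>*"
    using connected_graph assms by (auto simp: connected_graph_def edge_rel_def)
  then obtain n where n: "(u, v) \<in> edge_rel E ^^ n" by (auto simp: rtrancl_power)
  show thesis
    by (rule that[of "LEAST n. (u, v) \<in> edge_rel E ^^ n"]) (auto simp: gdist_def intro: LeastI[of "\<lambda>n. (u, v) \<in> edge_rel E ^^ n", OF n])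
qed

lemma gdist_tri:
  assumes "u \<in> V" "v \<in> V" "w \<in> V"
  shows "gdist E u w \<le> gdist E u v + gdist E v w"
proof -
  obtain m where m: "gdist E u v = real m" "(u, v) \<in> edge_rel E ^^ m" using gdist_relpow assms by metis
  obtain n where n: "gdist E v w = real n" "(v, w) \<in> edge_rel E ^^ n" using gdist_relpow assms by metis
  have "(u, w) \<in> edge_rel E ^^ (m + n)" using m n by (auto simp: relpow_add)
  from gdist_le_relpow[OF this] show ?thesis using m n by simp
qed

lemma gdist_geodesic:
  assumes "u \<in> V" "v \<in> V"
  shows "\<exists>f n. f 0 = u \<and> f n = v \<and> real n = gdist E u v \<and> (\<forall>i\<le>n. f i \<in> V) \<and>
    (\<forall>i<n. {f i, f (Suc i)} \<in> E) \<and> (\<forall>i\<le>n. \<forall>j\<le>n. gdist E (f i) (f j) = \<bar>real i - real j\<bar>)"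
proof -
  obtain n where n: "gdist E u v = real n" "(u, v) \<in> edge_rel E ^^ n" using gdist_relpow assms by metis
  then obtain f where f: "f 0 = u" "f n = v" "\<forall>i<n. {f i, f (Suc i)} \<in> E"
    by (auto simp: relpow_fun_conv edge_rel_def)
  have V: "\<forall>i\<le>n. f i \<in> V"
  proof (intro allI impI)
    fix i assume "i \<le> n"
    then show "f i \<in> V"
      using f assms(1) edge_subset by (cases i) (auto simp: Suc_le_eq)
  qed
  have le: "gdist E (f i) (f j) \<le> real j - real i" if "i \<le> j" "j \<le> n" for i j
    using gdist_le_chain[of "j - i" f i E] f(3) that by (auto simp: of_nat_diff)
  have eq: "gdist E (f i) (f j) = real j - real i" if ij: "i \<le> j" "j \<le> n" for i j
  proof -
    \<comment> \<open>Each of the three pieces is at most its number of edges and the total is at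
      least \<open>n\<close>, so no piece can be shorter.\<close>
    have "real n \<le> gdist E (f 0) (f i) + gdist E (f i) (f j) + gdist E (f j) (f n)"
      using gdist_tri[of "f 0" "f i" "f n"] gdist_tri[of "f i" "f j" "f n"] V ij f n by auto
    then show ?thesis using le[of 0 i] le[of i j] le[of j n] ij by auto
  qed
  have "gdist E (f i) (f j) = \<bar>real i - real j\<bar>" if "i \<le> n" "j \<le> n" for i j
    using eq[of i j] eq[of j i] gdist_sym[of E "f i" "f j"] that by (cases "i \<le> j") auto
  then show ?thesis using f V n by metis
qed

end

section \<open>Distances in the realization against distances of vertices\<close>

definition near_vertex :: "('v \<Rightarrow> real) \<Rightarrow> 'v" where
  "near_vertex p = (SOME v. v \<in> supp p)"

lemma supp_vertex_point [simp]: "supp (vertex_point v) = {v}"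
  by (auto simp: supp_def vertex_point_def)

lemma near_vertex_vertex_point [simp]: "near_vertex (vertex_point v) = v"
  by (simp add: near_vertex_def)

lemma vertex_point_in_realization [simp]: "v \<in> V \<Longrightarrow> vertex_point v \<in> realization V E"
  by (auto simp: realization_def) (auto simp: vertex_point_def)

lemma edge_dist_nonneg: "0 \<le> edge_dist p q"
  by (simp add: edge_dist_def sum_nonneg)

lemma chain_length_nonneg: "0 \<le> chain_length ps"
  by (induction ps rule: chain_length.induct) (auto simp: edge_dist_nonneg)

text \<open>
  The distance from the vertex \<open>u\<close> to \<open>p\<close>: a path to \<open>p\<close> enters the edge of \<open>p\<close> through one of
  its end points \<open>v\<close>, at distance \<open>1 - p v\<close> from \<open>p\<close>.
\<close>

definition vertex_dist :: "'v set set \<Rightarrow> 'v \<Rightarrow> ('v \<Rightarrow> real) \<Rightarrow> real" where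
  "vertex_dist E u p = Min ((\<lambda>v. gdist E u v + 1 - p v) ` supp p)"

lemma vertex_dist_vertex_point: "vertex_dist E u (vertex_point v) = gdist E u v"
  by (simp add: vertex_dist_def) (simp add: vertex_point_def)

context conn_graph
begin

lemma realization_supp:
  assumes "p \<in> realization V E"
  shows "finite (supp p)" "supp p \<noteq> {}" "supp p \<subseteq> V" "\<And>v. 0 \<le> p v" "\<And>v. p v \<le> 1"
    "near_vertex p \<in> supp p" "near_vertex p \<in> V" "supp p \<in> E \<or> p = vertex_point (near_vertex p)"
proof -
  have p: "\<And>v. 0 \<le> p v" "supp p \<in> (\<lambda>v. {v}) ` V \<union> E" "(\<Sum>v\<in>supp p. p v) = 1"
    using assms by (auto simp: realization_def)
  show "\<And>v. 0 \<le> p v" by (rule p)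
  show fin: "finite (supp p)" using p(2) edge_card card.infinite by fastforce
  show ne: "supp p \<noteq> {}" using p(3) by auto
  show sub: "supp p \<subseteq> V" using p(2) edge_subset by auto
  show "p v \<le> 1" for v
  proof (cases "v \<in> supp p")
    case True
    have "p v \<le> (\<Sum>v\<in>supp p. p v)" using True fin p(1) by (intro member_le_sum) auto
    then show ?thesis using p(3) by simp
  qed (simp add: supp_def)
  show n: "near_vertex p \<in> supp p" using ne unfolding near_vertex_def by (auto intro: someI_ex)
  then show "near_vertex p \<in> V" using sub by auto
  show "supp p \<in> E \<or> p = vertex_point (near_vertex p)"
  proof (cases "supp p \<in> E")
    case False
    then obtain v where v: "supp p = {v}" using p(2) by auto
    then have "near_vertex p = v" using n by simp
    moreover have "p w = vertex_point v w" for w using v p(3) by (auto simp: supp_def vertex_point_def)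
    ultimately show ?thesis by auto
  qed simp
qed

lemma supp_gdist_le: "\<lbrakk>p \<in> realization V E; v \<in> supp p; w \<in> supp p\<rbrakk> \<Longrightarrow> gdist E v w \<le> 1"
proof -
  assume p: "p \<in> realization V E" "v \<in> supp p" "w \<in> supp p"
  show ?thesis
  proof (cases "v = w")
    case False
    then have "supp p \<in> E" using p realization_supp(8)[OF p(1)] by (metis supp_vertex_point singletonD)
    moreover from this have "supp p = {v, w}" using edge_card[of "supp p"] p False by (auto simp: card_2_iff)
    ultimately show ?thesis by (auto intro: gdist_edge)
  qed simp
qed

lemma edge_dist_common_edge:
  assumes p: "p \<in> realization V E" and q: "q \<in> realization V E" and e: "e \<in> E" "supp p \<union> supp q \<subseteq> e"
  shows "edge_dist p q \<le> 1" "\<And>v. v \<in> e \<Longrightarrow> edge_dist p q = \<bar>p v - q v\<bar>"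
    "\<And>v w. v \<in> e \<Longrightarrow> w \<in> e \<Longrightarrow> v \<noteq> w \<Longrightarrow> q v + q w = 1"
proof -
  obtain a b where ab: "e = {a, b}" "a \<noteq> b" using edge_card[OF e(1)] by (auto simp: card_2_iff)
  have "edge_dist p q = (\<Sum>v\<in>e. \<bar>p v - q v\<bar>) / 2"
    unfolding edge_dist_def using e ab by (subst sum.mono_neutral_left[of e]) (auto simp: supp_def)
  then have d: "edge_dist p q = (\<bar>p a - q a\<bar> + \<bar>p b - q b\<bar>) / 2" using ab by simp
  have "(\<Sum>v\<in>supp r. r v) = (\<Sum>v\<in>e. r v)" if "supp r \<subseteq> e" for r :: "'v \<Rightarrow> real"
    using that ab by (intro sum.mono_neutral_left) (auto simp: supp_def)
  then have s: "p a + p b = 1" "q a + q b = 1" using p q e ab by (auto simp: realization_def)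
  have dist: "edge_dist p q = \<bar>p v - q v\<bar>" if "v \<in> e" for v using d s ab that by auto
  then show "\<And>v. v \<in> e \<Longrightarrow> edge_dist p q = \<bar>p v - q v\<bar>" .
  show "\<And>v w. v \<in> e \<Longrightarrow> w \<in> e \<Longrightarrow> v \<noteq> w \<Longrightarrow> q v + q w = 1" using s ab by auto
  have "\<bar>p a - q a\<bar> \<le> 1"
    using realization_supp(4,5)[OF p, of a] realization_supp(4,5)[OF q, of a] by auto
  then show "edge_dist p q \<le> 1" using dist[of a] ab by simp
qed

text \<open>\<open>vertex_dist\<close> serves as a potential: as it grows along a step by at most
  the length of the step, it bounds all chain lengths, and so the infimum \<open>graph_dist\<close>,
  from below.\<close>

lemma vertex_dist_lipschitz:
  assumes u: "u \<in> V" and p: "p \<in> realization V E" and q: "q \<in> realization V E"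
    and common: "on_common_edge E p q"
  shows "vertex_dist E u q \<le> vertex_dist E u p + edge_dist p q"
proof -
  obtain e where e: "e \<in> E" "supp p \<union> supp q \<subseteq> e" using common by (auto simp: on_common_edge_def)
  note d = edge_dist_common_edge[OF p q e]
  have "vertex_dist E u p \<in> (\<lambda>v. gdist E u v + 1 - p v) ` supp p"
    unfolding vertex_dist_def using realization_supp[OF p] by (intro Min_in) auto
  then obtain v where v: "v \<in> supp p" "vertex_dist E u p = gdist E u v + 1 - p v" by auto
  have ve: "v \<in> e" using v e by auto
  have le: "vertex_dist E u q \<le> gdist E u w + 1 - q w" if "w \<in> supp q" for w
    unfolding vertex_dist_def using that realization_supp[OF q] by (intro Min_le) auto
  show ?thesis
  proof (cases "v \<in> supp q")
    case True
    then show ?thesis using le[OF True] v d(2)[OF ve] by linarith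
  next
    case False
    \<comment> \<open>The end \<open>v\<close> that is optimal for \<open>p\<close> carries no
      weight in \<open>q\<close>, so \<open>q\<close> is the opposite vertex \<open>w\<close>. The
      step then has length \<open>p v\<close>, which is just what passing from \<open>v\<close> to
      \<open>w\<close> may cost.\<close>
    then have qv: "q v = 0" by (simp add: supp_def)
    obtain w where w: "w \<in> supp q" using realization_supp[OF q] by auto
    have "v \<noteq> w" "w \<in> e" using w False e by auto
    then have "q w = 1" using d(3)[OF ve] qv by force
    have "{v, w} = e" using edge_card[OF e(1)] ve \<open>w \<in> e\<close> \<open>v \<noteq> w\<close> by (auto simp: card_2_iff)
    then have "gdist E v w \<le> 1" using e(1) by (simp add: gdist_edge)
    moreover have "gdist E u w \<le> gdist E u v + gdist E v w"
      using gdist_tri u ve \<open>w \<in> e\<close> edge_subset e(1) by blast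
    ultimately show ?thesis using le[OF w] v(2) d(2)[OF ve] qv \<open>q w = 1\<close> by linarith
  qed
qed

lemma vertex_dist_chain:
  assumes "u \<in> V" "ps \<noteq> []" "set ps \<subseteq> realization V E" "successively (on_common_edge E) ps"
  shows "vertex_dist E u (last ps) \<le> vertex_dist E u (hd ps) + chain_length ps"
  using assms(2-)
proof (induction ps rule: chain_length.induct)
  case (1 p q ps)
  then show ?case using vertex_dist_lipschitz[of u p q] assms(1) by force
qed auto

lemma edge_chains_Cons:
  assumes "p \<in> realization V E" "on_common_edge E p q" "ps \<in> edge_chains V E q r"
  shows "p # ps \<in> edge_chains V E p r" "chain_length (p # ps) \<le> 1 + chain_length ps"
proof -
  show "p # ps \<in> edge_chains V E p r" using assms by (cases ps) (auto simp: edge_chains_def)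
  have "q \<in> realization V E" using assms(3) by (auto simp: edge_chains_def)
  moreover obtain e where "e \<in> E" "supp p \<union> supp q \<subseteq> e" using assms(2) by (auto simp: on_common_edge_def)
  ultimately have "edge_dist p q \<le> 1" using edge_dist_common_edge(1) assms(1) by blast
  then show "chain_length (p # ps) \<le> 1 + chain_length ps"
    using assms(3) by (cases ps) (auto simp: edge_chains_def)
qed

lemma edge_chain_relpow:
  assumes "(u, v) \<in> edge_rel E ^^ n" "u \<in> V" "ps \<in> edge_chains V E (vertex_point v) q"
  shows "\<exists>qs\<in>edge_chains V E (vertex_point u) q. chain_length qs \<le> n + chain_length ps"
  using assms(1,2)
proof (induction n arbitrary: u)
  case 0
  then show ?case using assms(3) by auto
next
  case (Suc n)
  then obtain w where w: "(u, w) \<in> edge_rel E" "(w, v) \<in> edge_rel E ^^ n" by (meson relpow_Suc_D2)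
  then have uw: "{u, w} \<in> E" by (simp add: edge_rel_def)
  then have "w \<in> V" using edge_subset by auto
  from Suc.IH[OF w(2) this] obtain qs where qs: "qs \<in> edge_chains V E (vertex_point w) q"
    "chain_length qs \<le> n + chain_length ps" by blast
  have "on_common_edge E (vertex_point u) (vertex_point w)"
    using uw by (auto simp: on_common_edge_def intro!: bexI[of _ "{u, w}"])
  from edge_chains_Cons[OF _ this qs(1)] show ?case
    using qs(2) Suc.prems by (intro bexI[of _ "vertex_point u # qs"]) auto
qed

text \<open>Leave \<open>p\<close> through an end of its edge, follow a shortest path, and enter the
  edge of \<open>q\<close>. A point that is already a vertex adds no step: this makes the bound
  exact on vertices, and it is forced in a graph with a single vertex, which has no edge to carry a
  step.\<close>

lemma short_edge_chain:
  assumes p: "p \<in> realization V E" and q: "q \<in> realization V E"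
  shows "\<exists>ps\<in>edge_chains V E p q. chain_length ps \<le> gdist E (near_vertex p) (near_vertex q) +
    (if p = vertex_point (near_vertex p) then 0 else 1) + (if q = vertex_point (near_vertex q) then 0 else 1)"
proof -
  let ?u = "near_vertex p" and ?v = "near_vertex q"
  have V: "?u \<in> V" "?v \<in> V" using p q realization_supp by auto
  have sing: "[q] \<in> edge_chains V E q q" using q by (auto simp: edge_chains_def)
  obtain ps where ps: "ps \<in> edge_chains V E (vertex_point ?v) q"
    "chain_length ps \<le> (if q = vertex_point ?v then 0 else 1)"
  proof (cases "q = vertex_point ?v")
    case True
    then show thesis using sing that[of "[q]"] by simp
  next
    case False
    then have "supp q \<in> E" using realization_supp(8)[OF q] by auto
    then have "on_common_edge E (vertex_point ?v) q"
      using realization_supp(6)[OF q] by (auto simp: on_common_edge_def)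
    from edge_chains_Cons[OF _ this sing] show thesis
      using False V that[of "[vertex_point ?v, q]"] by auto
  qed
  obtain n where n: "gdist E ?u ?v = real n" "(?u, ?v) \<in> edge_rel E ^^ n" using gdist_relpow V by metis
  obtain qs where qs: "qs \<in> edge_chains V E (vertex_point ?u) q" "chain_length qs \<le> n + chain_length ps"
    using edge_chain_relpow[OF n(2) V(1) ps(1)] by blast
  show ?thesis
  proof (cases "p = vertex_point ?u")
    case True
    then show ?thesis using qs n ps(2) by (intro bexI[of _ qs]) auto
  next
    case False
    then have "supp p \<in> E" using realization_supp(8)[OF p] by auto
    then have "on_common_edge E p (vertex_point ?u)"
      using realization_supp(6)[OF p] by (auto simp: on_common_edge_def)
    from edge_chains_Cons[OF p this qs(1)] show ?thesis
      using False qs n ps(2) by (intro bexI[of _ "p # qs"]) auto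
  qed
qed

lemma graph_dist_upper:
  assumes p: "p \<in> realization V E" and q: "q \<in> realization V E"
  shows "graph_dist V E p q \<le> gdist E (near_vertex p) (near_vertex q) +
    (if p = vertex_point (near_vertex p) then 0 else 1) + (if q = vertex_point (near_vertex q) then 0 else 1)"
proof -
  obtain ps where ps: "ps \<in> edge_chains V E p q" "chain_length ps \<le> gdist E (near_vertex p) (near_vertex q) +
    (if p = vertex_point (near_vertex p) then 0 else 1) + (if q = vertex_point (near_vertex q) then 0 else 1)"
    using short_edge_chain[OF assms] by blast
  have "bdd_below (chain_length ` edge_chains V E p q)"
    by (rule bdd_belowI[of _ 0]) (auto simp: chain_length_nonneg)
  then have "graph_dist V E p q \<le> chain_length ps"
    unfolding graph_dist_def using p q ps(1) by (auto intro: cINF_lower)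
  then show ?thesis using ps(2) by linarith
qed

lemma graph_dist_lower:
  assumes u: "u \<in> V" and p: "p \<in> realization V E" and q: "q \<in> realization V E"
  shows "vertex_dist E u q - vertex_dist E u p \<le> graph_dist V E p q"
proof -
  have "vertex_dist E u q - vertex_dist E u p \<le> (INF ps\<in>edge_chains V E p q. chain_length ps)"
  proof (rule cINF_greatest)
    show "edge_chains V E p q \<noteq> {}" using short_edge_chain[OF p q] by auto
    fix ps assume "ps \<in> edge_chains V E p q"
    then show "vertex_dist E u q - vertex_dist E u p \<le> chain_length ps"
      using vertex_dist_chain[OF u, of ps] by (auto simp: edge_chains_def)
  qed
  then show ?thesis using p q by (simp add: graph_dist_def)
qed

lemma graph_dist_vertex_point:
  assumes "u \<in> V" "v \<in> V"
  shows "graph_dist V E (vertex_point u) (vertex_point v) = gdist E u v"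
  using graph_dist_upper[of "vertex_point u" "vertex_point v"]
    graph_dist_lower[of u "vertex_point u" "vertex_point v"] assms
  by (simp add: vertex_dist_vertex_point)

lemma graph_dist_near_vertex:
  assumes p: "p \<in> realization V E" and q: "q \<in> realization V E"
  shows "\<bar>graph_dist V E p q - gdist E (near_vertex p) (near_vertex q)\<bar> \<le> 2"
proof -
  let ?u = "near_vertex p" and ?v = "near_vertex q"
  have V: "?u \<in> V" "?v \<in> V" using p q realization_supp by auto
  have "vertex_dist E ?u p \<le> gdist E ?u ?u + 1 - p ?u"
    unfolding vertex_dist_def using realization_supp(1,6)[OF p] by (intro Min_le) blast+
  then have 1: "vertex_dist E ?u p \<le> 1" using realization_supp(4)[OF p, of ?u] by simp
  have "vertex_dist E ?u q \<in> (\<lambda>v. gdist E ?u v + 1 - q v) ` supp q"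
    unfolding vertex_dist_def using realization_supp[OF q] by (intro Min_in) auto
  then obtain w where w: "w \<in> supp q" "vertex_dist E ?u q = gdist E ?u w + 1 - q w" by auto
  have "gdist E ?u ?v \<le> gdist E ?u w + gdist E w ?v"
    using w realization_supp(3)[OF q] V by (intro gdist_tri) auto
  moreover have "gdist E w ?v \<le> 1" using supp_gdist_le[OF q w(1)] realization_supp(6)[OF q] by blast
  ultimately have "gdist E ?u ?v - 1 \<le> vertex_dist E ?u q"
    using w(2) realization_supp(5)[OF q, of w] by linarith
  then have "gdist E ?u ?v - 2 \<le> graph_dist V E p q" using graph_dist_lower[OF V(1) p q] 1 by linarith
  moreover have "graph_dist V E p q \<le> gdist E ?u ?v + 2"
    using graph_dist_upper[OF p q] by (auto split: if_splits)
  ultimately show ?thesis by linarith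
qed

text \<open>Each of the three distances is off by at most 2, and the product halves their
  sum.\<close>

lemma gp_graph_dist:
  assumes "p \<in> realization V E" "q \<in> realization V E" "x \<in> V"
  shows "\<bar>gromov_product (graph_dist V E) (vertex_point x) p q -
    gromov_product (gdist E) x (near_vertex p) (near_vertex q)\<bar> \<le> 3"
  using graph_dist_near_vertex[OF assms(1,2)] graph_dist_near_vertex[OF assms(1), of "vertex_point x"]
    graph_dist_near_vertex[OF assms(2), of "vertex_point x"] assms(3)
  by (simp add: gromov_product_def abs_le_iff field_simps)

lemma gp_graph_dist_vertex_point:
  assumes "u \<in> V" "v \<in> V" "x \<in> V"
  shows "gromov_product (graph_dist V E) (vertex_point x) (vertex_point u) (vertex_point v) =
    gromov_product (gdist E) x u v"
  using assms by (simp add: gromov_product_def graph_dist_vertex_point)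

end

section \<open>Comparison of Gromov boundaries\<close>

lemma filterlim_double_at_top:
  fixes f :: "nat \<Rightarrow> nat \<Rightarrow> real"
  shows "filterlim (\<lambda>(i, j). f i j) at_top (sequentially \<times>\<^sub>F sequentially) \<longleftrightarrow>
    (\<forall>r. \<exists>N. \<forall>i\<ge>N. \<forall>j\<ge>N. r \<le> f i j)"
  by (simp add: filterlim_at_top eventually_prod_sequentially) blast

lemma ereal_less_of_plus_one: "ereal (r + 1) \<le> x \<Longrightarrow> ereal r < x"
  by (cases x) auto

text \<open>
  Symmetry of the Gromov product is only required up to an error, so that for the cone-off it can
  be read off from the distance on vertices.
\<close>

locale boundary_space =
  fixes M :: "'a set" and d :: "'a \<Rightarrow> 'a \<Rightarrow> real" and w :: 'a and \<delta> :: real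
  assumes delta_nonneg: "0 \<le> \<delta>"
    and coarse_sym: "\<lbrakk>p \<in> M; q \<in> M\<rbrakk> \<Longrightarrow> gromov_product d w p q - \<delta> \<le> gromov_product d w q p"
    and hyp: "\<lbrakk>p \<in> M; q \<in> M; r \<in> M\<rbrakk> \<Longrightarrow>
      min (gromov_product d w p q) (gromov_product d w q r) - \<delta> \<le> gromov_product d w p r"
begin

abbreviation "P \<equiv> gromov_product d w"
abbreviation "S \<equiv> seqs_to_infinity M d w"
abbreviation "R \<equiv> boundary_rel M d w"

lemma in_S: "y \<in> S \<longleftrightarrow> range y \<subseteq> M \<and> (\<forall>r. \<exists>N. \<forall>i\<ge>N. \<forall>j\<ge>N. r \<le> P (y i) (y j))"
  unfolding seqs_to_infinity_def by (simp add: filterlim_double_at_top)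

lemma in_R: "(y, z) \<in> R \<longleftrightarrow> y \<in> S \<and> z \<in> S \<and> (\<forall>r. \<exists>N. \<forall>i\<ge>N. \<forall>j\<ge>N. r \<le> P (y i) (z j))"
  unfolding boundary_rel_def by (simp add: filterlim_double_at_top)

lemma S_M: "y \<in> S \<Longrightarrow> y i \<in> M"
  by (auto simp: in_S)

lemma trans3: "\<lbrakk>p \<in> M; q \<in> M; r \<in> M; a \<le> P p q; a \<le> P q r\<rbrakk> \<Longrightarrow> a - \<delta> \<le> P p r"
  using hyp[of p q r] by linarith

text \<open>As \<open>y\<close> converges, \<open>y i\<close> may be replaced by any later
  \<open>y l\<close> at the cost of \<open>\<delta>\<close>. So one index \<open>l\<close> for each
  late \<open>k\<close> suffices, and convergence of \<open>z\<close> is part of the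
  conclusion.\<close>

lemma asymptotic:
  assumes y: "y \<in> S" and z: "range z \<subseteq> M"
    and yz: "\<And>r. \<exists>N. \<forall>k\<ge>N. \<exists>l\<ge>k. r \<le> P (y l) (z k)"
  shows "(y, z) \<in> R"
proof -
  have zM: "z i \<in> M" for i using z by auto
  have main: "\<exists>N. \<forall>i\<ge>N. \<forall>j\<ge>N. r \<le> P (y i) (z j)" for r
  proof -
    obtain N1 where N1: "\<forall>i\<ge>N1. \<forall>j\<ge>N1. r + \<delta> \<le> P (y i) (y j)" using y in_S by meson
    obtain N2 where N2: "\<forall>k\<ge>N2. \<exists>l\<ge>k. r + \<delta> \<le> P (y l) (z k)" using yz by meson
    have "r \<le> P (y i) (z j)" if ij: "i \<ge> max N1 N2" "j \<ge> max N1 N2" for i j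
    proof -
      obtain l where "l \<ge> j" "r + \<delta> \<le> P (y l) (z j)" using N2[rule_format, of j] ij by auto
      then show ?thesis using trans3[of "y i" "y l" "z j" "r + \<delta>"] N1 ij S_M[OF y] zM by auto
    qed
    then show ?thesis by blast
  qed
  have "\<exists>N. \<forall>i\<ge>N. \<forall>j\<ge>N. r \<le> P (z i) (z j)" for r
  proof -
    obtain N where N: "\<forall>i\<ge>N. \<forall>j\<ge>N. r + 2 * \<delta> \<le> P (y i) (z j)" using main by meson
    have "r \<le> P (z i) (z j)" if "i \<ge> N" "j \<ge> N" for i j
    proof -
      have "r + 2 * \<delta> \<le> P (y i) (z i)" "r + 2 * \<delta> \<le> P (y i) (z j)" using N that by auto
      moreover have "P (y i) (z i) - \<delta> \<le> P (z i) (y i)" using coarse_sym S_M[OF y] zM by auto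
      ultimately show ?thesis using trans3[of "z i" "y i" "z j" "r + \<delta>"] S_M[OF y] zM delta_nonneg by auto
    qed
    then show ?thesis by blast
  qed
  then show ?thesis using in_R in_S y z main by auto
qed

lemma R_subseq:
  assumes y: "y \<in> S" and s: "\<And>k. k \<le> s k"
  shows "(y, y \<circ> s) \<in> R"
proof (rule asymptotic[OF y])
  fix r
  obtain N where "\<forall>i\<ge>N. \<forall>j\<ge>N. r \<le> P (y i) (y j)" using y in_S by meson
  then show "\<exists>N. \<forall>k\<ge>N. \<exists>l\<ge>k. r \<le> P (y l) ((y \<circ> s) k)"
    using s by (metis comp_apply le_trans le_refl)
qed (use S_M[OF y] in auto)

lemma equiv_R: "equiv S R"
proof (rule equivI)
  show "R \<subseteq> S \<times> S" by (auto simp: in_R)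
  show "refl_on S R" by (auto simp: refl_on_def in_R in_S)
  show "sym R"
  proof (rule symI)
    fix y z assume yz: "(y, z) \<in> R"
    have "\<exists>N. \<forall>i\<ge>N. \<forall>j\<ge>N. r \<le> P (z i) (y j)" for r
    proof -
      obtain N where N: "\<forall>i\<ge>N. \<forall>j\<ge>N. r + \<delta> \<le> P (y i) (z j)" using yz in_R by meson
      have "r \<le> P (z i) (y j)" if "i \<ge> N" "j \<ge> N" for i j
        using N[rule_format, of j i] that coarse_sym[of "y j" "z i"] yz S_M by (force simp: in_R)
      then show ?thesis by blast
    qed
    then show "(z, y) \<in> R" using yz by (simp add: in_R)
  qed
  show "trans R"
  proof (rule transI)
    fix x y z assume xy: "(x, y) \<in> R" and yz: "(y, z) \<in> R"
    have S: "x \<in> S" "y \<in> S" "z \<in> S" using xy yz by (auto simp: in_R)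
    have "\<exists>N. \<forall>i\<ge>N. \<forall>j\<ge>N. r \<le> P (x i) (z j)" for r
    proof -
      obtain N1 where N1: "\<forall>i\<ge>N1. \<forall>j\<ge>N1. r + \<delta> \<le> P (x i) (y j)" using xy in_R by meson
      obtain N2 where N2: "\<forall>i\<ge>N2. \<forall>j\<ge>N2. r + \<delta> \<le> P (y i) (z j)" using yz in_R by meson
      have "r \<le> P (x i) (z j)" if "i \<ge> max N1 N2" "j \<ge> max N1 N2" for i j
        using trans3[of "x i" "y (max N1 N2)" "z j" "r + \<delta>"] N1 N2 that S S_M by auto
      then show ?thesis by blast
    qed
    then show "(x, z) \<in> R" using S by (simp add: in_R)
  qed
qed

lemma boundary_class:
  assumes "\<xi> \<in> gromov_boundary M d w" "y \<in> \<xi>"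
  shows "y \<in> S \<and> \<xi> = R `` {y}"
proof -
  obtain z where z: "z \<in> S" "\<xi> = R `` {z}" using assms(1) unfolding gromov_boundary_def by (rule quotientE)
  then have "(z, y) \<in> R" using assms(2) by simp
  then show ?thesis using z(2) equiv_class_eq[OF equiv_R] in_R by simp
qed

lemma class_boundary: "y \<in> S \<Longrightarrow> R `` {y} \<in> gromov_boundary M d w \<and> y \<in> R `` {y}"
  unfolding gromov_boundary_def using equiv_class_self[OF equiv_R] by (simp add: quotientI)

lemma boundary_nonempty: "\<xi> \<in> gromov_boundary M d w \<Longrightarrow> \<exists>y. y \<in> \<xi>"
  unfolding gromov_boundary_def using equiv_R in_quotient_imp_non_empty by fastforce

lemma in_class: "\<lbrakk>\<xi> \<in> gromov_boundary M d w; y \<in> \<xi>\<rbrakk> \<Longrightarrow> z \<in> \<xi> \<longleftrightarrow> (y, z) \<in> R"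
  using boundary_class by blast

text \<open>Some representatives \<open>y'\<close>, \<open>z'\<close> have products above
  \<open>r\<close>. Passing from \<open>y\<close> to \<open>y'\<close> and from \<open>z'\<close> to
  \<open>z\<close> costs \<open>\<delta>\<close> each, since products of equivalent sequences tend
  to infinity. So any representatives compute the boundary product up to
  \<open>2 * \<delta>\<close>.\<close>

lemma boundary_product_gtD:
  assumes \<xi>: "\<xi> \<in> gromov_boundary M d w" and \<eta>: "\<eta> \<in> gromov_boundary M d w"
    and gt: "ereal r < boundary_product d w \<xi> \<eta>" and y: "y \<in> \<xi>" and z: "z \<in> \<eta>"
  shows "\<exists>N. \<forall>i\<ge>N. \<forall>j\<ge>N. r - 2 * \<delta> \<le> P (y i) (z j)"
proof -
  obtain y' z' where y': "y' \<in> \<xi>" and z': "z' \<in> \<eta>" and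
    "ereal r < Liminf (sequentially \<times>\<^sub>F sequentially) (\<lambda>(i, j). ereal (P (y' i) (z' j)))"
    using gt unfolding boundary_product_def by (auto simp: less_SUP_iff)
  from less_LiminfD[OF this(3)] have "\<forall>\<^sub>F (i, j) in sequentially \<times>\<^sub>F sequentially. r < P (y' i) (z' j)"
    by (rule eventually_mono) auto
  then obtain N1 where N1: "\<forall>i\<ge>N1. \<forall>j\<ge>N1. r < P (y' i) (z' j)"
    unfolding eventually_prod_sequentially by auto
  have "(y, y') \<in> R" "(z', z) \<in> R" using in_class \<xi> \<eta> y z y' z' by auto
  then obtain N2 N3 where N2: "\<forall>i\<ge>N2. \<forall>j\<ge>N2. r \<le> P (y i) (y' j)" and N3: "\<forall>i\<ge>N3. \<forall>j\<ge>N3. r \<le> P (z' i) (z j)"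
    unfolding in_R by meson
  let ?N = "max N1 (max N2 N3)"
  have inM: "y i \<in> M" "z i \<in> M" "y' i \<in> M" "z' i \<in> M" for i
    using boundary_class \<xi> \<eta> y z y' z' S_M by blast+
  have "r - 2 * \<delta> \<le> P (y i) (z j)" if "i \<ge> ?N" "j \<ge> ?N" for i j
  proof -
    have N: "?N \<ge> N1" "?N \<ge> N2" "?N \<ge> N3" by auto
    have "r \<le> P (y i) (y' ?N)" using N2 N that by simp
    moreover have "r \<le> P (y' ?N) (z' ?N)" using N1 N by (simp add: less_imp_le)
    moreover have "r \<le> P (z' ?N) (z j)" using N3 N that by simp
    ultimately have "r - \<delta> \<le> P (y i) (z' ?N)" "r - \<delta> \<le> P (z' ?N) (z j)"
      using trans3[OF inM(1,3,4), of r i ?N ?N] delta_nonneg by linarith+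
    then have "r - \<delta> - \<delta> \<le> P (y i) (z j)" by (rule trans3[OF inM(1,4,2)])
    then show ?thesis by simp
  qed
  then show ?thesis by blast
qed

lemma boundary_product_geI:
  assumes "y \<in> \<xi>" "z \<in> \<eta>" "\<forall>i\<ge>N. \<forall>j\<ge>N. r \<le> P (y i) (z j)"
  shows "ereal r \<le> boundary_product d w \<xi> \<eta>"
proof -
  have "ereal r \<le> Liminf (sequentially \<times>\<^sub>F sequentially) (\<lambda>(i, j). ereal (P (y i) (z j)))"
    by (rule Liminf_bounded) (use assms(3) in \<open>auto simp: eventually_prod_sequentially\<close>)
  also have "\<dots> \<le> boundary_product d w \<xi> \<eta>"
    unfolding boundary_product_def
    by (rule SUP_upper2[of "(y, z)"]) (use assms in auto)
  finally show ?thesis .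
qed

lemma boundary_product_trans:
  assumes "\<xi> \<in> gromov_boundary M d w" "\<eta> \<in> gromov_boundary M d w" "\<zeta> \<in> gromov_boundary M d w"
    and "ereal (r + 3 * \<delta> + 1) < boundary_product d w \<xi> \<eta>" "ereal (r + 3 * \<delta> + 1) < boundary_product d w \<eta> \<zeta>"
  shows "ereal r < boundary_product d w \<xi> \<zeta>"
proof -
  obtain x y z where x: "x \<in> \<xi>" and y: "y \<in> \<eta>" and z: "z \<in> \<zeta>" using assms(1-3) boundary_nonempty by meson
  obtain N1 where N1: "\<forall>i\<ge>N1. \<forall>j\<ge>N1. r + 3 * \<delta> + 1 - 2 * \<delta> \<le> P (x i) (y j)"
    using boundary_product_gtD[OF assms(1,2,4) x y] by blast
  obtain N2 where N2: "\<forall>i\<ge>N2. \<forall>j\<ge>N2. r + 3 * \<delta> + 1 - 2 * \<delta> \<le> P (y i) (z j)"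
    using boundary_product_gtD[OF assms(2,3,5) y z] by blast
  have inM: "x i \<in> M" "y i \<in> M" "z i \<in> M" for i
    using boundary_class assms(1-3) x y z S_M by blast+
  let ?N = "max N1 N2"
  have "r + 1 \<le> P (x i) (z j)" if "i \<ge> ?N" "j \<ge> ?N" for i j
    using trans3[of "x i" "y ?N" "z j" "r + 3 * \<delta> + 1 - 2 * \<delta>"] inM N1[rule_format, of i ?N]
      N2[rule_format, of ?N j] that by auto
  then have "ereal (r + 1) \<le> boundary_product d w \<xi> \<zeta>" by (intro boundary_product_geI[OF x z, of ?N]) auto
  then show ?thesis by (rule ereal_less_of_plus_one)
qed

lemma boundary_product_self:
  assumes "\<xi> \<in> gromov_boundary M d w"
  shows "ereal r < boundary_product d w \<xi> \<xi>"
proof -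
  obtain x where x: "x \<in> \<xi>" using assms boundary_nonempty by blast
  then obtain N where "\<forall>i\<ge>N. \<forall>j\<ge>N. r + 1 \<le> P (x i) (x j)"
    using boundary_class[OF assms x] in_S by meson
  then have "ereal (r + 1) \<le> boundary_product d w \<xi> \<xi>" by (rule boundary_product_geI[OF x x])
  then show ?thesis by (rule ereal_less_of_plus_one)
qed

lemma topspace_boundary: "topspace (boundary_topology M d w) = gromov_boundary M d w"
proof
  show "topspace (boundary_topology M d w) \<subseteq> gromov_boundary M d w"
    unfolding topspace_def by (auto simp: openin_boundary_topology)
  have "openin (boundary_topology M d w) (gromov_boundary M d w)"
    by (simp add: openin_boundary_topology)
  then show "gromov_boundary M d w \<subseteq> topspace (boundary_topology M d w)" by (rule openin_subset)
qed

text \<open>The interior of \<open>T\<close>, which is open because of the triangle inequality for boundary products.\<close>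

lemma openin_interior:
  "openin (boundary_topology M d w) {\<xi> \<in> gromov_boundary M d w. \<exists>r::real. \<forall>\<eta>\<in>gromov_boundary M d w.
     ereal r < boundary_product d w \<xi> \<eta> \<longrightarrow> \<eta> \<in> T}" (is "openin _ ?I")
  unfolding openin_boundary_topology
proof (intro conjI ballI)
  fix \<xi> assume "\<xi> \<in> ?I"
  then obtain r where \<xi>: "\<xi> \<in> gromov_boundary M d w"
    and r: "\<forall>\<eta>\<in>gromov_boundary M d w. ereal r < boundary_product d w \<xi> \<eta> \<longrightarrow> \<eta> \<in> T" by blast
  show "\<exists>r::real. \<forall>\<eta>\<in>gromov_boundary M d w. ereal r < boundary_product d w \<xi> \<eta> \<longrightarrow> \<eta> \<in> ?I"
  proof (intro exI ballI impI)
    fix \<eta> assume \<eta>: "\<eta> \<in> gromov_boundary M d w" "ereal (r + 3 * \<delta> + 1) < boundary_product d w \<xi> \<eta>"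
    have "\<forall>\<zeta>\<in>gromov_boundary M d w. ereal (r + 3 * \<delta> + 1) < boundary_product d w \<eta> \<zeta> \<longrightarrow> \<zeta> \<in> T"
      using boundary_product_trans[OF \<xi> \<eta>(1) _ \<eta>(2)] r by blast
    then show "\<eta> \<in> ?I" using \<eta>(1) by blast
  qed
qed auto

end

text \<open>Products of the second space dominate those of the first, but not conversely; the
  converse is replaced by \<open>product_mono\<close>, an order comparison of products with a common
  entry, together with \<open>product_bdd\<close>. In the application the first space is the
  cone-off, the second is the graph, \<open>\<rho>\<close> moves points to vertices, and
  \<open>A\<close> is the complement of the deleted limit sets.\<close>

locale boundary_comparison =
  B1: boundary_space M1 d1 w1 \<delta>1 + B2: boundary_space M2 d2 w2 \<delta>2
  for M1 :: "'a set" and d1 w1 \<delta>1 and M2 :: "'b set" and d2 w2 \<delta>2 +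
  fixes \<rho> :: "'a \<Rightarrow> 'b" and C :: real and A :: "(nat \<Rightarrow> 'b) set set"
  assumes rho_in: "p \<in> M1 \<Longrightarrow> \<rho> p \<in> M2"
    and product_le: "\<lbrakk>p \<in> M1; q \<in> M1\<rbrakk> \<Longrightarrow> gromov_product d1 w1 p q \<le> gromov_product d2 w2 (\<rho> p) (\<rho> q) + C"
    and product_mono: "\<lbrakk>p \<in> M1; q \<in> M1; r \<in> M1;
      gromov_product d2 w2 (\<rho> p) (\<rho> q) \<le> gromov_product d2 w2 (\<rho> p) (\<rho> r)\<rbrakk> \<Longrightarrow>
      gromov_product d1 w1 p q - C \<le> gromov_product d1 w1 p r"
    and product_bdd: "q \<in> M1 \<Longrightarrow> \<exists>b. \<forall>p\<in>M1. gromov_product d2 w2 (\<rho> p) (\<rho> q) \<le> b"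
    and A_subset: "A \<subseteq> gromov_boundary M2 d2 w2"
    and image_in_A: "y \<in> seqs_to_infinity M1 d1 w1 \<Longrightarrow> boundary_rel M2 d2 w2 `` {\<rho> \<circ> y} \<in> A"
    and A_lift: "\<xi> \<in> A \<Longrightarrow> \<exists>y\<in>seqs_to_infinity M1 d1 w1. \<rho> \<circ> y \<in> \<xi>"
begin

definition bmap :: "(nat \<Rightarrow> 'a) set \<Rightarrow> (nat \<Rightarrow> 'b) set" where
  "bmap \<xi> = B2.R `` ((\<lambda>y. \<rho> \<circ> y) ` \<xi>)"

lemma S_map: "y \<in> B1.S \<Longrightarrow> \<rho> \<circ> y \<in> B2.S"
proof -
  assume "y \<in> B1.S"
  then have "B2.R `` {\<rho> \<circ> y} \<in> gromov_boundary M2 d2 w2" using image_in_A A_subset by auto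
  then obtain z where "(\<rho> \<circ> y, z) \<in> B2.R" using B2.boundary_nonempty[of "B2.R `` {\<rho> \<circ> y}"] by auto
  then show ?thesis unfolding B2.in_R by simp
qed

lemma R_map:
  assumes "(y, z) \<in> B1.R"
  shows "(\<rho> \<circ> y, \<rho> \<circ> z) \<in> B2.R"
proof -
  have S: "y \<in> B1.S" "z \<in> B1.S" using assms by (auto simp: B1.in_R)
  have "\<exists>N. \<forall>i\<ge>N. \<forall>j\<ge>N. r \<le> B2.P ((\<rho> \<circ> y) i) ((\<rho> \<circ> z) j)" for r
  proof -
    obtain N where N: "\<forall>i\<ge>N. \<forall>j\<ge>N. r + C \<le> B1.P (y i) (z j)" using assms B1.in_R by meson
    have "r \<le> B2.P ((\<rho> \<circ> y) i) ((\<rho> \<circ> z) j)" if "i \<ge> N" "j \<ge> N" for i j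
      using N[rule_format, OF that] product_le[of "y i" "z j"] B1.S_M S by force
    then show ?thesis by blast
  qed
  then show ?thesis using S S_map by (simp add: B2.in_R)
qed

lemma bmap_class: "y \<in> B1.S \<Longrightarrow> bmap (B1.R `` {y}) = B2.R `` {\<rho> \<circ> y}"
proof -
  assume y: "y \<in> B1.S"
  have "B2.R `` {\<rho> \<circ> z} = B2.R `` {\<rho> \<circ> y}" if "(y, z) \<in> B1.R" for z
    using equiv_class_eq[OF B2.equiv_R R_map[OF that]] by simp
  moreover have "(y, y) \<in> B1.R" using B1.class_boundary[OF y] by auto
  ultimately show ?thesis unfolding bmap_def by blast
qed

lemma bmap_rep:
  assumes "\<xi> \<in> gromov_boundary M1 d1 w1" "y \<in> \<xi>"
  shows "bmap \<xi> = B2.R `` {\<rho> \<circ> y} \<and> \<rho> \<circ> y \<in> bmap \<xi> \<and> bmap \<xi> \<in> A"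
proof -
  have y: "y \<in> B1.S" "\<xi> = B1.R `` {y}" using B1.boundary_class[OF assms] by auto
  show ?thesis using bmap_class[OF y(1)] image_in_A[OF y(1)] B2.class_boundary[OF S_map[OF y(1)]] y(2) by simp
qed

text \<open>A fixed late term \<open>y N\<close> is the yardstick: its products in the second space
  are bounded by some \<open>b\<close>, so a product of \<open>y i\<close> with \<open>z j\<close>
  that reaches \<open>b\<close> is at least that with \<open>y N\<close>.
  \<open>product_mono\<close> carries this to the first space, where \<open>y i\<close> and
  \<open>y N\<close> have a large product. The threshold depends on \<open>y\<close>, so the control
  is pointwise; this is enough for injectivity and openness.\<close>

lemma product_lower:
  assumes "y \<in> B1.S"
  shows "\<exists>b. \<forall>z\<in>B1.S. (\<exists>N. \<forall>i\<ge>N. \<forall>j\<ge>N. b \<le> B2.P (\<rho> (y i)) (\<rho> (z j))) \<longrightarrow>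
    (\<exists>N. \<forall>i\<ge>N. \<forall>j\<ge>N. r \<le> B1.P (y i) (z j))"
proof -
  obtain N where N: "\<forall>i\<ge>N. \<forall>j\<ge>N. r + C \<le> B1.P (y i) (y j)" using assms B1.in_S by meson
  obtain b where b: "\<forall>p\<in>M1. B2.P (\<rho> p) (\<rho> (y N)) \<le> b" using product_bdd B1.S_M[OF assms] by meson
  show ?thesis
  proof (intro exI[of _ b] ballI impI)
    fix z assume z: "z \<in> B1.S" "\<exists>N. \<forall>i\<ge>N. \<forall>j\<ge>N. b \<le> B2.P (\<rho> (y i)) (\<rho> (z j))"
    then obtain N' where N': "\<forall>i\<ge>N'. \<forall>j\<ge>N'. b \<le> B2.P (\<rho> (y i)) (\<rho> (z j))" by blast
    have "r \<le> B1.P (y i) (z j)" if "i \<ge> max N N'" "j \<ge> max N N'" for i j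
    proof -
      have M: "y i \<in> M1" "z j \<in> M1" "y N \<in> M1" using B1.S_M assms z by auto
      then have "B2.P (\<rho> (y i)) (\<rho> (y N)) \<le> B2.P (\<rho> (y i)) (\<rho> (z j))"
        using b N'[rule_format, of i j] that by force
      then have "B1.P (y i) (y N) - C \<le> B1.P (y i) (z j)" using product_mono M by blast
      then show ?thesis using N[rule_format, of i N] that by auto
    qed
    then show "\<exists>N. \<forall>i\<ge>N. \<forall>j\<ge>N. r \<le> B1.P (y i) (z j)" by blast
  qed
qed

lemma inj_bmap: "inj_on bmap (gromov_boundary M1 d1 w1)"
proof (rule inj_onI)
  fix \<xi> \<eta> assume \<xi>: "\<xi> \<in> gromov_boundary M1 d1 w1" and \<eta>: "\<eta> \<in> gromov_boundary M1 d1 w1" and eq: "bmap \<xi> = bmap \<eta>"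
  obtain y z where y: "y \<in> \<xi>" and z: "z \<in> \<eta>" using \<xi> \<eta> B1.boundary_nonempty by meson
  have S: "y \<in> B1.S" "z \<in> B1.S" using B1.boundary_class \<xi> \<eta> y z by auto
  have "(\<rho> \<circ> y, \<rho> \<circ> z) \<in> B2.R" using bmap_rep[OF \<xi> y] bmap_rep[OF \<eta> z] eq by auto
  then have "\<exists>N. \<forall>i\<ge>N. \<forall>j\<ge>N. b \<le> B2.P (\<rho> (y i)) (\<rho> (z j))" for b by (simp add: B2.in_R)
  then have "\<exists>N. \<forall>i\<ge>N. \<forall>j\<ge>N. r \<le> B1.P (y i) (z j)" for r using product_lower[OF S(1), of r] S(2) by blast
  then have "(y, z) \<in> B1.R" using S by (simp add: B1.in_R)
  then have "z \<in> \<xi>" using B1.in_class[OF \<xi> y] by blast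
  then show "\<xi> = \<eta>" using B1.boundary_class \<xi> \<eta> z by metis
qed

lemma image_bmap: "bmap ` gromov_boundary M1 d1 w1 = A"
proof
  show "bmap ` gromov_boundary M1 d1 w1 \<subseteq> A" using bmap_rep B1.boundary_nonempty by blast
  show "A \<subseteq> bmap ` gromov_boundary M1 d1 w1"
  proof
    fix \<xi> assume \<xi>: "\<xi> \<in> A"
    then obtain y where y: "y \<in> B1.S" "\<rho> \<circ> y \<in> \<xi>" using A_lift by blast
    have "\<xi> \<in> gromov_boundary M2 d2 w2" using \<xi> A_subset by blast
    then have "\<xi> = bmap (B1.R `` {y})" using B2.boundary_class y bmap_class[OF y(1)] by metis
    then show "\<xi> \<in> bmap ` gromov_boundary M1 d1 w1" using B1.class_boundary[OF y(1)] by blast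
  qed
qed

lemma boundary_product_le:
  assumes \<xi>: "\<xi> \<in> gromov_boundary M1 d1 w1" and \<eta>: "\<eta> \<in> gromov_boundary M1 d1 w1"
    and gt: "ereal (r + 2 * \<delta>1 + C + 1) < boundary_product d1 w1 \<xi> \<eta>"
  shows "ereal r < boundary_product d2 w2 (bmap \<xi>) (bmap \<eta>)"
proof -
  obtain y z where y: "y \<in> \<xi>" and z: "z \<in> \<eta>" using \<xi> \<eta> B1.boundary_nonempty by meson
  have S: "y \<in> B1.S" "z \<in> B1.S" using B1.boundary_class \<xi> \<eta> y z by auto
  obtain N where N: "\<forall>i\<ge>N. \<forall>j\<ge>N. r + 2 * \<delta>1 + C + 1 - 2 * \<delta>1 \<le> B1.P (y i) (z j)"
    using B1.boundary_product_gtD[OF \<xi> \<eta> gt y z] by blast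
  have "r + 1 \<le> B2.P ((\<rho> \<circ> y) i) ((\<rho> \<circ> z) j)" if "i \<ge> N" "j \<ge> N" for i j
    using N[rule_format, OF that] product_le[of "y i" "z j"] S B1.S_M by force
  then have "ereal (r + 1) \<le> boundary_product d2 w2 (bmap \<xi>) (bmap \<eta>)"
    using bmap_rep[OF \<xi> y] bmap_rep[OF \<eta> z] by (intro B2.boundary_product_geI) auto
  then show ?thesis by (rule ereal_less_of_plus_one)
qed

lemma boundary_product_ge:
  assumes \<xi>: "\<xi> \<in> gromov_boundary M1 d1 w1"
  shows "\<exists>b. \<forall>\<eta>\<in>gromov_boundary M1 d1 w1. ereal b < boundary_product d2 w2 (bmap \<xi>) (bmap \<eta>) \<longrightarrow>
    ereal r < boundary_product d1 w1 \<xi> \<eta>"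
proof -
  obtain y where y: "y \<in> \<xi>" using \<xi> B1.boundary_nonempty by meson
  have yS: "y \<in> B1.S" using B1.boundary_class \<xi> y by auto
  obtain b where b: "\<forall>z\<in>B1.S. (\<exists>N. \<forall>i\<ge>N. \<forall>j\<ge>N. b \<le> B2.P (\<rho> (y i)) (\<rho> (z j))) \<longrightarrow>
    (\<exists>N. \<forall>i\<ge>N. \<forall>j\<ge>N. r + 1 \<le> B1.P (y i) (z j))"
    using product_lower[OF yS] by blast
  show ?thesis
  proof (intro exI[of _ "b + 2 * \<delta>2"] ballI impI)
    fix \<eta> assume \<eta>: "\<eta> \<in> gromov_boundary M1 d1 w1"
      and gt: "ereal (b + 2 * \<delta>2) < boundary_product d2 w2 (bmap \<xi>) (bmap \<eta>)"
    obtain z where z: "z \<in> \<eta>" using \<eta> B1.boundary_nonempty by meson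
    have zS: "z \<in> B1.S" using B1.boundary_class \<eta> z by auto
    have "bmap \<xi> \<in> gromov_boundary M2 d2 w2" "bmap \<eta> \<in> gromov_boundary M2 d2 w2"
      using bmap_rep[OF \<xi> y] bmap_rep[OF \<eta> z] A_subset by auto
    then have "\<exists>N. \<forall>i\<ge>N. \<forall>j\<ge>N. b + 2 * \<delta>2 - 2 * \<delta>2 \<le> B2.P ((\<rho> \<circ> y) i) ((\<rho> \<circ> z) j)"
      using B2.boundary_product_gtD[OF _ _ gt] bmap_rep[OF \<xi> y] bmap_rep[OF \<eta> z] by blast
    then have "\<exists>N. \<forall>i\<ge>N. \<forall>j\<ge>N. b \<le> B2.P (\<rho> (y i)) (\<rho> (z j))" by simp
    then obtain N where "\<forall>i\<ge>N. \<forall>j\<ge>N. r + 1 \<le> B1.P (y i) (z j)" using b zS by blast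
    then have "ereal (r + 1) \<le> boundary_product d1 w1 \<xi> \<eta>" by (rule B1.boundary_product_geI[OF y z])
    then show "ereal r < boundary_product d1 w1 \<xi> \<eta>"
      by (rule ereal_less_of_plus_one)
  qed
qed

lemma homeomorphic_boundary:
  "boundary_topology M1 d1 w1 homeomorphic_space subtopology (boundary_topology M2 d2 w2) A"
proof (rule homeomorphic_map_imp_homeomorphic_space[of _ _ bmap], rule bijective_open_imp_homeomorphic_map)
  let ?T1 = "boundary_topology M1 d1 w1" and ?T2 = "boundary_topology M2 d2 w2"
  let ?B1 = "gromov_boundary M1 d1 w1" and ?B2 = "gromov_boundary M2 d2 w2"
  show "inj_on bmap (topspace ?T1)" using inj_bmap by (simp add: B1.topspace_boundary)
  show "bmap ` topspace ?T1 = topspace (subtopology ?T2 A)"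
    using image_bmap A_subset by (simp add: B1.topspace_boundary B2.topspace_boundary Int_absorb1)
  have "openin ?T1 {\<xi> \<in> ?B1. bmap \<xi> \<in> U}" if U: "openin ?T2 U" for U
    unfolding openin_boundary_topology
  proof (intro conjI ballI)
    fix \<xi> assume "\<xi> \<in> {\<xi> \<in> ?B1. bmap \<xi> \<in> U}"
    then have \<xi>: "\<xi> \<in> ?B1" "bmap \<xi> \<in> U" by auto
    then obtain r where r: "\<forall>\<eta>\<in>?B2. ereal r < boundary_product d2 w2 (bmap \<xi>) \<eta> \<longrightarrow> \<eta> \<in> U"
      using U by (auto simp: openin_boundary_topology)
    have "bmap \<eta> \<in> ?B2" if "\<eta> \<in> ?B1" for \<eta> using that image_bmap A_subset by blast
    then show "\<exists>r::real. \<forall>\<eta>\<in>?B1. ereal r < boundary_product d1 w1 \<xi> \<eta> \<longrightarrow> \<eta> \<in> {\<xi> \<in> ?B1. bmap \<xi> \<in> U}"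
      using boundary_product_le[OF \<xi>(1)] r by (intro exI[of _ "r + 2 * \<delta>1 + C + 1"]) auto
  qed auto
  moreover have "bmap \<in> ?B1 \<rightarrow> ?B2" using image_bmap A_subset by blast
  ultimately have "continuous_map ?T1 ?T2 bmap"
    by (simp add: continuous_map_def B1.topspace_boundary B2.topspace_boundary)
  then show "continuous_map ?T1 (subtopology ?T2 A) bmap"
    using image_bmap by (auto simp: continuous_map_in_subtopology B1.topspace_boundary)
  show "open_map ?T1 (subtopology ?T2 A) bmap"
    unfolding open_map_def
  proof (intro allI impI)
    fix U assume U: "openin ?T1 U"
    then have UB: "U \<subseteq> ?B1" using openin_subset B1.topspace_boundary by metis
    \<comment> \<open>An open set of the whole boundary is needed. Points outside \<open>A\<close>
      are added freely, and the interior of the enlarged set meets \<open>A\<close> exactly in the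
      image of \<open>U\<close>.\<close>
    let ?T = "bmap ` U \<union> (?B2 - A)"
    let ?W = "{\<xi> \<in> ?B2. \<exists>r::real. \<forall>\<eta>\<in>?B2. ereal r < boundary_product d2 w2 \<xi> \<eta> \<longrightarrow> \<eta> \<in> ?T}"
    have "bmap ` U = ?W \<inter> A"
    proof (intro equalityI subsetI)
      fix \<zeta> assume "\<zeta> \<in> bmap ` U"
      then obtain \<xi> where \<xi>: "\<xi> \<in> U" "\<zeta> = bmap \<xi>" by blast
      then have \<xi>B: "\<xi> \<in> ?B1" using UB by blast
      obtain r where r: "\<forall>\<eta>\<in>?B1. ereal r < boundary_product d1 w1 \<xi> \<eta> \<longrightarrow> \<eta> \<in> U"
        using U \<xi>(1) by (auto simp: openin_boundary_topology)
      obtain b where b: "\<forall>\<eta>\<in>?B1. ereal b < boundary_product d2 w2 (bmap \<xi>) (bmap \<eta>) \<longrightarrow>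
          ereal r < boundary_product d1 w1 \<xi> \<eta>"
        using boundary_product_ge[OF \<xi>B] by blast
      have "\<eta> \<in> ?T" if \<eta>: "\<eta> \<in> ?B2" "ereal b < boundary_product d2 w2 \<zeta> \<eta>" for \<eta>
      proof (cases "\<eta> \<in> A")
        case True
        then obtain \<eta>' where "\<eta>' \<in> ?B1" "\<eta> = bmap \<eta>'" using image_bmap by blast
        then show ?thesis using b r \<eta> \<xi>(2) by blast
      qed (use \<eta> in auto)
      moreover have "\<zeta> \<in> A" using image_bmap \<xi> \<xi>B by blast
      ultimately show "\<zeta> \<in> ?W \<inter> A" using A_subset by blast
    next
      fix \<zeta> assume "\<zeta> \<in> ?W \<inter> A"
      then obtain r where \<zeta>: "\<zeta> \<in> ?B2" "\<zeta> \<in> A"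
        and r: "\<forall>\<eta>\<in>?B2. ereal r < boundary_product d2 w2 \<zeta> \<eta> \<longrightarrow> \<eta> \<in> ?T" by blast
      have "\<zeta> \<in> ?T" using r[rule_format, OF \<zeta>(1) B2.boundary_product_self[OF \<zeta>(1)]] .
      then show "\<zeta> \<in> bmap ` U" using \<zeta>(2) by simp
    qed
    then show "openin (subtopology ?T2 A) (bmap ` U)"
      unfolding openin_subtopology by (intro exI[of _ ?W] conjI B2.openin_interior)
  qed
qed

end

section \<open>Orbits of a quasi-isometrically embedded subgroup\<close>

abbreviation (in group) word_product :: "'a list \<Rightarrow> 'a" where
  "word_product ws \<equiv> foldr (\<otimes>) ws \<one>"

context group
begin

lemma word_product_closed: "set ws \<subseteq> carrier G \<Longrightarrow> word_product ws \<in> carrier G"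
  by (induction ws) auto

lemma word_product_append:
  "\<lbrakk>set us \<subseteq> carrier G; set vs \<subseteq> carrier G\<rbrakk> \<Longrightarrow> word_product (us @ vs) = word_product us \<otimes> word_product vs"
  by (induction us) (auto simp: m_assoc word_product_closed)

lemma word_product_in_subgroup:
  assumes "subgroup H G" "set ws \<subseteq> H"
  shows "word_product ws \<in> H"
  using assms(2) by (induction ws) (auto simp: subgroup.m_closed[OF assms(1)] subgroup.one_closed[OF assms(1)])

lemma generate_word:
  assumes "S \<subseteq> carrier G" "h \<in> generate G S"
  shows "\<exists>ws. set ws \<subseteq> S \<union> (\<lambda>s. inv s) ` S \<and> word_product ws = h"
  using assms(2)
proof (induction h rule: generate.induct)
  case one
  then show ?case by (intro exI[of _ "[]"]) auto
next
  case (incl h)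
  then show ?case using assms(1) by (intro exI[of _ "[h]"]) auto
next
  case (inv h)
  then show ?case using assms(1) by (intro exI[of _ "[inv h]"]) auto
next
  case (eng h1 h2)
  then obtain us vs where w: "set us \<subseteq> S \<union> (\<lambda>s. inv s) ` S" "word_product us = h1"
    "set vs \<subseteq> S \<union> (\<lambda>s. inv s) ` S" "word_product vs = h2" by blast
  have "S \<union> (\<lambda>s. inv s) ` S \<subseteq> carrier G" using assms(1) by auto
  then have "word_product (us @ vs) = h1 \<otimes> h2" using word_product_append[of us vs] w by blast
  then show ?case using w by (intro exI[of _ "us @ vs"]) auto
qed

lemma word_length_le: "set ws \<subseteq> S \<union> (\<lambda>s. inv s) ` S \<Longrightarrow> word_length G S (word_product ws) \<le> length ws"
  unfolding word_length_def by (rule Least_le) auto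

lemma word_length_word:
  assumes "S \<subseteq> carrier G" "h \<in> generate G S"
  obtains ws where "length ws = word_length G S h" "set ws \<subseteq> S \<union> (\<lambda>s. inv s) ` S" "word_product ws = h"
proof -
  have "\<exists>n ws. length ws = n \<and> set ws \<subseteq> S \<union> (\<lambda>s. inv s) ` S \<and> word_product ws = h"
    using generate_word[OF assms] by auto
  then have "\<exists>ws. length ws = word_length G S h \<and> set ws \<subseteq> S \<union> (\<lambda>s. inv s) ` S \<and> word_product ws = h"
    unfolding word_length_def by (rule LeastI_ex)
  then show thesis using that by auto
qed

text \<open>The path runs through the prefixes of a shortest word for
  \<open>inv a \<otimes> b\<close>. Each subword is again shortest, since a shorter word for the
  same element could be spliced into the whole.\<close>

lemma word_geodesic:
  assumes S: "S \<subseteq> H" and H: "subgroup H G" "generate G S = H" and ab: "a \<in> H" "b \<in> H"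
  shows "\<exists>u n. u 0 = a \<and> u n = b \<and> (\<forall>i\<le>n. u i \<in> H) \<and>
    (\<forall>i j. i \<le> j \<and> j \<le> n \<longrightarrow> word_metric G S (u i) (u j) = real j - real i)"
proof -
  let ?T = "S \<union> (\<lambda>s. inv s) ` S"
  have HG: "H \<subseteq> carrier G" using H(1) by (rule subgroup.subset)
  then have SG: "S \<subseteq> carrier G" using S by auto
  have TH: "?T \<subseteq> H" using S subgroup.m_inv_closed[OF H(1)] by auto
  then have TG: "?T \<subseteq> carrier G" using HG by auto
  have "inv a \<otimes> b \<in> generate G S" using H ab by (simp add: subgroup.m_closed subgroup.m_inv_closed)
  from word_length_word[OF SG this] obtain ws where
    ws: "length ws = word_length G S (inv a \<otimes> b)" "set ws \<subseteq> ?T" "word_product ws = inv a \<otimes> b" .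
  define n where "n = length ws"
  define u where "u i = a \<otimes> word_product (take i ws)" for i
  have part: "set (take i ws) \<subseteq> ?T" "set (drop i ws) \<subseteq> ?T" "set (take k (drop i ws)) \<subseteq> ?T" for i k
    using ws(2) by (meson set_take_subset set_drop_subset subset_trans)+
  have aG: "a \<in> carrier G" "b \<in> carrier G" using ab HG by auto
  have uH: "u i \<in> H" for i
    unfolding u_def using part(1)[of i] TH by (intro subgroup.m_closed[OF H(1)] ab word_product_in_subgroup[OF H(1)]) auto
  have un: "u n = b" using ws(3) aG by (simp add: u_def n_def m_assoc[symmetric])
  have dist: "word_metric G S (u i) (u j) = real j - real i" if ij: "i \<le> j" "j \<le> n" for i j
  proof -
    let ?v = "take (j - i) (drop i ws)"
    have tj: "take j ws = take i ws @ ?v" using ij by (metis le_add_diff_inverse take_add)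
    have split: "word_product (take j ws) = word_product (take i ws) \<otimes> word_product ?v"
      unfolding tj using part TG by (intro word_product_append) blast+
    have P: "word_product (take i ws) \<in> carrier G" "word_product ?v \<in> carrier G"
      "word_product (drop j ws) \<in> carrier G" using part TG by (meson subset_trans word_product_closed)+
    have mid: "inv (u i) \<otimes> u j = word_product ?v"
      unfolding u_def split using P aG by (simp add: inv_mult_group m_assoc[symmetric]) (simp add: m_assoc)
    have le: "word_length G S (word_product ?v) \<le> j - i"
      using word_length_le[OF part(3), of "j - i" i] ij by (simp add: n_def)
    have "word_product ?v \<in> generate G S"
      unfolding H(2) using part TH by (intro word_product_in_subgroup[OF H(1)]) blast
    from word_length_word[OF SG this] obtain vs where
      vs: "length vs = word_length G S (word_product ?v)" "set vs \<subseteq> ?T" "word_product vs = word_product ?v" .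
    have app: "word_product (us @ us') = word_product us \<otimes> word_product us'"
      if "set us \<subseteq> ?T" "set us' \<subseteq> ?T" for us us'
      using that TG by (intro word_product_append) blast+
    have "set (?v @ drop j ws) \<subseteq> ?T" "set (vs @ drop j ws) \<subseteq> ?T"
      using Un_least[OF part(3)[of "j - i" i] part(2)[of j]] Un_least[OF vs(2) part(2)[of j]]
      by (simp_all only: set_append)
    note tail = this
    have "ws = take i ws @ ?v @ drop j ws" using tj by (metis append_assoc append_take_drop_id)
    then have "word_product ws = word_product (take i ws @ ?v @ drop j ws)" by simp
    also have "\<dots> = word_product (take i ws) \<otimes> (word_product ?v \<otimes> word_product (drop j ws))"
      by (simp only: app[OF part(1) tail(1)] app[OF part(3,2)])
    also have "\<dots> = word_product (take i ws @ vs @ drop j ws)"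
      by (simp only: app[OF part(1) tail(2)] app[OF vs(2) part(2)] vs(3))
    finally have "word_length G S (inv a \<otimes> b) \<le> length (take i ws @ vs @ drop j ws)"
      using word_length_le[of "take i ws @ vs @ drop j ws" S] part vs(2) ws(3) by simp
    then have "j - i \<le> word_length G S (word_product ?v)" using ws(1) vs(1) ij by (simp add: n_def)
    then have "word_length G S (word_product ?v) = j - i" using le by simp
    then show ?thesis using mid ij by (simp add: word_metric_def of_nat_diff)
  qed
  show ?thesis using uH un dist aG by (intro exI[of _ u] exI[of _ n]) (auto simp: u_def)
qed

lemma finite_word_ball:
  assumes "finite S" "S \<subseteq> carrier G"
  shows "finite {h \<in> generate G S. real (word_length G S h) \<le> r}"
proof (rule finite_subset)
  let ?T = "S \<union> (\<lambda>s. inv s) ` S"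
  show "{h \<in> generate G S. real (word_length G S h) \<le> r} \<subseteq> word_product ` {ws. set ws \<subseteq> ?T \<and> length ws \<le> nat \<lfloor>r\<rfloor>}"
  proof
    fix h assume h: "h \<in> {h \<in> generate G S. real (word_length G S h) \<le> r}"
    then obtain ws where "length ws = word_length G S h" "set ws \<subseteq> ?T" "word_product ws = h"
      using word_length_word[OF assms(2)] by blast
    moreover have "word_length G S h \<le> nat \<lfloor>r\<rfloor>" using h by (simp add: le_nat_floor)
    ultimately show "h \<in> word_product ` {ws. set ws \<subseteq> ?T \<and> length ws \<le> nat \<lfloor>r\<rfloor>}" by auto
  qed
  show "finite (word_product ` {ws. set ws \<subseteq> ?T \<and> length ws \<le> nat \<lfloor>r\<rfloor>})"
    using assms(1) by (intro finite_imageI finite_lists_length_le) auto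
qed

end

section \<open>Actions by graph automorphisms\<close>

locale graph_action = conn_graph V E + group_action G V \<phi>
  for V :: "'v set" and E and G :: "('g, 'm) monoid_scheme" (structure) and \<phi> +
  assumes edge_iff: "\<lbrakk>g \<in> carrier G; u \<in> V; v \<in> V\<rbrakk> \<Longrightarrow> {\<phi> g u, \<phi> g v} \<in> E \<longleftrightarrow> {u, v} \<in> E"
begin

sublocale group G
  using group_hom by (rule group_hom.axioms(1))

lemma act_closed [simp]: "\<lbrakk>g \<in> carrier G; v \<in> V\<rbrakk> \<Longrightarrow> \<phi> g v \<in> V"
  using element_image by blast

lemma act_one [simp]: "v \<in> V \<Longrightarrow> \<phi> \<one> v = v"
  using id_eq_one by (metis restrict_apply')

lemma act_inv: "\<lbrakk>g \<in> carrier G; v \<in> V\<rbrakk> \<Longrightarrow> \<phi> (inv g) (\<phi> g v) = v"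
  by (rule orbit_sym_aux) auto

lemma gdist_act_le:
  assumes "g \<in> carrier G" "u \<in> V" "v \<in> V"
  shows "gdist E (\<phi> g u) (\<phi> g v) \<le> gdist E u v"
proof -
  obtain f n where f: "f 0 = u" "f n = v" "real n = gdist E u v" "\<forall>i\<le>n. f i \<in> V" "\<forall>i<n. {f i, f (Suc i)} \<in> E"
    using gdist_geodesic assms(2,3) by metis
  have "gdist E ((\<phi> g \<circ> f) 0) ((\<phi> g \<circ> f) (0 + n)) \<le> n"
    by (rule gdist_le_chain) (use f edge_iff assms(1) in auto)
  then show ?thesis using f by simp
qed

lemma gdist_act:
  assumes "g \<in> carrier G" "u \<in> V" "v \<in> V"
  shows "gdist E (\<phi> g u) (\<phi> g v) = gdist E u v"
  using gdist_act_le[OF assms] gdist_act_le[of "inv g" "\<phi> g u" "\<phi> g v"] assms by (simp add: act_inv)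

lemma realization_action_vertex_point:
  assumes g: "g \<in> carrier G" and v: "v \<in> V"
  shows "realization_action G V E \<phi> g (vertex_point v) = vertex_point (\<phi> g v)"
proof
  fix w
  have "\<phi> (inv g) w = v \<longleftrightarrow> w = \<phi> g v" if "w \<in> V"
    using act_inv[OF g v] act_inv[of "inv g" w] g that by auto
  then show "realization_action G V E \<phi> g (vertex_point v) w = vertex_point (\<phi> g v) w"
    using g v by (auto simp: realization_action_def) (auto simp: vertex_point_def)
qed

end

locale aqi_graph = graph_action V E G \<phi> + hyp: coarse_hyperbolic V "gdist E" \<delta>
  for V :: "'v set" and E and G :: "('g, 'm) monoid_scheme" (structure) and \<phi> and \<delta> +
  fixes H :: "'g set" and x :: 'v and S :: "'g set" and K C :: real
  assumes H: "subgroup H G" and x: "x \<in> V"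
    and acyl: "0 \<le> \<epsilon> \<Longrightarrow> \<exists>R. \<forall>k\<in>H. R \<le> gdist E x (\<phi> k x) \<longrightarrow>
      finite {g \<in> carrier G. gdist E (\<phi> g x) x \<le> \<epsilon> \<and> gdist E (\<phi> g (\<phi> k x)) (\<phi> k x) \<le> \<epsilon>}"
    and S: "finite S" "S \<subseteq> H" "generate G S = H"
    and KC: "1 \<le> K" "0 \<le> C"
    and qi: "\<lbrakk>a \<in> H; b \<in> H\<rbrakk> \<Longrightarrow> word_metric G S a b / K - C \<le> gdist E (\<phi> a x) (\<phi> b x) \<and>
      gdist E (\<phi> a x) (\<phi> b x) \<le> K * word_metric G S a b + C"
begin

lemma H_carrier: "h \<in> H \<Longrightarrow> h \<in> carrier G"
  using H by (rule subgroup.mem_carrier)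

text \<open>The lower bound of the quasi-isometric embedding confines these elements to a ball of
  the word metric.\<close>

lemma finite_orbit_ball: "finite {k \<in> H. gdist E x (\<phi> k x) \<le> r}"
proof (rule finite_subset)
  show "{k \<in> H. gdist E x (\<phi> k x) \<le> r} \<subseteq> {h \<in> generate G S. real (word_length G S h) \<le> K * (r + C)}"
  proof
    fix k assume "k \<in> {k \<in> H. gdist E x (\<phi> k x) \<le> r}"
    then have k: "k \<in> H" "gdist E x (\<phi> k x) \<le> r" by auto
    have "word_metric G S \<one> k / K - C \<le> gdist E x (\<phi> k x)"
      using qi[of \<one> k] k(1) subgroup.one_closed[OF H] x by simp
    then have "word_length G S k / K \<le> r + C" using k H_carrier by (simp add: word_metric_def)
    then have "word_length G S k \<le> K * (r + C)" using KC by (simp add: divide_le_eq mult.commute)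
    then show "k \<in> {h \<in> generate G S. real (word_length G S h) \<le> K * (r + C)}" using k S by simp
  qed
  show "finite {h \<in> generate G S. real (word_length G S h) \<le> K * (r + C)}"
    using S H_carrier by (intro finite_word_ball) auto
qed

text \<open>Stability with \<open>e = d\<close>, applied to the orbit of a word geodesic from
  \<open>h\<close> to \<open>k\<close>. Translation by \<open>g\<close> is an isometry, so
  \<open>Q\<close> is uniform over all cosets.\<close>

lemma coset_quasiconvex:
  "\<exists>Q\<ge>0. \<forall>g\<in>carrier G. \<forall>h\<in>H. \<forall>k\<in>H. \<forall>p\<in>V. \<exists>l\<in>H.
    gdist E p (\<phi> (g \<otimes> l) x) \<le> gromov_product (gdist E) p (\<phi> (g \<otimes> h) x) (\<phi> (g \<otimes> k) x) + Q"
proof -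
  \<comment> \<open>Consecutive elements of a word geodesic are at word distance 1, so their images
    are at most \<open>K + C\<close> apart.\<close>
  define c where "c = K + C"
  have c: "1 \<le> c" using KC by (simp add: c_def)
  have "\<exists>Q\<ge>0. \<forall>f n p. p \<in> V \<longrightarrow> (\<forall>i\<le>n. f i \<in> V) \<longrightarrow> (\<forall>i<n. gdist E (f i) (f (Suc i)) \<le> c) \<longrightarrow>
    (\<forall>i j. i \<le> j \<and> j \<le> n \<longrightarrow> real j - real i \<le> K * gdist E (f i) (f j) + K * C) \<longrightarrow>
    (\<exists>i\<le>n. gdist E p (f i) \<le> gromov_product (gdist E) p (f 0) (f n) + Q)"
  proof (rule hyp.morse[where adj = "\<lambda>u v. gdist E u v \<le> c" and e = "gdist E"])
    fix u v p assume V: "u \<in> V" "v \<in> V" "p \<in> V" and uv: "gdist E u v \<le> c"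
    show "gdist E p u \<le> gromov_product (gdist E) p u v + c"
      using hyp.dist_le_gp[OF V(3,1,2)] uv by linarith
  next
    fix u v assume V: "u \<in> V" "v \<in> V"
    obtain f n where f: "f 0 = u" "f n = v" "real n = gdist E u v" "\<forall>i\<le>n. f i \<in> V"
        "\<forall>i\<le>n. \<forall>j\<le>n. gdist E (f i) (f j) = \<bar>real i - real j\<bar>"
      using hyp.discrete_geodesic V by metis
    have "1 * gdist E u v \<le> K * gdist E u v" using KC by (intro mult_right_mono) auto
    moreover have "0 \<le> K * C" using KC by simp
    ultimately have "real n \<le> K * gdist E u v + K * C" using f(3) by linarith
    moreover have "gdist E (f i) (f (Suc i)) \<le> c" if "i < n" for i using f(5) that c by simp
    moreover have "gdist E u (f i) \<le> gdist E u v" if "i \<le> n" for i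
      using f(1,3) f(5)[rule_format, of 0 i] that by simp
    ultimately show "\<exists>f m. f 0 = u \<and> f m = v \<and> real m \<le> K * gdist E u v + K * C \<and>
      (\<forall>i<m. gdist E (f i) (f (Suc i)) \<le> c) \<and> (\<forall>i\<le>m. f i \<in> V \<and> gdist E u (f i) \<le> gdist E u v)"
      using f by metis
  qed (use KC c gdist_tri in \<open>auto simp: gdist_sym\<close>)
  then obtain Q where "Q \<ge> 0" and Q: "\<And>f n p. p \<in> V \<Longrightarrow> (\<forall>i\<le>n. f i \<in> V) \<Longrightarrow> (\<forall>i<n. gdist E (f i) (f (Suc i)) \<le> c) \<Longrightarrow>
    (\<forall>i j. i \<le> j \<and> j \<le> n \<longrightarrow> real j - real i \<le> K * gdist E (f i) (f j) + K * C) \<Longrightarrow>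
    (\<exists>i\<le>n. gdist E p (f i) \<le> gromov_product (gdist E) p (f 0) (f n) + Q)"
    by metis
  show ?thesis
  proof (intro exI[of _ Q] conjI ballI \<open>Q \<ge> 0\<close>)
    fix g h k p assume g: "g \<in> carrier G" and h: "h \<in> H" and k: "k \<in> H" and p: "p \<in> V"
    obtain u n where u: "u 0 = h" "u n = k" "\<forall>i\<le>n. u i \<in> H"
      "\<forall>i j. i \<le> j \<and> j \<le> n \<longrightarrow> word_metric G S (u i) (u j) = real j - real i"
      using word_geodesic[OF S(2) H S(3) h k] by metis
    define f where "f i = \<phi> (g \<otimes> u i) x" for i
    have fV: "f i \<in> V" if "i \<le> n" for i using u(3) that g H_carrier x by (simp add: f_def)
    have d: "gdist E (f i) (f j) = gdist E (\<phi> (u i) x) (\<phi> (u j) x)" if "i \<le> n" "j \<le> n" for i j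
      using gdist_act[OF g, of "\<phi> (u i) x" "\<phi> (u j) x"] u(3) that g H_carrier x
      by (simp add: f_def composition_rule)
    have "\<exists>i\<le>n. gdist E p (f i) \<le> gromov_product (gdist E) p (f 0) (f n) + Q"
    proof (rule Q[OF p])
      show "\<forall>i\<le>n. f i \<in> V" using fV by blast
      show "\<forall>i<n. gdist E (f i) (f (Suc i)) \<le> c"
      proof (intro allI impI)
        fix i assume i: "i < n"
        then have "word_metric G S (u i) (u (Suc i)) = 1" using u(4)[rule_format, of i "Suc i"] by simp
        then show "gdist E (f i) (f (Suc i)) \<le> c"
          using d[of i "Suc i"] qi[of "u i" "u (Suc i)"] u(3) i by (simp add: c_def)
      qed
      show "\<forall>i j. i \<le> j \<and> j \<le> n \<longrightarrow> real j - real i \<le> K * gdist E (f i) (f j) + K * C"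
      proof (intro allI impI)
        fix i j assume ij: "i \<le> j \<and> j \<le> n"
        then have "(real j - real i) / K \<le> gdist E (f i) (f j) + C"
          using d[of i j] qi[of "u i" "u j"] u(3,4) by force
        then show "real j - real i \<le> K * gdist E (f i) (f j) + K * C"
          using KC by (simp add: divide_le_eq algebra_simps)
      qed
    qed
    then show "\<exists>l\<in>H. gdist E p (\<phi> (g \<otimes> l) x) \<le> gromov_product (gdist E) p (\<phi> (g \<otimes> h) x) (\<phi> (g \<otimes> k) x) + Q"
      using u by (auto simp: f_def)
  qed
qed

section \<open>The cone-off along the translates of the orbit\<close>

definition cone_edges :: "'v set set" where
  "cone_edges = cone_off E (coset_orbits G \<phi> H x)"

lemma E_subset: "E \<subseteq> cone_edges"
  by (auto simp: cone_edges_def cone_off_def)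

lemma cone_edges_cases:
  assumes "{u, v} \<in> cone_edges"
  obtains "{u, v} \<in> E" | g h k where "g \<in> carrier G" "h \<in> H" "k \<in> H" "u = \<phi> (g \<otimes> h) x" "v = \<phi> (g \<otimes> k) x"
proof (cases "{u, v} \<in> E")
  case False
  then obtain a b g where "{u, v} = {a, b}" "g \<in> carrier G" "a \<in> (\<lambda>k. \<phi> k x) ` (g <# H)" "b \<in> (\<lambda>k. \<phi> k x) ` (g <# H)"
    using assms by (auto simp: cone_edges_def cone_off_def coset_orbits_def)
  then have g: "g \<in> carrier G" "u \<in> (\<lambda>k. \<phi> k x) ` (g <# H)" "v \<in> (\<lambda>k. \<phi> k x) ` (g <# H)"
    by (auto simp: doubleton_eq_iff)
  then obtain h k where "h \<in> H" "k \<in> H" "u = \<phi> (g \<otimes> h) x" "v = \<phi> (g \<otimes> k) x" by (auto simp: l_coset_def)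
  then show thesis using that(2) g(1) by blast
qed (rule that)

lemma cone_edges_coset:
  assumes "g \<in> carrier G" "h \<in> H" "k \<in> H" "\<phi> (g \<otimes> h) x \<noteq> \<phi> (g \<otimes> k) x"
  shows "{\<phi> (g \<otimes> h) x, \<phi> (g \<otimes> k) x} \<in> cone_edges"
proof -
  have "\<phi> (g \<otimes> h) x \<in> (\<lambda>k. \<phi> k x) ` (g <# H)" "\<phi> (g \<otimes> k) x \<in> (\<lambda>k. \<phi> k x) ` (g <# H)"
    using assms by (auto simp: l_coset_def)
  then show ?thesis using assms unfolding cone_edges_def cone_off_def coset_orbits_def by blast
qed

lemma cone_edges_connected: "connected_graph V cone_edges"
  unfolding connected_graph_def
proof
  show "simple_graph V cone_edges"
    unfolding simple_graph_def
  proof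
    fix e assume e: "e \<in> cone_edges"
    show "e \<subseteq> V \<and> card e = 2"
    proof (cases "e \<in> E")
      case False
      then obtain u v g where uv: "e = {u, v}" "u \<noteq> v" "g \<in> carrier G" "u \<in> (\<lambda>k. \<phi> k x) ` (g <# H)" "v \<in> (\<lambda>k. \<phi> k x) ` (g <# H)"
        using e by (auto simp: cone_edges_def cone_off_def coset_orbits_def)
      then show ?thesis using x H_carrier by (auto simp: l_coset_def)
    qed (use edge_subset edge_card in auto)
  qed
  have "{(a, b). {a, b} \<in> E}\<^sup>* \<subseteq> {(a, b). {a, b} \<in> cone_edges}\<^sup>*"
    by (rule rtrancl_mono) (use E_subset in auto)
  then show "\<forall>u\<in>V. \<forall>v\<in>V. (u, v) \<in> {(a, b). {a, b} \<in> cone_edges}\<^sup>*"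
    using connected_graph by (auto simp: connected_graph_def)
qed

sublocale cone: conn_graph V cone_edges
  by unfold_locales (rule cone_edges_connected)

lemma cone_dist_le:
  assumes "u \<in> V" "v \<in> V"
  shows "gdist cone_edges u v \<le> gdist E u v"
proof -
  obtain f n where f: "f 0 = u" "f n = v" "real n = gdist E u v" "\<forall>i<n. {f i, f (Suc i)} \<in> E"
    using gdist_geodesic assms by metis
  have "gdist cone_edges (f 0) (f (0 + n)) \<le> n"
    by (rule gdist_le_chain) (use f E_subset in auto)
  then show ?thesis using f by simp
qed

lemma cone_dist_coset:
  assumes "g \<in> carrier G" "h \<in> H" "k \<in> H"
  shows "gdist cone_edges (\<phi> (g \<otimes> h) x) (\<phi> (g \<otimes> k) x) \<le> 1"
  using cone_edges_coset[OF assms] gdist_edge by (cases "\<phi> (g \<otimes> h) x = \<phi> (g \<otimes> k) x") auto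

text \<open>Geodesics of the graph are unparametrized quasi-geodesics of the cone-off.\<close>

lemma cone_gp_le_gp:
  "\<exists>C'\<ge>0. \<forall>p\<in>V. \<forall>u\<in>V. \<forall>v\<in>V. gromov_product (gdist cone_edges) p u v \<le> gromov_product (gdist E) p u v + C'"
proof -
  obtain Q where Q0: "Q \<ge> 0" and Q: "\<And>g h k p. \<lbrakk>g \<in> carrier G; h \<in> H; k \<in> H; p \<in> V\<rbrakk> \<Longrightarrow> \<exists>l\<in>H.
    gdist E p (\<phi> (g \<otimes> l) x) \<le> gromov_product (gdist E) p (\<phi> (g \<otimes> h) x) (\<phi> (g \<otimes> k) x) + Q"
    using coset_quasiconvex by metis
  have "\<exists>C'\<ge>0. \<forall>f n p. p \<in> V \<longrightarrow> (\<forall>i\<le>n. f i \<in> V) \<longrightarrow> (\<forall>i<n. {f i, f (Suc i)} \<in> cone_edges) \<longrightarrow>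
    (\<forall>i j. i \<le> j \<and> j \<le> n \<longrightarrow> real j - real i \<le> 1 * gdist cone_edges (f i) (f j) + 0) \<longrightarrow>
    (\<exists>i\<le>n. gdist cone_edges p (f i) \<le> gromov_product (gdist E) p (f 0) (f n) + C')"
  proof (rule hyp.morse[where adj = "\<lambda>u v. {u, v} \<in> cone_edges" and e = "gdist cone_edges"])
    fix u v p assume V: "u \<in> V" "v \<in> V" "p \<in> V" and uv: "{u, v} \<in> cone_edges"
    from uv show "gdist cone_edges p u \<le> gromov_product (gdist E) p u v + (Q + 1)"
    proof (cases rule: cone_edges_cases)
      case 1
      then have "gdist E u v \<le> 1" by (rule gdist_edge)
      then have "gdist E p u \<le> gromov_product (gdist E) p u v + 1"
        using hyp.dist_le_gp[OF V(3,1,2)] by linarith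
      then show ?thesis using cone_dist_le[OF V(3,1)] Q0 by linarith
    next
      \<comment> \<open>Quasiconvexity provides a point of the orbit near \<open>p\<close>, and at
        most one edge of the cone-off leads from it to \<open>u\<close>; hence the constant
        \<open>Q + 1\<close>.\<close>
      case (2 g h k)
      obtain l where l: "l \<in> H" "gdist E p (\<phi> (g \<otimes> l) x) \<le> gromov_product (gdist E) p u v + Q"
        using Q[OF 2(1-3) V(3)] 2 by auto
      have w: "\<phi> (g \<otimes> l) x \<in> V" using 2(1) l(1) H_carrier x by simp
      have "gdist cone_edges p u \<le> gdist cone_edges p (\<phi> (g \<otimes> l) x) + gdist cone_edges (\<phi> (g \<otimes> l) x) u"
        using cone.gdist_tri V w by blast
      moreover have "gdist cone_edges (\<phi> (g \<otimes> l) x) u \<le> 1" using cone_dist_coset[OF 2(1) l(1) 2(2)] 2(4) by simp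
      ultimately show ?thesis using cone_dist_le[OF V(3) w] l(2) by linarith
    qed
  next
    fix u v assume V: "u \<in> V" "v \<in> V"
    obtain f n where f: "f 0 = u" "f n = v" "real n = gdist cone_edges u v" "\<forall>i\<le>n. f i \<in> V" "\<forall>i<n. {f i, f (Suc i)} \<in> cone_edges"
        "\<forall>i\<le>n. \<forall>j\<le>n. gdist cone_edges (f i) (f j) = \<bar>real i - real j\<bar>"
      using cone.gdist_geodesic[OF V] by metis
    have "gdist cone_edges u (f i) \<le> gdist cone_edges u v" if "i \<le> n" for i
      using f(1,3) f(6)[rule_format, of 0 i] that by simp
    then show "\<exists>f m. f 0 = u \<and> f m = v \<and> real m \<le> 1 * gdist cone_edges u v + 0 \<and>
      (\<forall>i<m. {f i, f (Suc i)} \<in> cone_edges) \<and> (\<forall>i\<le>m. f i \<in> V \<and> gdist cone_edges u (f i) \<le> gdist cone_edges u v)"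
      using f by (intro exI[of _ f] exI[of _ n]) auto
  qed (use Q0 cone.gdist_tri cone_dist_le in \<open>auto simp: gdist_sym\<close>)
  then obtain C' where C0: "C' \<ge> 0" and C': "\<And>f n p. p \<in> V \<Longrightarrow> (\<forall>i\<le>n. f i \<in> V) \<Longrightarrow> (\<forall>i<n. {f i, f (Suc i)} \<in> cone_edges) \<Longrightarrow>
    (\<forall>i j. i \<le> j \<and> j \<le> n \<longrightarrow> real j - real i \<le> 1 * gdist cone_edges (f i) (f j) + 0) \<Longrightarrow>
    (\<exists>i\<le>n. gdist cone_edges p (f i) \<le> gromov_product (gdist E) p (f 0) (f n) + C')"
    by metis
  show ?thesis
  proof (intro exI[of _ C'] conjI ballI C0)
    fix p u v assume V: "p \<in> V" "u \<in> V" "v \<in> V"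
    obtain f n where f: "f 0 = u" "f n = v" "real n = gdist cone_edges u v" "\<forall>i\<le>n. f i \<in> V" "\<forall>i<n. {f i, f (Suc i)} \<in> cone_edges"
        "\<forall>i\<le>n. \<forall>j\<le>n. gdist cone_edges (f i) (f j) = \<bar>real i - real j\<bar>"
      using cone.gdist_geodesic[OF V(2,3)] by metis
    have "\<exists>i\<le>n. gdist cone_edges p (f i) \<le> gromov_product (gdist E) p (f 0) (f n) + C'"
      by (rule C'[OF V(1) f(4,5)]) (use f(6) in auto)
    then obtain i where i: "i \<le> n" "gdist cone_edges p (f i) \<le> gromov_product (gdist E) p u v + C'" using f by auto
    \<comment> \<open>As \<open>f i\<close> lies on a cone-off geodesic from \<open>u\<close> to
      \<open>v\<close>, its cone-off distance from \<open>p\<close> is at least the cone-off product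
      of \<open>u\<close>, \<open>v\<close> at \<open>p\<close>.\<close>
    have "gdist cone_edges u (f i) + gdist cone_edges (f i) v = gdist cone_edges u v"
      using f(6)[rule_format, of 0 i] f(6)[rule_format, of i n] f(1-3) i by simp
    then have "gromov_product (gdist cone_edges) p u v \<le> gdist cone_edges p (f i)"
      using cone.gdist_tri[of u "f i" p] cone.gdist_tri[of v "f i" p] V f(4) i(1)
        gdist_sym[of cone_edges p "f i"] gdist_sym[of cone_edges v "f i"] by (simp add: gromov_product_def)
    then show "gromov_product (gdist cone_edges) p u v \<le> gromov_product (gdist E) p u v + C'" using i by linarith
  qed
qed

end

section \<open>Limits of sequences bounded in the cone-off\<close>

context aqi_graph
begin

sublocale bd: boundary_space V "gdist E" x \<delta>
proof
  show "0 \<le> \<delta>" using hyp.delta_pos by simp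
  show "gromov_product (gdist E) x p q - \<delta> \<le> gromov_product (gdist E) x q p" for p q
    using hyp.delta_pos hyp.gp_sym[of x p q] by simp
qed (rule hyp.four_point[OF x])

text \<open>If \<open>\<gamma>0\<close> and \<open>\<gamma>\<close> share the same \<open>k\<close>,
  then \<open>inv \<gamma>0 \<otimes> \<gamma>\<close> moves \<open>x\<close> and
  \<open>\<phi> k x\<close> by at most \<open>2 * B\<close>. These points are far apart when
  \<open>r\<close> is far from \<open>x\<close>, so acylindricity leaves finitely many
  \<open>\<gamma>\<close> for each \<open>k\<close>, and \<open>finite_orbit_ball\<close> leaves
  finitely many \<open>k\<close>.\<close>

lemma finite_cosets_near:
  assumes "0 \<le> B"
  shows "\<exists>L. \<forall>r\<in>V. L \<le> gdist E x r \<longrightarrow>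
    finite {\<gamma> \<in> carrier G. gdist E x (\<phi> \<gamma> x) \<le> B \<and> (\<exists>k\<in>H. gdist E r (\<phi> (\<gamma> \<otimes> k) x) \<le> B)}"
proof -
  obtain R where R: "\<And>k. \<lbrakk>k \<in> H; R \<le> gdist E x (\<phi> k x)\<rbrakk> \<Longrightarrow>
      finite {g \<in> carrier G. gdist E (\<phi> g x) x \<le> 2 * B \<and> gdist E (\<phi> g (\<phi> k x)) (\<phi> k x) \<le> 2 * B}"
    using acyl[of "2 * B"] assms by auto
  show ?thesis
  proof (intro exI[of _ "R + 2 * B"] ballI impI)
    fix r assume r: "r \<in> V" "R + 2 * B \<le> gdist E x r"
    define F where "F k = {\<gamma> \<in> carrier G. gdist E x (\<phi> \<gamma> x) \<le> B \<and> gdist E r (\<phi> (\<gamma> \<otimes> k) x) \<le> B}" for k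
    let ?K = "{k \<in> H. gdist E x (\<phi> k x) \<le> gdist E x r + 2 * B}"
    \<comment> \<open>The isometry \<open>\<gamma>\<close> takes \<open>x\<close> and
      \<open>\<phi> k x\<close> to within \<open>B\<close> of \<open>x\<close> and \<open>r\<close>.
      The estimate gives both the lower bound \<open>R\<close> required for acylindricity and the
      upper bound defining \<open>?K\<close>.\<close>
    have dist: "\<bar>gdist E x (\<phi> k x) - gdist E x r\<bar> \<le> 2 * B" if k: "k \<in> H" "\<gamma> \<in> F k" for k \<gamma>
    proof -
      have \<gamma>: "\<gamma> \<in> carrier G" "gdist E x (\<phi> \<gamma> x) \<le> B" "gdist E r (\<phi> (\<gamma> \<otimes> k) x) \<le> B"
        using k(2) by (auto simp: F_def)
      have V: "\<phi> \<gamma> x \<in> V" "\<phi> (\<gamma> \<otimes> k) x \<in> V" using \<gamma>(1) k(1) H_carrier x by auto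
      have "gdist E (\<phi> \<gamma> x) (\<phi> (\<gamma> \<otimes> k) x) = gdist E x (\<phi> k x)"
        using gdist_act[OF \<gamma>(1), of x "\<phi> k x"] k(1) H_carrier x \<gamma>(1) by (simp add: composition_rule)
      then show ?thesis
        using gdist_tri[of "\<phi> \<gamma> x" x "\<phi> (\<gamma> \<otimes> k) x"] gdist_tri[of x r "\<phi> (\<gamma> \<otimes> k) x"]
          gdist_tri[of x "\<phi> \<gamma> x" r] gdist_tri[of "\<phi> \<gamma> x" "\<phi> (\<gamma> \<otimes> k) x" r]
          gdist_sym[of E x "\<phi> \<gamma> x"] gdist_sym[of E r "\<phi> (\<gamma> \<otimes> k) x"] V r(1) x \<gamma>(2,3)
        by linarith
    qed
    have fin: "finite (F k)" if k: "k \<in> H" for k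
    proof (cases "F k = {}")
      case False
      then obtain \<gamma>0 where \<gamma>0: "\<gamma>0 \<in> F k" by auto
      let ?A = "{g \<in> carrier G. gdist E (\<phi> g x) x \<le> 2 * B \<and> gdist E (\<phi> g (\<phi> k x)) (\<phi> k x) \<le> 2 * B}"
      have kx: "\<phi> k x \<in> V" "k \<in> carrier G" using k H_carrier x by auto
      have g0: "\<gamma>0 \<in> carrier G" using \<gamma>0 by (simp add: F_def)
      have shift: "gdist E (\<phi> (inv \<gamma>0 \<otimes> \<gamma>) v) v \<le> 2 * B"
        if "\<gamma> \<in> carrier G" "v \<in> V" "z \<in> V" "gdist E z (\<phi> \<gamma> v) \<le> B" "gdist E z (\<phi> \<gamma>0 v) \<le> B" for \<gamma> v z
      proof -
        have "gdist E (\<phi> (inv \<gamma>0 \<otimes> \<gamma>) v) v = gdist E (\<phi> (inv \<gamma>0) (\<phi> \<gamma> v)) (\<phi> (inv \<gamma>0) (\<phi> \<gamma>0 v))"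
          using that g0 by (simp add: composition_rule act_inv)
        also have "\<dots> = gdist E (\<phi> \<gamma> v) (\<phi> \<gamma>0 v)" using that g0 by (intro gdist_act) auto
        also have "\<dots> \<le> gdist E z (\<phi> \<gamma> v) + gdist E z (\<phi> \<gamma>0 v)"
          using gdist_tri[of "\<phi> \<gamma> v" z "\<phi> \<gamma>0 v"] that g0 gdist_sym[of E z "\<phi> \<gamma> v"] by simp
        finally show ?thesis using that by simp
      qed
      have "(\<lambda>\<gamma>. inv \<gamma>0 \<otimes> \<gamma>) ` F k \<subseteq> ?A"
      proof
        fix g assume "g \<in> (\<lambda>\<gamma>. inv \<gamma>0 \<otimes> \<gamma>) ` F k"
        then obtain \<gamma> where \<gamma>: "\<gamma> \<in> F k" "g = inv \<gamma>0 \<otimes> \<gamma>" by auto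
        then show "g \<in> ?A"
          using shift[of \<gamma> x x] shift[of \<gamma> "\<phi> k x" r] \<gamma>0 g0 x kx r(1) by (auto simp: F_def composition_rule)
      qed
      moreover have "finite ?A" using R[OF k] dist[OF k \<gamma>0] r(2) by linarith
      ultimately have "finite ((\<lambda>\<gamma>. inv \<gamma>0 \<otimes> \<gamma>) ` F k)" by (rule finite_subset)
      moreover have "inj_on (\<lambda>\<gamma>. inv \<gamma>0 \<otimes> \<gamma>) (F k)"
        using g0 by (intro inj_onI) (auto simp: F_def)
      ultimately show ?thesis by (rule finite_imageD)
    qed simp
    have "{\<gamma> \<in> carrier G. gdist E x (\<phi> \<gamma> x) \<le> B \<and> (\<exists>k\<in>H. gdist E r (\<phi> (\<gamma> \<otimes> k) x) \<le> B)} \<subseteq> (\<Union>k\<in>?K. F k)"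
    proof
      fix \<gamma> assume "\<gamma> \<in> {\<gamma> \<in> carrier G. gdist E x (\<phi> \<gamma> x) \<le> B \<and> (\<exists>k\<in>H. gdist E r (\<phi> (\<gamma> \<otimes> k) x) \<le> B)}"
      then obtain k where k: "k \<in> H" "\<gamma> \<in> F k" by (auto simp: F_def)
      then have "k \<in> ?K" using dist[OF k] by auto
      then show "\<gamma> \<in> (\<Union>k\<in>?K. F k)" using k by blast
    qed
    moreover have "finite (\<Union>k\<in>?K. F k)" using finite_orbit_ball fin by (intro finite_UN_I) auto
    ultimately show "finite {\<gamma> \<in> carrier G. gdist E x (\<phi> \<gamma> x) \<le> B \<and> (\<exists>k\<in>H. gdist E r (\<phi> (\<gamma> \<otimes> k) x) \<le> B)}"
      by (rule finite_subset)
  qed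
qed

text \<open>The vertex version of lying in the limit set of a conjugate of \<open>H\<close>; stated
  up to \<open>bd.R\<close>, so that it depends only on the class of \<open>y\<close>.\<close>

definition limit_of_conjugate :: "(nat \<Rightarrow> 'v) \<Rightarrow> bool" where
  "limit_of_conjugate y \<longleftrightarrow> (\<exists>\<gamma>\<in>carrier G. \<exists>h. range h \<subseteq> H \<and> (y, \<lambda>n. \<phi> (\<gamma> \<otimes> h n \<otimes> inv \<gamma>) x) \<in> bd.R)"

lemma limit_of_conjugate_cong:
  assumes "(y, z) \<in> bd.R" "limit_of_conjugate z"
  shows "limit_of_conjugate y"
proof -
  obtain \<gamma> h where h: "\<gamma> \<in> carrier G" "range h \<subseteq> H" "(z, \<lambda>n. \<phi> (\<gamma> \<otimes> h n \<otimes> inv \<gamma>) x) \<in> bd.R"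
    using assms(2) unfolding limit_of_conjugate_def by auto
  have "trans bd.R" using bd.equiv_R by (rule equivE)
  then have "(y, \<lambda>n. \<phi> (\<gamma> \<otimes> h n \<otimes> inv \<gamma>) x) \<in> bd.R" using assms(1) h(3) by (rule transD)
  then show ?thesis using h(1,2) unfolding limit_of_conjugate_def by auto
qed

lemma dist_tendsto:
  assumes "y \<in> bd.S"
  shows "\<exists>N. \<forall>n\<ge>N. r \<le> gdist E x (y n)"
proof -
  obtain N where "\<forall>i\<ge>N. \<forall>j\<ge>N. r \<le> gromov_product (gdist E) x (y i) (y j)" using assms bd.in_S by meson
  then have "\<forall>n\<ge>N. r \<le> gromov_product (gdist E) x (y n) (y n)" by auto
  then show ?thesis by (auto simp: gromov_product_def gdist_sym[of E _ x])
qed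

text \<open>Replacing \<open>\<gamma> \<otimes> j n\<close> by
  \<open>\<gamma> \<otimes> j n \<otimes> inv \<gamma>\<close> moves the orbit point by the distance
  from \<open>x\<close> to \<open>\<phi> (inv \<gamma>) x\<close>, which does not depend on
  \<open>n\<close>, so the limit stays the same.\<close>

lemma coset_limit:
  assumes y: "y \<in> bd.S" and \<gamma>: "\<gamma> \<in> carrier G" and j: "\<And>k. j k \<in> H" "\<And>k. y k = \<phi> (\<gamma> \<otimes> j k) x"
  shows "limit_of_conjugate y"
proof -
  let ?z = "\<lambda>n. \<phi> (\<gamma> \<otimes> j n \<otimes> inv \<gamma>) x"
  have jG: "j n \<in> carrier G" for n using j(1) H_carrier by blast
  have yz: "gdist E (y n) (?z n) = gdist E x (\<phi> (inv \<gamma>) x)" for n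
    using gdist_act[of "\<gamma> \<otimes> j n" x "\<phi> (inv \<gamma>) x"] \<gamma> jG[of n] x by (simp add: j(2) composition_rule m_assoc)
  have "(y, ?z) \<in> bd.R"
  proof (rule bd.asymptotic[OF y])
    show "range ?z \<subseteq> V" using \<gamma> jG x by auto
    fix r
    obtain N where N: "\<forall>n\<ge>N. r + gdist E x (\<phi> (inv \<gamma>) x) \<le> gdist E x (y n)" using dist_tendsto[OF y] by blast
    have "r \<le> gromov_product (gdist E) x (y k) (?z k)" if "k \<ge> N" for k
      using hyp.dist_le_gp[of x "y k" "?z k"] N yz[of k] that bd.S_M[OF y] x \<gamma> jG by fastforce
    then show "\<exists>N. \<forall>k\<ge>N. \<exists>l\<ge>k. r \<le> gromov_product (gdist E) x (y l) (?z k)" by blast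
  qed
  then show ?thesis using \<gamma> j(1) unfolding limit_of_conjugate_def by blast
qed

text \<open>The orbit of the coset containing \<open>y n\<close> and \<open>p n\<close> passes near
  \<open>x\<close>, as their product at \<open>x\<close> is bounded; since it also contains
  \<open>y n\<close>, it passes near a fixed distant point \<open>r\<close> on the way to the limit.
  So finitely many cosets occur, and one of them contains a subsequence of \<open>y\<close>.\<close>

lemma common_coset_limit:
  assumes y: "y \<in> bd.S" and B: "\<And>n. n \<ge> m \<Longrightarrow> gromov_product (gdist E) x (y n) (p n) \<le> B"
    and coset: "\<And>n. n \<ge> m \<Longrightarrow> \<exists>g\<in>carrier G. \<exists>h\<in>H. \<exists>k\<in>H. y n = \<phi> (g \<otimes> h) x \<and> p n = \<phi> (g \<otimes> k) x"
  shows "limit_of_conjugate y"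
proof -
  obtain Q where Q0: "Q \<ge> 0" and Q: "\<And>g h k p. \<lbrakk>g \<in> carrier G; h \<in> H; k \<in> H; p \<in> V\<rbrakk> \<Longrightarrow> \<exists>l\<in>H.
    gdist E p (\<phi> (g \<otimes> l) x) \<le> gromov_product (gdist E) p (\<phi> (g \<otimes> h) x) (\<phi> (g \<otimes> k) x) + Q"
    using coset_quasiconvex by metis
  \<comment> \<open>\<open>\<bar>B\<bar> + Q\<close> for reaching the coset from \<open>x\<close>,
    \<open>\<delta>\<close> for passing from \<open>y M\<close> to \<open>y n\<close>, and another
    \<open>Q\<close> for reaching the coset from \<open>r\<close>.\<close>
  define B' where "B' = \<bar>B\<bar> + 2 * Q + \<delta>"
  have B'0: "0 \<le> B'" using Q0 hyp.delta_pos by (simp add: B'_def)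
  let ?F = "\<lambda>r. {\<gamma> \<in> carrier G. gdist E x (\<phi> \<gamma> x) \<le> B' \<and> (\<exists>k\<in>H. gdist E r (\<phi> (\<gamma> \<otimes> k) x) \<le> B')}"
  obtain L where L: "\<forall>r\<in>V. L \<le> gdist E x r \<longrightarrow> finite (?F r)"
    using finite_cosets_near[OF B'0] ..
  obtain m' where m': "\<forall>i\<ge>m'. \<forall>j\<ge>m'. \<bar>L\<bar> + 1 \<le> gromov_product (gdist E) x (y i) (y j)" using y bd.in_S by meson
  define M where "M = max m m'"
  have yV: "y n \<in> V" for n using bd.S_M[OF y] .
  obtain f N where f: "f 0 = x" "f N = y M" "real N = gdist E x (y M)" "\<forall>i\<le>N. f i \<in> V"
      "\<forall>i\<le>N. \<forall>j\<le>N. gdist E (f i) (f j) = \<bar>real i - real j\<bar>"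
    using hyp.discrete_geodesic[OF x yV] by metis
  have "\<bar>L\<bar> \<le> real (nat \<lceil>\<bar>L\<bar>\<rceil>)" "real (nat \<lceil>\<bar>L\<bar>\<rceil>) \<le> \<bar>L\<bar> + 1" by linarith+
  then obtain l :: nat where l: "\<bar>L\<bar> \<le> real l" "real l \<le> \<bar>L\<bar> + 1" by blast
  have "\<bar>L\<bar> + 1 \<le> gromov_product (gdist E) x (y M) (y M)" using m' by (simp add: M_def)
  then have "\<bar>L\<bar> + 1 \<le> real N" using hyp.gp_le_dist[OF x yV yV, of M M] f(3) by simp
  then have lN: "l \<le> N" using l by linarith
  define r where "r = f l"
  have r: "r \<in> V" "gdist E x r = l" using f lN by (auto simp: r_def)
  have "gdist E r (y M) = real N - real l" using f(2) f(5)[rule_format, of l N] lN by (simp add: r_def)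
  then have r0: "gromov_product (gdist E) r x (y M) = 0"
    using f(3) r(2) gdist_sym[of E r "y M"] by (simp add: gromov_product_def)
  have fin: "finite (?F r)" using L r(1,2) l(1) by simp
  have "\<exists>\<gamma>\<in>?F r. \<exists>j\<in>H. y n = \<phi> (\<gamma> \<otimes> j) x" if n: "n \<ge> M" for n
  proof -
    have nm: "n \<ge> m" "n \<ge> m'" using n by (auto simp: M_def)
    obtain g h k where g: "g \<in> carrier G" "h \<in> H" "k \<in> H" "y n = \<phi> (g \<otimes> h) x" "p n = \<phi> (g \<otimes> k) x"
      using coset[OF nm(1)] by blast
    obtain a where a: "a \<in> H" "gdist E x (\<phi> (g \<otimes> a) x) \<le> B + Q"
      using Q[OF g(1-3) x] B[OF nm(1)] g(4,5) by force
    have ax: "\<phi> (g \<otimes> a) x \<in> V" using g(1) a(1) H_carrier x by simp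
    \<comment> \<open>Products of late terms are at least \<open>\<bar>L\<bar> + 1\<close>, hence at
      least \<open>l\<close>: geodesics from \<open>x\<close> to \<open>y M\<close> and to
      \<open>y n\<close> have not yet separated at \<open>r\<close>.\<close>
    have "gromov_product (gdist E) r x (y n) \<le> 0 + \<delta>"
    proof (rule hyp.push_along[OF x r(1) yV yV])
      show "gromov_product (gdist E) r x (y M) \<le> 0" using r0 by simp
      show "gdist E x r \<le> gromov_product (gdist E) x (y M) (y n) + 0"
        using m'[rule_format, of M n] nm(2) r(2) l(2) by (simp add: M_def)
    qed
    then have "gromov_product (gdist E) r (\<phi> (g \<otimes> a) x) (y n) \<le> \<delta> + (B + Q)"
      using hyp.gp_lipschitz_left[OF r(1) ax x yV, of n] a(2) gdist_sym[of E x "\<phi> (g \<otimes> a) x"] by linarith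
    then obtain b where b: "b \<in> H" "gdist E r (\<phi> (g \<otimes> b) x) \<le> B'"
      using Q[OF g(1) a(1) g(2) r(1)] g(4) by (force simp: B'_def)
    \<comment> \<open>The representative \<open>g\<close> of the coset is arbitrary;
      \<open>g \<otimes> a\<close> is one that moves \<open>x\<close> by at most \<open>B'\<close>,
      as \<open>finite_cosets_near\<close> requires.\<close>
    let ?\<gamma> = "g \<otimes> a"
    have G: "a \<in> carrier G" "b \<in> carrier G" "h \<in> carrier G" using a b g H_carrier by auto
    have "g \<otimes> a \<otimes> (inv a \<otimes> b) = g \<otimes> b" "g \<otimes> a \<otimes> (inv a \<otimes> h) = g \<otimes> h"
      using g(1) G by (simp_all add: m_assoc) (simp_all add: m_assoc[symmetric])
    moreover have "inv a \<otimes> b \<in> H" "inv a \<otimes> h \<in> H"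
      using a b g by (auto intro!: subgroup.m_closed[OF H] subgroup.m_inv_closed[OF H])
    moreover have "gdist E x (\<phi> ?\<gamma> x) \<le> B'" using a(2) Q0 hyp.delta_pos by (simp add: B'_def)
    moreover have "?\<gamma> \<in> carrier G" using g(1) G by simp
    ultimately have "?\<gamma> \<in> ?F r" "y n = \<phi> (?\<gamma> \<otimes> (inv a \<otimes> h)) x"
      using b(2) g(4) by (auto intro!: bexI[of _ "inv a \<otimes> b"])
    then show ?thesis using \<open>inv a \<otimes> h \<in> H\<close> by blast
  qed
  then have "\<forall>n. \<exists>\<gamma>. n \<ge> M \<longrightarrow> \<gamma> \<in> ?F r \<and> (\<exists>j\<in>H. y n = \<phi> (\<gamma> \<otimes> j) x)" by blast
  from choice[OF this] obtain \<Gamma> where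
    \<Gamma>: "\<forall>n. n \<ge> M \<longrightarrow> \<Gamma> n \<in> ?F r \<and> (\<exists>j\<in>H. y n = \<phi> (\<Gamma> n \<otimes> j) x)" ..
  have "infinite {M..}"
    unfolding infinite_nat_iff_unbounded_le by (metis atLeast_iff nat_le_linear)
  moreover have "finite (\<Gamma> ` {M..})" by (rule finite_subset[OF _ fin]) (use \<Gamma> in auto)
  ultimately obtain n0 where n0: "n0 \<in> {M..}" "infinite {n \<in> {M..}. \<Gamma> n = \<Gamma> n0}"
    using pigeonhole_infinite by blast
  have "\<exists>n\<ge>k. n \<ge> M \<and> \<Gamma> n = \<Gamma> n0" for k
    using n0(2) unfolding infinite_nat_iff_unbounded_le by blast
  then obtain s where s: "\<And>k. s k \<ge> k" "\<And>k. s k \<ge> M" "\<And>k. \<Gamma> (s k) = \<Gamma> n0" by metis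
  have "\<exists>j. j \<in> H \<and> (y \<circ> s) k = \<phi> (\<Gamma> n0 \<otimes> j) x" for k
    using \<Gamma>[rule_format, OF s(2)[of k]] s(3)[of k] by auto
  then obtain j where j: "\<And>k. j k \<in> H" "\<And>k. (y \<circ> s) k = \<phi> (\<Gamma> n0 \<otimes> j k) x" by metis
  have sub: "(y, y \<circ> s) \<in> bd.R" using s(1) by (rule bd.R_subseq[OF y])
  then have "y \<circ> s \<in> bd.S" by (simp add: bd.in_R)
  moreover have "\<Gamma> n0 \<in> carrier G" using \<Gamma> n0(1) by simp
  ultimately have "limit_of_conjugate (y \<circ> s)" using j by (rule coset_limit)
  then show ?thesis using limit_of_conjugate_cong[OF sub] by simp
qed

lemma cone_step:
  assumes "v \<in> V" "gdist cone_edges x v \<le> real (Suc D)"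
  shows "\<exists>u\<in>V. gdist cone_edges x u \<le> real D \<and> (v = u \<or> {v, u} \<in> cone_edges)"
proof (cases "gdist cone_edges x v \<le> real D")
  case False
  obtain f n where f: "f 0 = x" "f n = v" "real n = gdist cone_edges x v" "\<forall>i\<le>n. f i \<in> V" "\<forall>i<n. {f i, f (Suc i)} \<in> cone_edges"
      "\<forall>i\<le>n. \<forall>j\<le>n. gdist cone_edges (f i) (f j) = \<bar>real i - real j\<bar>"
    using cone.gdist_geodesic[OF x assms(1)] by metis
  have n: "n = Suc D" using False f(3) assms(2) by linarith
  then show ?thesis
    using f(1,2,4) f(5)[rule_format, of D] f(6)[rule_format, of 0 D]
    by (intro bexI[of _ "f D"]) (auto simp: insert_commute)
qed (use assms in auto)

text \<open>
  Acylindricity enters here: a sequence bounded in the cone-off converges to a limit point of a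
  conjugate of \<open>H\<close>. If the neighbours \<open>p n\<close> of \<open>y n\<close> that are closer to \<open>x\<close> in the cone-off have the
  same limit as a subsequence of \<open>y\<close>, the induction hypothesis applies. Otherwise the cosets joining
  \<open>y n\<close> to \<open>p n\<close> follow the ray to the limit for a long time, so that only finitely many occur.
\<close>

lemma cone_bounded_limit:
  assumes "y \<in> bd.S" "\<And>n. gdist cone_edges x (y n) \<le> real D"
  shows "limit_of_conjugate y"
  using assms
proof (induction D arbitrary: y)
  case 0
  have "y n = x" for n
  proof -
    obtain k where "gdist cone_edges x (y n) = real k" "(x, y n) \<in> edge_rel cone_edges ^^ k"
      using cone.gdist_relpow[OF x bd.S_M[OF 0(1)]] by metis
    then show ?thesis using 0(2)[of n] by simp
  qed
  then show ?case using dist_tendsto[OF 0(1), of 1] by auto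
next
  case (Suc D)
  note y = Suc.prems(1)
  have yV: "y n \<in> V" for n using bd.S_M[OF y] .
  obtain p where p: "\<And>n. p n \<in> V" "\<And>n. gdist cone_edges x (p n) \<le> real D" "\<And>n. y n = p n \<or> {y n, p n} \<in> cone_edges"
    using cone_step[OF yV Suc.prems(2)] by metis
  show ?case
  proof (cases "\<forall>k. \<exists>n\<ge>k. real k \<le> gromov_product (gdist E) x (y n) (p n)")
    case True
    then obtain s where s: "\<And>k. s k \<ge> k" "\<And>k. real k \<le> gromov_product (gdist E) x (y (s k)) (p (s k))" by metis
    have ys: "(y, y \<circ> s) \<in> bd.R" using s by (intro bd.R_subseq[OF y])
    then have "y \<circ> s \<in> bd.S" by (simp add: bd.in_R)
    then have sp: "(y \<circ> s, p \<circ> s) \<in> bd.R"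
    proof (rule bd.asymptotic)
      show "range (p \<circ> s) \<subseteq> V" using p(1) by auto
      fix r
      have "r \<le> gromov_product (gdist E) x ((y \<circ> s) k) ((p \<circ> s) k)" if "k \<ge> nat \<lceil>r\<rceil>" for k
        using s(2)[of k] that by simp
      then show "\<exists>N. \<forall>k\<ge>N. \<exists>l\<ge>k. r \<le> gromov_product (gdist E) x ((y \<circ> s) l) ((p \<circ> s) k)" by blast
    qed
    then have "p \<circ> s \<in> bd.S" by (simp add: bd.in_R)
    then have "limit_of_conjugate (p \<circ> s)" by (rule Suc.IH) (simp add: p(2))
    then show ?thesis using limit_of_conjugate_cong[OF ys] limit_of_conjugate_cong[OF sp] by blast
  next
    case False
    then obtain k where k: "\<And>n. n \<ge> k \<Longrightarrow> gromov_product (gdist E) x (y n) (p n) < real k" by force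
    obtain N where N: "\<forall>n\<ge>N. real k + 1 \<le> gdist E x (y n)" using dist_tendsto[OF y] by blast
    show ?thesis
    proof (rule common_coset_limit[OF y, of "max k N" p "real k"])
      fix n assume n: "n \<ge> max k N"
      then show "gromov_product (gdist E) x (y n) (p n) \<le> real k" using k[of n] by simp
      \<comment> \<open>The product is below \<open>k\<close> while \<open>y n\<close> is at
        distance at least \<open>k + 1\<close> from \<open>x\<close>. Points more than 1 apart span
        no edge of \<open>E\<close>, so the edge between them was added by coning off.\<close>
      have far: "1 < gdist E (y n) (p n)"
        using hyp.dist_le_gp[OF x yV p(1), of n n] N k[of n] n by fastforce
      then have "y n \<noteq> p n" by auto
      then have "{y n, p n} \<in> cone_edges" using p(3) by blast
      then show "\<exists>g\<in>carrier G. \<exists>h\<in>H. \<exists>k\<in>H. y n = \<phi> (g \<otimes> h) x \<and> p n = \<phi> (g \<otimes> k) x"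
      proof (cases rule: cone_edges_cases)
        case 1
        then show ?thesis using gdist_edge far by fastforce
      qed blast
    qed
  qed
qed

end

section \<open>The boundary of the cone-off\<close>

text \<open>Moving to vertices changes products by at most 3, once on each side of the inequality;
  hence \<open>\<delta> + 6\<close>.\<close>

lemma (in conn_graph) boundary_space_realization:
  assumes x: "x \<in> V" and \<delta>: "0 \<le> \<delta>"
    and hyp: "\<And>u v w. \<lbrakk>u \<in> V; v \<in> V; w \<in> V\<rbrakk> \<Longrightarrow>
      min (gromov_product (gdist E) x u v) (gromov_product (gdist E) x v w) - \<delta> \<le> gromov_product (gdist E) x u w"
  shows "boundary_space (realization V E) (graph_dist V E) (vertex_point x) (\<delta> + 6)"
proof
  show "0 \<le> \<delta> + 6" using \<delta> by simp
  fix p q r assume M: "p \<in> realization V E" "q \<in> realization V E"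
  note V = realization_supp(7)[OF M(1)] realization_supp(7)[OF M(2)]
  show "gromov_product (graph_dist V E) (vertex_point x) p q - (\<delta> + 6)
      \<le> gromov_product (graph_dist V E) (vertex_point x) q p"
    using gp_graph_dist[OF M x] gp_graph_dist[OF M(2,1) x] \<delta> gdist_sym[of E "near_vertex p" "near_vertex q"]
    by (simp add: gromov_product_def abs_le_iff field_simps)
  assume r: "r \<in> realization V E"
  show "min (gromov_product (graph_dist V E) (vertex_point x) p q) (gromov_product (graph_dist V E) (vertex_point x) q r) -
      (\<delta> + 6) \<le> gromov_product (graph_dist V E) (vertex_point x) p r"
    using hyp[OF V realization_supp(7)[OF r]] gp_graph_dist[OF M x] gp_graph_dist[OF M(2) r x]
      gp_graph_dist[OF M(1) r x] by linarith
qed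

context aqi_graph
begin

abbreviation "X \<equiv> realization V E"
abbreviation "dX \<equiv> graph_dist V E"
abbreviation "b \<equiv> vertex_point x"
abbreviation "conjugate_limits \<equiv>
  \<Union>g\<in>carrier G. limit_set X dX b (realization_action G V E \<phi>) ((g <# H) #> inv g)"

sublocale bX: boundary_space X dX b "\<delta> + 6"
  by (rule boundary_space_realization) (use x hyp.delta_pos hyp.four_point in auto)

lemma vertex_point_R_iff:
  assumes "range y \<subseteq> V" "range z \<subseteq> V"
  shows "(vertex_point \<circ> y, vertex_point \<circ> z) \<in> bX.R \<longleftrightarrow> (y, z) \<in> bd.R"
proof -
  have gp: "bX.P (vertex_point u) (vertex_point v) = bd.P u v" if "u \<in> V" "v \<in> V" for u v
    using gp_graph_dist_vertex_point[OF that x] .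
  have "y i \<in> V" "z i \<in> V" for i using assms by auto
  then show ?thesis by (auto simp: bX.in_R bX.in_S bd.in_R bd.in_S gp)
qed

lemma conjugate_action:
  assumes "g \<in> carrier G" "h \<in> H"
  shows "realization_action G V E \<phi> (g \<otimes> h \<otimes> inv g) b = vertex_point (\<phi> (g \<otimes> h \<otimes> inv g) x)"
  using assms H_carrier x by (simp add: realization_action_vertex_point)

lemma conjugate_coset: "(g <# H) #> inv g = {g \<otimes> h \<otimes> inv g |h. h \<in> H}"
  by (auto simp: l_coset_def r_coset_def)

lemma limit_of_conjugate_limits:
  assumes "limit_of_conjugate y"
  shows "bX.R `` {vertex_point \<circ> y} \<in> conjugate_limits"
proof -
  obtain g h where g: "g \<in> carrier G" and h: "range h \<subseteq> H"
    and R: "(y, \<lambda>n. \<phi> (g \<otimes> h n \<otimes> inv g) x) \<in> bd.R"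
    using assms by (auto simp: limit_of_conjugate_def)
  let ?z = "\<lambda>n. \<phi> (g \<otimes> h n \<otimes> inv g) x" and ?t = "\<lambda>n. g \<otimes> h n \<otimes> inv g"
  have "(vertex_point \<circ> y, vertex_point \<circ> ?z) \<in> bX.R"
    using R vertex_point_R_iff[of y ?z] by (auto simp: bd.in_R bd.in_S)
  moreover have z: "vertex_point \<circ> ?z = (\<lambda>n. realization_action G V E \<phi> (?t n) b)"
    using conjugate_action[OF g] h by (simp add: comp_def range_subsetD)
  ultimately have *: "(vertex_point \<circ> y, \<lambda>n. realization_action G V E \<phi> (?t n) b) \<in> bX.R" by simp
  then have "bX.R `` {vertex_point \<circ> y} = bX.R `` {\<lambda>n. realization_action G V E \<phi> (?t n) b}"
    by (rule equiv_class_eq[OF bX.equiv_R])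
  moreover have "range ?t \<subseteq> (g <# H) #> inv g" using h by (auto simp: conjugate_coset)
  moreover have "(\<lambda>n. realization_action G V E \<phi> (?t n) b) \<in> bX.S" using * by (simp add: bX.in_R)
  ultimately have "bX.R `` {vertex_point \<circ> y} \<in> limit_set X dX b (realization_action G V E \<phi>) ((g <# H) #> inv g)"
    unfolding limit_set_def by (intro CollectI exI[of _ ?t] conjI)
  then show ?thesis using g by (rule UN_I[rotated])
qed

text \<open>Go from \<open>x\<close> to \<open>\<phi> g x\<close>, across at most one cone edge to
  \<open>\<phi> (g \<otimes> h n) x\<close>, then along a translate of a path from \<open>x\<close>
  to \<open>\<phi> (inv g) x\<close>: the length has a bound independent of
  \<open>n\<close>.\<close>

lemma conjugate_limits_cone_bounded:
  assumes "\<xi> \<in> conjugate_limits"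
  shows "\<exists>z D. range z \<subseteq> V \<and> (\<forall>n. gdist cone_edges x (z n) \<le> D) \<and> \<xi> = bX.R `` {vertex_point \<circ> z} \<and> vertex_point \<circ> z \<in> bX.S"
proof -
  obtain g t where g: "g \<in> carrier G" and t: "range t \<subseteq> (g <# H) #> inv g"
    and S: "(\<lambda>n. realization_action G V E \<phi> (t n) b) \<in> bX.S"
    and \<xi>: "\<xi> = bX.R `` {\<lambda>n. realization_action G V E \<phi> (t n) b}"
    using assms unfolding limit_set_def by (elim UN_E CollectE exE conjE)
  have "\<exists>h\<in>H. t n = g \<otimes> h \<otimes> inv g" for n using t by (auto simp: conjugate_coset)
  then obtain h where h: "\<And>n. h n \<in> H" "\<And>n. t n = g \<otimes> h n \<otimes> inv g" by metis
  have hG: "h n \<in> carrier G" for n using h(1) H_carrier by blast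
  let ?z = "\<lambda>n. \<phi> (g \<otimes> h n \<otimes> inv g) x"
  have z: "(\<lambda>n. realization_action G V E \<phi> (t n) b) = vertex_point \<circ> ?z"
    by (rule ext) (simp add: conjugate_action[OF g h(1)] h(2))
  have zV: "?z n \<in> V" for n using g hG x by simp
  have "gdist cone_edges x (?z n) \<le> gdist E x (\<phi> g x) + 1 + gdist E x (\<phi> (inv g) x)" for n
  proof -
    have V: "\<phi> g x \<in> V" "\<phi> (g \<otimes> h n) x \<in> V" using g hG x by auto
    have "gdist cone_edges (\<phi> (g \<otimes> \<one>) x) (\<phi> (g \<otimes> h n) x) \<le> 1"
      using cone_dist_coset[OF g subgroup.one_closed[OF H] h(1)] .
    moreover have "gdist E (\<phi> (g \<otimes> h n) x) (?z n) = gdist E x (\<phi> (inv g) x)"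
      using gdist_act[of "g \<otimes> h n" x "\<phi> (inv g) x"] g hG[of n] x by (simp add: composition_rule m_assoc)
    ultimately show ?thesis
      using cone.gdist_tri[OF x V(1) zV[of n]] cone.gdist_tri[OF V zV[of n]] cone_dist_le[OF x V(1)]
        cone_dist_le[OF V(2) zV[of n]] g by simp
  qed
  then show ?thesis using z zV S \<xi> by (intro exI[of _ ?z] exI) auto
qed

lemma cone_off_boundary:
  "boundary_topology (realization V cone_edges) (graph_dist V cone_edges) b homeomorphic_space
    subtopology (boundary_topology X dX b) (gromov_boundary X dX b - conjugate_limits)"
proof -
  obtain C0 where C0: "C0 \<ge> 0" "\<forall>p\<in>V. \<forall>u\<in>V. \<forall>v\<in>V.
      gromov_product (gdist cone_edges) p u v \<le> gromov_product (gdist E) p u v + C0"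
    using cone_gp_le_gp by blast
  interpret ch: coned_hyperbolic V "gdist E" \<delta> "gdist cone_edges" C0
    by unfold_locales (use C0 cone_dist_le cone.gdist_tri in \<open>auto intro: gdist_sym\<close>)
  define c where "c = 3 * (2 * \<delta> + 1 + C0)"
  have c: "0 \<le> c" "C0 \<le> c" using hyp.delta_pos C0(1) by (auto simp: c_def)
  have cone_sym: "gromov_product (gdist cone_edges) x u v = gromov_product (gdist cone_edges) x v u" for u v
    by (simp add: gromov_product_def gdist_sym[of cone_edges u v])
  interpret b1: boundary_space "realization V cone_edges" "graph_dist V cone_edges" b "c + 6"
    by (rule cone.boundary_space_realization[OF x c(1)]) (use ch.cone_four_point[OF x] in \<open>simp add: c_def\<close>)
  have mono: "gromov_product (gdist cone_edges) x u v - c \<le> gromov_product (gdist cone_edges) x u w"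
    if "u \<in> V" "v \<in> V" "w \<in> V" "gromov_product (gdist E) x u v \<le> gromov_product (gdist E) x u w" for u v w
    using ch.cone_gp_mono(1)[OF x that(2,1,3)] that(4) hyp.gp_sym[of x u v] cone_sym[of u v] by (simp add: c_def)
  \<comment> \<open>A point inside an added edge has no counterpart in \<open>X\<close>, so it is
    moved to an end of its edge.\<close>
  let ?\<rho> = "\<lambda>p. vertex_point (near_vertex p)"
  have nV: "near_vertex p \<in> V" if "p \<in> realization V cone_edges" for p
    using cone.realization_supp(7)[OF that] .
  have gp1: "\<bar>b1.P p q - gromov_product (gdist cone_edges) x (near_vertex p) (near_vertex q)\<bar> \<le> 3"
    if "p \<in> realization V cone_edges" "q \<in> realization V cone_edges" for p q
    using cone.gp_graph_dist[OF that x] .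
  have gp2: "bX.P (vertex_point u) (vertex_point v) = bd.P u v" if "u \<in> V" "v \<in> V" for u v
    using gp_graph_dist_vertex_point[OF that x] .
  have le: "gromov_product (gdist cone_edges) x u v \<le> bd.P u v + c" if "u \<in> V" "v \<in> V" for u v
    using C0(2) x that c(2) by force
  interpret boundary_comparison "realization V cone_edges" "graph_dist V cone_edges" b "c + 6" X dX b "\<delta> + 6"
    ?\<rho> "c + 6" "gromov_boundary X dX b - conjugate_limits"
  proof
    fix p assume p: "p \<in> realization V cone_edges"
    then show "?\<rho> p \<in> X" using nV by simp
    fix q assume q: "q \<in> realization V cone_edges"
    show "b1.P p q \<le> bX.P (?\<rho> p) (?\<rho> q) + (c + 6)"
      using gp1[OF p q] gp2[OF nV[OF p] nV[OF q]] le[OF nV[OF p] nV[OF q]] by linarith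
    fix r assume r: "r \<in> realization V cone_edges" "bX.P (?\<rho> p) (?\<rho> q) \<le> bX.P (?\<rho> p) (?\<rho> r)"
    then show "b1.P p q - (c + 6) \<le> b1.P p r"
      using mono[OF nV[OF p] nV[OF q] nV[OF r(1)]] gp2 nV p q gp1[OF p q] gp1[OF p r(1)] by fastforce
  next
    fix q assume q: "q \<in> realization V cone_edges"
    have "bX.P (?\<rho> p) (?\<rho> q) \<le> gdist E x (near_vertex q)" if "p \<in> realization V cone_edges" for p
      using gp2[OF nV[OF that] nV[OF q]] hyp.gp_le_dist[OF x nV[OF q] nV[OF that]]
        hyp.gp_sym[of x "near_vertex p" "near_vertex q"] by simp
    then show "\<exists>B. \<forall>p\<in>realization V cone_edges. bX.P (?\<rho> p) (?\<rho> q) \<le> B" by blast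
  next
    fix y assume y: "y \<in> b1.S"
    define u where "u = near_vertex \<circ> y"
    have uV: "u i \<in> V" for i using nV b1.S_M[OF y] by (simp add: u_def)
    have u: "\<exists>N. \<forall>i\<ge>N. \<forall>j\<ge>N. r \<le> gromov_product (gdist cone_edges) x (u i) (u j)" for r
    proof -
      obtain N where "\<forall>i\<ge>N. \<forall>j\<ge>N. r + 3 \<le> b1.P (y i) (y j)" using y b1.in_S by meson
      then have "r \<le> gromov_product (gdist cone_edges) x (u i) (u j)" if "i \<ge> N" "j \<ge> N" for i j
        using gp1[OF b1.S_M[OF y] b1.S_M[OF y], of i j] that by (force simp: u_def)
      then show ?thesis by blast
    qed
    have "\<exists>N. \<forall>i\<ge>N. \<forall>j\<ge>N. r \<le> bd.P (u i) (u j)" for r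
    proof -
      obtain N where "\<forall>i\<ge>N. \<forall>j\<ge>N. r + c \<le> gromov_product (gdist cone_edges) x (u i) (u j)" using u by blast
      then have "r \<le> bd.P (u i) (u j)" if "i \<ge> N" "j \<ge> N" for i j using le[OF uV uV, of i j] that by force
      then show ?thesis by blast
    qed
    then have "u \<in> bd.S" using uV by (auto simp: bd.in_S)
    then have "(u, u) \<in> bd.R" using bd.class_boundary by blast
    then have "(vertex_point \<circ> u, vertex_point \<circ> u) \<in> bX.R" using vertex_point_R_iff uV by blast
    then have uX: "vertex_point \<circ> u \<in> bX.S" by (simp add: bX.in_R)
    \<comment> \<open>If the class contained a sequence \<open>z\<close> bounded in the cone-off,
      then for large \<open>i\<close> the product of \<open>u i\<close> and \<open>z i\<close> in
      the graph would be at least that of \<open>u i\<close> and a fixed \<open>u N\<close>. By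
      monotonicity their cone-off product would exceed \<open>D\<close>, yet it is at most the
      cone-off distance from \<open>x\<close> to \<open>z i\<close>.\<close>
    have "bX.R `` {vertex_point \<circ> u} \<notin> conjugate_limits"
    proof
      assume "bX.R `` {vertex_point \<circ> u} \<in> conjugate_limits"
      then obtain z D where z: "range z \<subseteq> V" "\<forall>n. gdist cone_edges x (z n) \<le> D"
        "bX.R `` {vertex_point \<circ> u} = bX.R `` {vertex_point \<circ> z}" "vertex_point \<circ> z \<in> bX.S"
        using conjugate_limits_cone_bounded by blast
      then have "(vertex_point \<circ> u, vertex_point \<circ> z) \<in> bX.R" using bX.class_boundary[OF z(4)] by blast
      then have uz: "(u, z) \<in> bd.R" using vertex_point_R_iff z(1) uV by blast
      obtain N where N: "\<forall>i\<ge>N. \<forall>j\<ge>N. D + c + 1 \<le> gromov_product (gdist cone_edges) x (u i) (u j)" using u by blast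
      obtain N' where N': "\<forall>i\<ge>N'. \<forall>j\<ge>N'. gdist E x (u N) \<le> bd.P (u i) (z j)" using uz bd.in_R by meson
      let ?i = "max N N'"
      have zV: "z ?i \<in> V" using z(1) by auto
      have "bd.P (u ?i) (u N) \<le> gdist E x (u N)"
        using hyp.gp_le_dist[OF x uV uV, of N ?i] hyp.gp_sym[of x "u N" "u ?i"] by simp
      then have "bd.P (u ?i) (u N) \<le> bd.P (u ?i) (z ?i)" using N'[rule_format, of ?i ?i] by simp
      then have "gromov_product (gdist cone_edges) x (u ?i) (u N) - c \<le> gromov_product (gdist cone_edges) x (u ?i) (z ?i)"
        using mono[OF uV uV zV] by blast
      moreover have "D + c + 1 \<le> gromov_product (gdist cone_edges) x (u ?i) (u N)" using N by simp
      moreover have "gromov_product (gdist cone_edges) x (u ?i) (z ?i) \<le> gdist cone_edges x (z ?i)"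
        using cone.gdist_tri[OF uV[of ?i] zV x] cone.gdist_tri[OF uV[of ?i] zV x] gdist_sym[of cone_edges x "z ?i"]
        by (simp add: gromov_product_def)
      ultimately show False using z(2)[rule_format, of ?i] by linarith
    qed
    moreover have "?\<rho> \<circ> y = vertex_point \<circ> u" by (auto simp: u_def)
    ultimately show "bX.R `` {?\<rho> \<circ> y} \<in> gromov_boundary X dX b - conjugate_limits"
      using bX.class_boundary[OF uX] by auto
  next
    fix \<xi> assume \<xi>: "\<xi> \<in> gromov_boundary X dX b - conjugate_limits"
    then obtain q where q: "q \<in> \<xi>" using bX.boundary_nonempty by blast
    have qS: "q \<in> bX.S" "\<xi> = bX.R `` {q}" using bX.boundary_class \<xi> q by auto
    define u where "u = near_vertex \<circ> q"
    have uV: "u i \<in> V" for i using realization_supp(7) bX.S_M[OF qS(1)] by (simp add: u_def)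
    have "(q, vertex_point \<circ> u) \<in> bX.R"
    proof (rule bX.asymptotic[OF qS(1)])
      show "range (vertex_point \<circ> u) \<subseteq> X" using uV by auto
      fix r
      obtain N where N: "\<forall>i\<ge>N. \<forall>j\<ge>N. r + 6 \<le> bX.P (q i) (q j)" using qS(1) bX.in_S by meson
      have "r \<le> bX.P (q k) ((vertex_point \<circ> u) k)" if "k \<ge> N" for k
      proof -
        have qk: "q k \<in> X" "vertex_point (u k) \<in> X" using bX.S_M[OF qS(1)] uV by auto
        have "near_vertex (q k) = u k" by (simp add: u_def)
        then show ?thesis
          using gp_graph_dist[OF qk x] gp_graph_dist[OF qk(1,1) x] N[rule_format, OF that that] by simp
      qed
      then show "\<exists>N. \<forall>k\<ge>N. \<exists>l\<ge>k. r \<le> bX.P (q l) ((vertex_point \<circ> u) k)" by blast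
    qed
    then have u\<xi>: "vertex_point \<circ> u \<in> \<xi>" using qS by blast
    then have uX: "vertex_point \<circ> u \<in> bX.S" "\<xi> = bX.R `` {vertex_point \<circ> u}" using bX.boundary_class \<xi> by auto
    then have uS: "u \<in> bd.S"
      using vertex_point_R_iff[of u u] uV bX.class_boundary[OF uX(1)] by (auto simp: bd.in_R)
    \<comment> \<open>Otherwise there are pairs of ever later terms with bounded cone-off product,
      and their centres \<open>v n\<close> in the graph are at bounded cone-off distance from
      \<open>x\<close>. Since the products of these pairs in the graph tend to infinity, the centres
      converge to the same point as \<open>u\<close>, and \<open>cone_bounded_limit\<close> applies
      to them.\<close>
    have cone: "\<exists>N. \<forall>i\<ge>N. \<forall>j\<ge>N. r \<le> gromov_product (gdist cone_edges) x (u i) (u j)" for r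
    proof (rule ccontr)
      assume "\<not> (\<exists>N. \<forall>i\<ge>N. \<forall>j\<ge>N. r \<le> gromov_product (gdist cone_edges) x (u i) (u j))"
      then have "\<forall>N. \<exists>i j. i \<ge> N \<and> j \<ge> N \<and> gromov_product (gdist cone_edges) x (u i) (u j) < r" by (meson not_le)
      then obtain s t where st: "\<And>n. s n \<ge> n" "\<And>n. t n \<ge> n" "\<And>n. gromov_product (gdist cone_edges) x (u (s n)) (u (t n)) < r"
        by metis
      have "\<exists>v\<in>V. bd.P (u (s n)) (u (t n)) \<le> gdist E x v + 1 \<and> gromov_product (gdist E) v x (u (s n)) \<le> \<delta> + 1 \<and>
          gromov_product (gdist E) v x (u (t n)) \<le> \<delta> + 1" for n
        using hyp.center[OF x uV uV, of "s n" "t n"] by blast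
      then obtain v where v: "\<And>n. v n \<in> V" "\<And>n. bd.P (u (s n)) (u (t n)) \<le> gdist E x (v n) + 1"
        "\<And>n. gromov_product (gdist E) (v n) x (u (s n)) \<le> \<delta> + 1"
        "\<And>n. gromov_product (gdist E) (v n) x (u (t n)) \<le> \<delta> + 1" by metis
      have us: "(u, u \<circ> s) \<in> bd.R" using st(1) by (rule bd.R_subseq[OF uS])
      then have "u \<circ> s \<in> bd.S" by (simp add: bd.in_R)
      then have sv: "(u \<circ> s, v) \<in> bd.R"
      proof (rule bd.asymptotic)
        show "range v \<subseteq> V" using v(1) by auto
        fix a
        obtain N where N: "\<forall>i\<ge>N. \<forall>j\<ge>N. a + \<delta> + 2 \<le> bd.P (u i) (u j)" using uS bd.in_S by meson
        have "a \<le> bd.P ((u \<circ> s) k) (v k)" if "k \<ge> N" for k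
        proof -
          have "s k \<ge> N" "t k \<ge> N" using st(1,2)[of k] that by linarith+
          then have "a + \<delta> + 2 \<le> gdist E x (v k) + 1" using N v(2)[of k] by force
          moreover have "bd.P (u (s k)) (v k) = gdist E x (v k) - gromov_product (gdist E) (v k) x (u (s k))"
            using gdist_sym[of E x "v k"] gdist_sym[of E x "u (s k)"]
            by (simp add: gromov_product_def field_simps)
          ultimately show ?thesis using v(3)[of k] by simp
        qed
        then show "\<exists>N. \<forall>k\<ge>N. \<exists>l\<ge>k. a \<le> bd.P ((u \<circ> s) l) (v k)" by blast
      qed
      then have vS: "v \<in> bd.S" by (simp add: bd.in_R)
      have "gdist cone_edges x (v n) \<le> real (nat \<lceil>r + 2 * (\<delta> + 1 + C0)\<rceil>)" for n
        using ch.cone_center[OF x v(1) uV uV v(3,4), of n] st(3)[of n] by linarith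
      then have "limit_of_conjugate v" by (rule cone_bounded_limit[OF vS])
      then have "limit_of_conjugate u" using limit_of_conjugate_cong us sv by blast
      then show False using limit_of_conjugate_limits uX(2) \<xi> by auto
    qed
    have "vertex_point \<circ> u \<in> b1.S"
      unfolding b1.in_S
    proof (intro conjI allI)
      show "range (vertex_point \<circ> u) \<subseteq> realization V cone_edges" using uV by auto
      show "\<exists>N. \<forall>i\<ge>N. \<forall>j\<ge>N. r \<le> b1.P ((vertex_point \<circ> u) i) ((vertex_point \<circ> u) j)" for r
        using cone[of r] cone.gp_graph_dist_vertex_point[OF uV uV x] by simp
    qed
    moreover have "?\<rho> \<circ> (vertex_point \<circ> u) = vertex_point \<circ> u" by auto
    ultimately show "\<exists>y\<in>b1.S. ?\<rho> \<circ> y \<in> \<xi>" using u\<xi> by metis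
  qed auto
  show ?thesis by (rule homeomorphic_boundary)
qed

end

section \<open>Transfer of the hypotheses to the vertex \<open>x\<close>\<close>

theorem theorem1p6:
  fixes G :: "('g, 'm) monoid_scheme" and H :: "'g set"
    and V :: "'v set" and E :: "'v set set"
    and \<phi> :: "'g \<Rightarrow> 'v \<Rightarrow> 'v" and x :: 'v
  defines "X \<equiv> realization V E"
    and "dX \<equiv> graph_dist V E"
    and "\<psi> \<equiv> realization_action G V E \<phi>"
    and "E' \<equiv> cone_off E (coset_orbits G \<phi> H x)"
    and "b \<equiv> vertex_point x"
  assumes graph: "connected_graph V E"
    and action: "acts_by_graph_automorphisms G V E \<phi>"
    and triple: "AQI_triple G X dX \<psi> H"
    and vertex: "x \<in> V"
  shows "boundary_topology (realization V E') (graph_dist V E') b homeomorphic_space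
    subtopology (boundary_topology X dX b)
      (gromov_boundary X dX b -
        (\<Union>g\<in>carrier G. limit_set X dX b \<psi> ((g <#\<^bsub>G\<^esub> H) #>\<^bsub>G\<^esub> inv\<^bsub>G\<^esub> g)))"
proof -
  interpret cg: conn_graph V E by unfold_locales (rule graph)
  have "group_action G V \<phi>" using action by (simp add: acts_by_graph_automorphisms_def)
  then interpret act: group_action G V \<phi> .
  interpret ga: graph_action V E G \<phi>
    by unfold_locales (use action in \<open>auto simp: acts_by_graph_automorphisms_def\<close>)
  have H: "subgroup H G" using triple by (simp add: AQI_triple_def)
  have metric: "Metric_space X dX" and hyp: "gromov_hyperbolic X dX" and iso: "isometric_action G X dX \<psi>"
    using triple by (simp_all add: AQI_triple_def hyperbolic_space_def)
  interpret MX: Metric_space X dX by (rule metric)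
  have HG: "h \<in> carrier G" if "h \<in> H" for h using H that by (rule subgroup.mem_carrier)
  have actX: "group_action G X \<psi>" using iso by (simp add: isometric_action_def)
  have \<psi>X: "\<psi> g p \<in> X" if "g \<in> carrier G" "p \<in> X" for g p
    using group_action.element_image[OF actX that] by blast
  have \<psi>iso: "dX (\<psi> g p) (\<psi> g q) = dX p q" if "g \<in> carrier G" "p \<in> X" "q \<in> X" for g p q
    using iso that by (simp add: isometric_action_def)
  have \<psi>v: "\<psi> g (vertex_point v) = vertex_point (\<phi> g v)" if "g \<in> carrier G" "v \<in> V" for g v
    unfolding \<psi>_def using that by (rule ga.realization_action_vertex_point)
  have vX: "vertex_point v \<in> X" if "v \<in> V" for v using that by (simp add: X_def)
  have dv: "dX (vertex_point u) (vertex_point v) = gdist E u v" if "u \<in> V" "v \<in> V" for u v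
    unfolding dX_def using that by (rule cg.graph_dist_vertex_point)
  obtain \<delta> where \<delta>: "\<delta> \<ge> 0" "\<And>w u v z. \<lbrakk>w \<in> X; u \<in> X; v \<in> X; z \<in> X\<rbrakk> \<Longrightarrow>
     gromov_product dX w u z \<ge> min (gromov_product dX w u v) (gromov_product dX w v z) - \<delta>"
    using hyp unfolding gromov_hyperbolic_def by blast
  have gp: "gromov_product dX (vertex_point p) (vertex_point u) (vertex_point v) = gromov_product (gdist E) p u v"
    if "p \<in> V" "u \<in> V" "v \<in> V" for p u v
    using that by (simp add: gromov_product_def dv)
  \<comment> \<open>The locale asks for a positive constant, whereas \<open>\<delta>\<close> may be
    0.\<close>
  have coarse: "coarse_hyperbolic V (gdist E) (\<delta> + 1)"
  proof
    fix p u v w assume V: "p \<in> V" "u \<in> V" "v \<in> V" "w \<in> V"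
    then show "min (gromov_product (gdist E) p u v) (gromov_product (gdist E) p v w) - (\<delta> + 1)
        \<le> gromov_product (gdist E) p u w"
      using \<delta>(2)[OF vX[OF V(1)] vX[OF V(2)] vX[OF V(3)] vX[OF V(4)]] by (simp add: gp)
  next
    fix u v assume V: "u \<in> V" "v \<in> V"
    from cg.gdist_geodesic[OF this] show "\<exists>f n. f 0 = u \<and> f n = v \<and> real n = gdist E u v \<and>
      (\<forall>i\<le>n. f i \<in> V) \<and> (\<forall>i\<le>n. \<forall>j\<le>n. gdist E (f i) (f j) = \<bar>real i - real j\<bar>)" by blast
  qed (use \<delta> cg.gdist_tri in \<open>auto intro: gdist_sym\<close>)
  have bX: "b \<in> X" unfolding b_def by (rule vX[OF vertex])
  have orb: "\<psi> g b = vertex_point (\<phi> g x)" if "g \<in> carrier G" for g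
    unfolding b_def by (rule \<psi>v[OF that vertex])
  obtain x0 where x0: "x0 \<in> X" "acylindrical_along G dX \<psi> ((\<lambda>h. \<psi> h x0) ` H)"
    using triple unfolding AQI_triple_def acylindrical_along_subgroup_def by blast
  obtain S x1 where S: "finite_generating_set G S H" and x1: "x1 \<in> X"
    and qi1: "quasi_isometric_embedding H (word_metric G S) X dX (\<lambda>h. \<psi> h x1)"
    using triple unfolding AQI_triple_def qi_embedded_by_action_def by blast
  obtain K C where KC: "K \<ge> 1" "C \<ge> 0" and qi: "\<And>a c. \<lbrakk>a \<in> H; c \<in> H\<rbrakk> \<Longrightarrow>
      word_metric G S a c / K - C \<le> dX (\<psi> a x1) (\<psi> c x1) \<and> dX (\<psi> a x1) (\<psi> c x1) \<le> K * word_metric G S a c + C"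
    using qi1 unfolding quasi_isometric_embedding_def by blast
  \<comment> \<open>Acylindricity and the quasi-isometric embedding are each given at some point of
    the realization, possibly different from \<open>b\<close>; passing to \<open>b\<close> changes
    distances within an orbit by at most twice the distance between the base points.\<close>
  have move: "\<bar>dX (\<psi> g p) (\<psi> h p) - dX (\<psi> g b) (\<psi> h b)\<bar> \<le> 2 * dX b p"
    if "g \<in> carrier G" "h \<in> carrier G" "p \<in> X" for g h p
  proof -
    have X: "\<psi> g p \<in> X" "\<psi> h p \<in> X" "\<psi> g b \<in> X" "\<psi> h b \<in> X" using \<psi>X that bX by auto
    have "dX (\<psi> g b) (\<psi> g p) = dX b p" "dX (\<psi> h b) (\<psi> h p) = dX b p" using \<psi>iso that bX by auto
    then show ?thesis
      using MX.triangle[OF X(1,3,2)] MX.triangle[OF X(3,4,2)] MX.triangle[OF X(3,1,4)] MX.triangle[OF X(1,2,4)]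
        MX.commute[of "\<psi> g b" "\<psi> g p"] MX.commute[of "\<psi> h b" "\<psi> h p"] by linarith
  qed
  interpret aqi_graph V E G \<phi> "\<delta> + 1" H x S K "C + 2 * dX b x1"
  proof (intro aqi_graph.intro coarse aqi_graph_axioms.intro)
    show "graph_action V E G \<phi>" by unfold_locales
    show "subgroup H G" "x \<in> V" by (fact H, fact vertex)
    show "finite S" "S \<subseteq> H" "generate G S = H" using S by (auto simp: finite_generating_set_def)
    show "1 \<le> K" "0 \<le> C + 2 * dX b x1" using KC MX.nonneg by auto
  next
    fix a c assume ac: "a \<in> H" "c \<in> H"
    have "dX (\<psi> a b) (\<psi> c b) = gdist E (\<phi> a x) (\<phi> c x)"
      using orb HG ac dv vertex by simp
    then show "word_metric G S a c / K - (C + 2 * dX b x1) \<le> gdist E (\<phi> a x) (\<phi> c x) \<and>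
      gdist E (\<phi> a x) (\<phi> c x) \<le> K * word_metric G S a c + (C + 2 * dX b x1)"
      using qi[OF ac] move[OF HG[OF ac(1)] HG[OF ac(2)] x1] by linarith
  next
    fix \<epsilon> :: real assume \<epsilon>: "0 \<le> \<epsilon>"
    have nonneg: "0 \<le> dX b x0" by (rule MX.nonneg)
    define \<epsilon>' where "\<epsilon>' = \<epsilon> + 2 * dX b x0"
    have \<epsilon>'0: "0 \<le> \<epsilon>'" using \<epsilon> nonneg by (simp add: \<epsilon>'_def)
    obtain R where R: "\<And>p q. \<lbrakk>p \<in> (\<lambda>h. \<psi> h x0) ` H; q \<in> (\<lambda>h. \<psi> h x0) ` H; R \<le> dX p q\<rbrakk> \<Longrightarrow>
        finite {g \<in> carrier G. dX (\<psi> g p) p \<le> \<epsilon>' \<and> dX (\<psi> g q) q \<le> \<epsilon>'}"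
      using x0(2)[unfolded acylindrical_along_def, rule_format, OF \<epsilon>'0] by (elim exE conjE) (rule that, blast)
    have \<psi>comp: "\<psi> (g \<otimes>\<^bsub>G\<^esub> k) p = \<psi> g (\<psi> k p)" if "g \<in> carrier G" "k \<in> carrier G" "p \<in> X" for g k p
      using group_action.composition_rule[OF actX that(3,1,2)] .
    show "\<exists>R. \<forall>k\<in>H. R \<le> gdist E x (\<phi> k x) \<longrightarrow>
      finite {g \<in> carrier G. gdist E (\<phi> g x) x \<le> \<epsilon> \<and> gdist E (\<phi> g (\<phi> k x)) (\<phi> k x) \<le> \<epsilon>}"
    proof (intro exI[of _ "R + 2 * dX b x0"] ballI impI)
      fix k assume k: "k \<in> H" and far: "R + 2 * dX b x0 \<le> gdist E x (\<phi> k x)"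
      have kG: "k \<in> carrier G" and oneH: "\<one>\<^bsub>G\<^esub> \<in> H" using k HG subgroup.one_closed[OF H] by auto
      have oneG: "\<one>\<^bsub>G\<^esub> \<in> carrier G" using oneH HG by blast
      have "dX (\<psi> \<one>\<^bsub>G\<^esub> b) (\<psi> k b) = gdist E x (\<phi> k x)" using orb oneG kG dv vertex by simp
      then have "R \<le> dX (\<psi> \<one>\<^bsub>G\<^esub> x0) (\<psi> k x0)" using far move[OF oneG kG x0(1)] by linarith
      then have "finite {g \<in> carrier G. dX (\<psi> g (\<psi> \<one>\<^bsub>G\<^esub> x0)) (\<psi> \<one>\<^bsub>G\<^esub> x0) \<le> \<epsilon>' \<and> dX (\<psi> g (\<psi> k x0)) (\<psi> k x0) \<le> \<epsilon>'}"
        using k oneH by (intro R) auto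
      moreover have "{g \<in> carrier G. gdist E (\<phi> g x) x \<le> \<epsilon> \<and> gdist E (\<phi> g (\<phi> k x)) (\<phi> k x) \<le> \<epsilon>} \<subseteq>
        {g \<in> carrier G. dX (\<psi> g (\<psi> \<one>\<^bsub>G\<^esub> x0)) (\<psi> \<one>\<^bsub>G\<^esub> x0) \<le> \<epsilon>' \<and> dX (\<psi> g (\<psi> k x0)) (\<psi> k x0) \<le> \<epsilon>'}"
      proof
        fix g assume "g \<in> {g \<in> carrier G. gdist E (\<phi> g x) x \<le> \<epsilon> \<and> gdist E (\<phi> g (\<phi> k x)) (\<phi> k x) \<le> \<epsilon>}"
        then have g: "g \<in> carrier G" "gdist E (\<phi> g x) x \<le> \<epsilon>" "gdist E (\<phi> g (\<phi> k x)) (\<phi> k x) \<le> \<epsilon>" by auto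
        have bound: "dX (\<psi> g (\<psi> h x0)) (\<psi> h x0) \<le> \<epsilon>'"
          if h: "h \<in> carrier G" "gdist E (\<phi> g (\<phi> h x)) (\<phi> h x) \<le> \<epsilon>" for h
        proof -
          have gh: "g \<otimes>\<^bsub>G\<^esub> h \<in> carrier G" using g(1) h(1) by simp
          have "dX (\<psi> (g \<otimes>\<^bsub>G\<^esub> h) b) (\<psi> h b) = gdist E (\<phi> g (\<phi> h x)) (\<phi> h x)"
            using orb[OF gh] orb[OF h(1)] g(1) h(1) vertex dv by (simp add: act.composition_rule)
          then show ?thesis
            using move[OF gh h(1) x0(1)] h(2) \<psi>comp[OF g(1) h(1) x0(1)] by (simp add: \<epsilon>'_def)
        qed
        have "gdist E (\<phi> g (\<phi> \<one>\<^bsub>G\<^esub> x)) (\<phi> \<one>\<^bsub>G\<^esub> x) \<le> \<epsilon>" using g(2) vertex by simp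
        then show "g \<in> {g \<in> carrier G. dX (\<psi> g (\<psi> \<one>\<^bsub>G\<^esub> x0)) (\<psi> \<one>\<^bsub>G\<^esub> x0) \<le> \<epsilon>' \<and> dX (\<psi> g (\<psi> k x0)) (\<psi> k x0) \<le> \<epsilon>'}"
          using bound[OF oneG] bound[OF kG g(3)] g(1) by blast
      qed
      ultimately show "finite {g \<in> carrier G. gdist E (\<phi> g x) x \<le> \<epsilon> \<and> gdist E (\<phi> g (\<phi> k x)) (\<phi> k x) \<le> \<epsilon>}"
        by (rule finite_subset[rotated])
    qed
  qed
  show ?thesis
    using cone_off_boundary unfolding cone_edges_def E'_def X_def dX_def b_def \<psi>_def .
qed

end
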